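(* Let $E=\mathbb{R}^d$, $F=\{1,\dots,J\}$ a finite set, and $\Theta=\mathcal{P}(F)$ the set of probability measures on $F$, with $\theta_i:=\theta(\{i\})$. Let $$\Lambda(x,p,\theta)=\sum_{i\in F}\left[\langle a(x,i)p,p\rangle+\langle b(x,i),p\rangle\right]\theta_i,\qquad \mathcal{I}(x,\theta)=\sup_{w\in\mathbb{R}^J}\sum_{i,j}r(i,j,x)\theta_i\left[1-e^{w_j-w_i}\right],$$ where $a:E\times F\to\mathbb{R}^{d\times d}$, $b:E\times F\to\mathbb{R}^d$ and $r:F^2\times E\to[0,\infty)$ satisfy: (1) $r(i,j,\cdot)$ is continuous on $E$ for all $i,j$; for each $x\in E$ the matrix $R(x)$ with $R(x)_{ij}=r(i,j,x)$ for $i\ne j$ and $R(x)_{ii}=-\sum_{j\neq i}r(i,j,x)$ is irreducible; and for each pair $(i,j)$ either $r(i,j,\cdot)\equiv0$ or $\inf_{x\in K}r(i,j,x)>0$ for each compact $K\subseteq E$. (2) $a$ and $b$ are continuous; for every compact $K\subseteq\mathbb{R}^d$, $\inf_{x\in K,i\in F,|p|=1}\langle a(x,i)p,p\rangle>0$, $\sup_{x\in K,i\in F,|p|=1}\langle a(x,i)p,p\rangle<\infty$ and $\sup_{x\in K,i\in F,|p|=1}|\langle b(x,i),p\rangle|<\infty$; there is $L>0$ with $\|a(x,i)-a(y,i)\|\le L|x-y|$ for all $x,y\in E$, $i\in F$; and the functions $b(\cdot,i)$ are one-sided Lipschitz. Let $\mathcal{H}(x,p)=\sup_{\theta\in\Theta}[\Lambda(x,p,\theta)-\mathcal{I}(x,\theta)]$,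 $\mathbf{H}f(x)=\mathcal{H}(x,\nabla f(x))$ with domain $\mathcal{D}(\mathbf{H})=C_{cc}^\infty(E)$, and $\mathcal{L}(x,v)=\sup_{p\in\mathbb{R}^d}[\langle p,v\rangle-\mathcal{H}(x,p)]$. Then: (a) for every $f\in C_{cc}^\infty(E)$ the map $x\mapsto\mathbf{H}f(x)$ is continuous; (b) for all $h\in C_b(E)$ and $\lambda>0$ the comparison principle holds for $f-\lambda\mathbf{H}f=h$: every viscosity subsolution $u$ and every viscosity supersolution $v$ satisfy $u\le v$; (c) for all $h\in C_b(E)$ and $\lambda>0$, the function $$R(\lambda)h(x)=\sup_{\substack{\gamma\in\mathcal{AC}\\ \gamma(0)=x}}\int_0^\infty\lambda^{-1}e^{-\lambda^{-1}t}\left[h(\gamma(t))-\int_0^t\mathcal{L}(\gamma(s),\dot\gamma(s))\,\mathrm{d}s\right]\mathrm{d}t$$ is the unique viscosity solution to $f-\lambda\mathbf{H}f=h$, where $\mathcal{AC}$ is the collection of absolutely continuous paths $\gamma:[0,\infty)\to E$.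
   Context: $C_b(E)$: bounded continuous functions on $E$. $C_{cc}^\infty(E)$: smooth functions on $E$ that are constant outside a compact set. The functions $b(\cdot,i)$ are one-sided Lipschitz if there is a constant $M$ with $\langle b(x,i)-b(y,i),x-y\rangle\le M|x-y|^2$ for all $x,y\in E$, $i\in F$. **Viscosity solutions.** Let $A:\mathcal{D}(A)\subseteq C_b(E)\to C_b(E)$, $\lambda>0$, $h\in C_b(E)$. A function $u:E\to\mathbb{R}$ is a (viscosity) subsolution of $f-\lambda Af=h$ if $u$ is bounded from above, upper semi-continuous, and for every $f\in\mathcal{D}(A)$ there is a sequence $x_n\in E$ with $\lim_n u(x_n)-f(x_n)=\sup_x u(x)-f(x)$ and $\lim_n u(x_n)-\lambda Af(x_n)-h(x_n)\le0$. A function $v:E\to\mathbb{R}$ is a (viscosity) supersolution if $v$ is bounded from below, lower semi-continuous, and for every $f\in\mathcal{D}(A)$ there is a sequence $x_n\in E$ with $\lim_n v(x_n)-f(x_n)=\inf_x v(x)-f(x)$ and $\lim_n v(x_n)-\lambda Af(x_n)-h(x_n)\ge0$. A (viscosity) solution is a function that is both a subsolution and a supersolution. *)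

theory Defs
  imports "HOL-Analysis.Analysis" "HOL-Probability.Probability_Mass_Function"
begin

primrec Ck :: "nat \<Rightarrow> ('a::euclidean_space \<Rightarrow> real) \<Rightarrow> bool" where
  "Ck 0 f \<longleftrightarrow> continuous_on UNIV f"
| "Ck (Suc k) f \<longleftrightarrow> (\<forall>x. f differentiable (at x)) \<and>
     (\<forall>v. Ck k (\<lambda>x. frechet_derivative f (at x) v))"

definition smooth :: "('a::euclidean_space \<Rightarrow> real) \<Rightarrow> bool" where
  "smooth f \<longleftrightarrow> (\<forall>k. Ck k f)"

definition Ccc_smooth :: "('a::euclidean_space \<Rightarrow> real) set" where
  "Ccc_smooth = {f. smooth f \<and> (\<exists>K c. compact K \<and> (\<forall>x. x \<notin> K \<longrightarrow> f x = c))}"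

definition grad :: "('a::euclidean_space \<Rightarrow> real) \<Rightarrow> 'a \<Rightarrow> 'a" where
  "grad f x = (THE D. GDERIV f x :> D)"

definition usc :: "('a::topological_space \<Rightarrow> real) \<Rightarrow> bool" where
  "usc u \<longleftrightarrow> (\<forall>c. open {x. u x < c})"

definition lsc :: "('a::topological_space \<Rightarrow> real) \<Rightarrow> bool" where
  "lsc v \<longleftrightarrow> (\<forall>c. open {x. c < v x})"

text \<open>
  An operator on bounded continuous functions is given by its domain \<open>D\<close> (a set of bounded
  continuous functions) and a map \<open>A\<close>, of which only the values on \<open>D\<close> matter. Since \<open>u\<close> is bounded
  from above and \<open>f\<close> is bounded, the real supremum below is a genuine one; dually for \<open>v\<close>.
\<close>

definition viscosity_subsolution ::
    "('a::topological_space \<Rightarrow> real) set \<Rightarrow> (('a \<Rightarrow> real) \<Rightarrow> 'a \<Rightarrow> real) \<Rightarrow>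
     real \<Rightarrow> ('a \<Rightarrow> real) \<Rightarrow> ('a \<Rightarrow> real) \<Rightarrow> bool" where
  "viscosity_subsolution D A lam h u \<longleftrightarrow>
     bdd_above (range u) \<and> usc u \<and>
     (\<forall>f\<in>D. \<exists>(x :: nat \<Rightarrow> 'a) l.
        (\<lambda>n. u (x n) - f (x n)) \<longlonglongrightarrow> (SUP y. u y - f y) \<and>
        (\<lambda>n. u (x n) - lam * A f (x n) - h (x n)) \<longlonglongrightarrow> l \<and> l \<le> 0)"

definition viscosity_supersolution ::
    "('a::topological_space \<Rightarrow> real) set \<Rightarrow> (('a \<Rightarrow> real) \<Rightarrow> 'a \<Rightarrow> real) \<Rightarrow>
     real \<Rightarrow> ('a \<Rightarrow> real) \<Rightarrow> ('a \<Rightarrow> real) \<Rightarrow> bool" where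
  "viscosity_supersolution D A lam h v \<longleftrightarrow>
     bdd_below (range v) \<and> lsc v \<and>
     (\<forall>f\<in>D. \<exists>(x :: nat \<Rightarrow> 'a) l.
        (\<lambda>n. v (x n) - f (x n)) \<longlonglongrightarrow> (INF y. v y - f y) \<and>
        (\<lambda>n. v (x n) - lam * A f (x n) - h (x n)) \<longlonglongrightarrow> l \<and> l \<ge> 0)"

definition viscosity_solution ::
    "('a::topological_space \<Rightarrow> real) set \<Rightarrow> (('a \<Rightarrow> real) \<Rightarrow> 'a \<Rightarrow> real) \<Rightarrow>
     real \<Rightarrow> ('a \<Rightarrow> real) \<Rightarrow> ('a \<Rightarrow> real) \<Rightarrow> bool" where
  "viscosity_solution D A lam h u \<longleftrightarrow>
     viscosity_subsolution D A lam h u \<and> viscosity_supersolution D A lam h u"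

definition comparison_principle ::
    "('a::topological_space \<Rightarrow> real) set \<Rightarrow> (('a \<Rightarrow> real) \<Rightarrow> 'a \<Rightarrow> real) \<Rightarrow>
     real \<Rightarrow> ('a \<Rightarrow> real) \<Rightarrow> bool" where
  "comparison_principle D A lam h \<longleftrightarrow>
     (\<forall>u v. viscosity_subsolution D A lam h u \<longrightarrow> viscosity_supersolution D A lam h v \<longrightarrow>
        (\<forall>x. u x \<le> v x))"

definition rate_matrix ::
    "('j \<Rightarrow> 'j \<Rightarrow> 'a \<Rightarrow> real) \<Rightarrow> 'a \<Rightarrow> real ^ 'j ^ 'j::finite" where
  "rate_matrix r x =
     (\<chi> i j. if i = j then - (\<Sum>k\<in>UNIV - {i}. r i k x) else r i j x)"

text \<open>
  Simultaneous row and column permutations do not bring the matrix to block triangular form;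
  in particular every one by one matrix is irreducible, including the zero matrix.
\<close>

definition irreducible_matrix :: "real ^ 'j ^ 'j::finite \<Rightarrow> bool" where
  "irreducible_matrix M \<longleftrightarrow>
     \<not> (\<exists>S. S \<noteq> {} \<and> S \<noteq> UNIV \<and> (\<forall>i\<in>S. \<forall>j\<in>-S. M $ i $ j = 0))"

definition one_sided_Lipschitz ::
    "('a::real_inner \<Rightarrow> 'j \<Rightarrow> 'a) \<Rightarrow> bool" where
  "one_sided_Lipschitz b \<longleftrightarrow>
     (\<exists>M. \<forall>x y i. (b x i - b y i) \<bullet> (x - y) \<le> M * (norm (x - y))\<^sup>2)"

definition Lambda_fun ::
    "(real ^ 'd \<Rightarrow> 'j \<Rightarrow> real ^ 'd ^ 'd) \<Rightarrow> (real ^ 'd \<Rightarrow> 'j \<Rightarrow> real ^ 'd) \<Rightarrow>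
     real ^ 'd \<Rightarrow> real ^ 'd \<Rightarrow> 'j::finite pmf \<Rightarrow> real" where
  "Lambda_fun a b x p \<theta> =
     (\<Sum>i\<in>UNIV. ((a x i *v p) \<bullet> p + b x i \<bullet> p) * pmf \<theta> i)"

text \<open>
  For nonnegative rates the expressions under this supremum are bounded by
  \<open>\<Sum>i j. r i j x * \<theta>\<^sub>i\<close>, and \<open>w = 0\<close> gives the value 0.
  Hence \<open>I_fun\<close> is finite and nonnegative, and the supremum in \<open>Hamiltonian\<close>
  is over a nonempty bounded above set as well, so both real suprema are genuine.
\<close>

definition I_fun ::
    "('j \<Rightarrow> 'j \<Rightarrow> 'a \<Rightarrow> real) \<Rightarrow> 'a \<Rightarrow> 'j::finite pmf \<Rightarrow> real" where
  "I_fun r x \<theta> =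
     (SUP w :: real ^ 'j. \<Sum>i\<in>UNIV. \<Sum>j\<in>UNIV. r i j x * pmf \<theta> i * (1 - exp (w $ j - w $ i)))"

definition Hamiltonian ::
    "(real ^ 'd \<Rightarrow> 'j \<Rightarrow> real ^ 'd ^ 'd) \<Rightarrow> (real ^ 'd \<Rightarrow> 'j \<Rightarrow> real ^ 'd) \<Rightarrow>
     ('j::finite \<Rightarrow> 'j \<Rightarrow> real ^ 'd \<Rightarrow> real) \<Rightarrow> real ^ 'd \<Rightarrow> real ^ 'd \<Rightarrow> real" where
  "Hamiltonian a b r x p = (SUP \<theta>. Lambda_fun a b x p \<theta> - I_fun r x \<theta>)"

definition H_op ::
    "(real ^ 'd \<Rightarrow> 'j \<Rightarrow> real ^ 'd ^ 'd) \<Rightarrow> (real ^ 'd \<Rightarrow> 'j \<Rightarrow> real ^ 'd) \<Rightarrow>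
     ('j::finite \<Rightarrow> 'j \<Rightarrow> real ^ 'd \<Rightarrow> real) \<Rightarrow> (real ^ 'd \<Rightarrow> real) \<Rightarrow> real ^ 'd \<Rightarrow> real" where
  "H_op a b r f x = Hamiltonian a b r x (grad f x)"

definition Lagrangian ::
    "(real ^ 'd \<Rightarrow> 'j \<Rightarrow> real ^ 'd ^ 'd) \<Rightarrow> (real ^ 'd \<Rightarrow> 'j \<Rightarrow> real ^ 'd) \<Rightarrow>
     ('j::finite \<Rightarrow> 'j \<Rightarrow> real ^ 'd \<Rightarrow> real) \<Rightarrow> real ^ 'd \<Rightarrow> real ^ 'd \<Rightarrow> ereal" where
  "Lagrangian a b r x v = (SUP p. ereal (p \<bullet> v - Hamiltonian a b r x p))"

definition abs_continuous_on :: "real set \<Rightarrow> (real \<Rightarrow> 'a::metric_space) \<Rightarrow> bool" where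
  "abs_continuous_on S \<gamma> \<longleftrightarrow>
     (\<forall>\<epsilon>>0. \<exists>\<delta>>0. \<forall>(n::nat) \<alpha> \<beta>.
        (\<forall>k<n. \<alpha> k \<le> \<beta> k \<and> {\<alpha> k..\<beta> k} \<subseteq> S) \<and>
        (\<forall>k<n. \<forall>l<n. k \<noteq> l \<longrightarrow> {\<alpha> k<..<\<beta> k} \<inter> {\<alpha> l<..<\<beta> l} = {}) \<and>
        (\<Sum>k<n. \<beta> k - \<alpha> k) < \<delta> \<longrightarrow>
        (\<Sum>k<n. dist (\<gamma> (\<alpha> k)) (\<gamma> (\<beta> k))) < \<epsilon>)"

text \<open>
  Paths on the half-line are functions on the whole real line of which only the values at
  nonnegative times matter; absolute continuity is required on every bounded time interval.
\<close>

definition AC_paths :: "(real \<Rightarrow> 'a::metric_space) set" where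
  "AC_paths = {\<gamma>. \<forall>T\<ge>0. abs_continuous_on {0..T} \<gamma>}"

text \<open>
  The Lebesgue integral of an extended real valued function, as the integral of its positive part
  minus that of its negative part (\<open>e2ennreal\<close> sends negative numbers to 0). It is only meaningful
  if one of the two is finite.
\<close>

definition ereal_integral :: "real set \<Rightarrow> (real \<Rightarrow> ereal) \<Rightarrow> ereal" where
  "ereal_integral S f =
     enn2ereal (\<integral>\<^sup>+t\<in>S. e2ennreal (f t) \<partial>lborel) -
     enn2ereal (\<integral>\<^sup>+t\<in>S. e2ennreal (- f t) \<partial>lborel)"

text \<open>
  An absolutely continuous path is differentiable at almost every time, and the unspecified value of
  \<open>vector_derivative\<close> at the remaining times does not influence the integral. In the setting of
  interest the Lagrangian is nonnegative (as \<open>Hamiltonian a b r x 0 = 0\<close>) and \<open>h\<close> is bounded, so both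
  integrals are meaningful, the outer one possibly being minus infinity.
\<close>

definition resolvent ::
    "(real ^ 'd \<Rightarrow> 'j \<Rightarrow> real ^ 'd ^ 'd) \<Rightarrow> (real ^ 'd \<Rightarrow> 'j \<Rightarrow> real ^ 'd) \<Rightarrow>
     ('j::finite \<Rightarrow> 'j \<Rightarrow> real ^ 'd \<Rightarrow> real) \<Rightarrow> real \<Rightarrow> (real ^ 'd \<Rightarrow> real) \<Rightarrow> real ^ 'd \<Rightarrow> ereal" where
  "resolvent a b r lam h x =
     (SUP \<gamma>\<in>{\<gamma>\<in>AC_paths. \<gamma> 0 = x}.
        ereal_integral {0..} (\<lambda>t. ereal (inverse lam * exp (- inverse lam * t)) *
          (ereal (h (\<gamma> t)) -
           ereal_integral {0..t} (\<lambda>s. Lagrangian a b r (\<gamma> s) (vector_derivative \<gamma> (at s))))))"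

end

theory Submission
  imports Defs
begin

text \<open>
  The Hamiltonian is convex, coercive in the momentum locally uniformly in the position, and jointly
  continuous: the rates at nearby points are close in ratio, which bounds the change of \<open>I_fun\<close>
  uniformly in the measure. It vanishes at momentum zero because a stationary distribution of the
  jump rates has \<open>I_fun\<close> zero.

  Comparison: at a maximum of \<open>u x - (1 - e) v y - (1 - e) n |x - y|^2 / 2 - e ln (1 + |x|^2) / 2\<close> the
  supersolution inequality bounds the Hamiltonian at \<open>p = n (x - y)\<close>, so coercivity keeps \<open>p\<close> bounded
  and the difference of the Hamiltonians vanishes as \<open>n\<close> grows; convexity absorbs the logarithmic
  penalty.

  Existence: the value function is continuous, since straight segments join nearby points at
  bounded cost. For a test function \<open>f\<close>, Young's inequality along a nearly optimal path, followed for a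
  short time and averaged, gives an almost maximal point of \<open>u - f\<close> with the subsolution inequality. For
  the supersolution inequality one follows a polygonal path whose velocity is an almost exact
  subgradient of the Hamiltonian at \<open>grad f\<close>, so that Young's inequality is almost an equality.
\<close>

section \<open>Absolutely continuous paths\<close>

text \<open>Two obstacles shape the proof. Test functions are constant near infinity, while doubling
  the variables produces quadratic and logarithmic ones. These are cut off above the level that
  matters, and an added \<open>|x - z|^2\<close> makes the maximum strict, so that the almost
  maximising sequences in the definition of a subsolution converge to it. The second obstacle is
  that paths are given only by an epsilon-delta condition. Their derivatives and a fundamental
  theorem must be produced before any chain rule; the variation serves for this, as its Stieltjes
  measure has a Radon-Nikodym density.

  The function \<open>ln (1 + |x|^2) / 2\<close> acts twice. The Hamiltonian is bounded above along
  its gradient, so it confines the maximum in the comparison argument at a cost of order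
  \<open>e\<close>, and it also keeps the polygons of the existence argument from exploding in
  finite time.

  The iterated integral of the resolvent may be minus infinity. Exchanging the integrations yields a
  single discounted integral, and paths of infinite discounted cost are those without a finite
  payoff. Supersolutions are handled as subsolutions for the reflected Hamiltonian
  \<open>- H x (- p)\<close>.\<close>

definition acd :: "(real \<Rightarrow> 'a::metric_space) \<Rightarrow> real \<Rightarrow> real \<Rightarrow> bool" where
  "acd F e d \<longleftrightarrow> (\<forall>(n::nat) \<alpha> \<beta>. (\<forall>k<n. \<alpha> k \<le> \<beta> k) \<longrightarrow>
        (\<forall>k<n. \<forall>l<n. k \<noteq> l \<longrightarrow> {\<alpha> k<..<\<beta> k} \<inter> {\<alpha> l<..<\<beta> l} = {}) \<longrightarrow>
        (\<Sum>k<n. \<beta> k - \<alpha> k) < d \<longrightarrow> (\<Sum>k<n. dist (F (\<alpha> k)) (F (\<beta> k))) < e)"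

lemma acd_finite:
  assumes "acd F e d" "finite I" "\<And>k. k \<in> I \<Longrightarrow> \<alpha> k \<le> \<beta> k"
    and disj: "\<And>k l. k \<in> I \<Longrightarrow> l \<in> I \<Longrightarrow> k \<noteq> l \<Longrightarrow> {\<alpha> k<..<\<beta> k} \<inter> {\<alpha> l<..<\<beta> l} = {}"
    and "(\<Sum>k\<in>I. \<beta> k - \<alpha> k) < d"
  shows "(\<Sum>k\<in>I. dist (F (\<alpha> k)) (F (\<beta> k))) < e"
proof -
  obtain h where h: "bij_betw h {0..<card I} I" using ex_bij_betw_nat_finite assms(2) by blast
  then have h': "bij_betw h {..<card I} I" by (simp add: atLeast0LessThan)
  have inI: "h k \<in> I" if "k < card I" for k using h' that by (auto dest: bij_betwE)
  have inj: "h k \<noteq> h l" if "k < card I" "l < card I" "k \<noteq> l" for k l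
    using h' that unfolding bij_betw_def inj_on_def by auto
  have s1: "(\<Sum>k<card I. \<beta> (h k) - \<alpha> (h k)) = (\<Sum>k\<in>I. \<beta> k - \<alpha> k)"
    by (rule sum.reindex_bij_betw[OF h'])
  have s2: "(\<Sum>k<card I. dist (F (\<alpha> (h k))) (F (\<beta> (h k)))) = (\<Sum>k\<in>I. dist (F (\<alpha> k)) (F (\<beta> k)))"
    by (rule sum.reindex_bij_betw[OF h'])
  have a1: "\<forall>k<card I. \<alpha> (h k) \<le> \<beta> (h k)" using inI assms(3) by blast
  have a2: "\<forall>k<card I. \<forall>l<card I. k \<noteq> l \<longrightarrow> {\<alpha> (h k)<..<\<beta> (h k)} \<inter> {\<alpha> (h l)<..<\<beta> (h l)} = {}"
    using disj inI inj by blast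
  show ?thesis
    using assms(1)[unfolded acd_def, rule_format, of "card I" "\<lambda>k. \<alpha> (h k)" "\<lambda>k. \<beta> (h k)"] a1 a2 s1 s2 assms(5)
    by auto
qed

section \<open>Bounded variation of absolutely continuous functions\<close>

definition chain_sum :: "(real \<Rightarrow> 'a::metric_space) \<Rightarrow> (nat \<Rightarrow> real) \<Rightarrow> nat \<Rightarrow> real" where
  "chain_sum F p n = (\<Sum>i<n. dist (F (p i)) (F (p (Suc i))))"

lemma mono_chain_disjoint:
  fixes p :: "nat \<Rightarrow> real"
  assumes "mono p" "i \<noteq> j"
  shows "{p i<..<p (Suc i)} \<inter> {p j<..<p (Suc j)} = {}"
proof -
  have "p (Suc i) \<le> p j" if "i < j" for i j using that assms(1) by (simp add: Suc_leI monoD)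
  then have "p (Suc i) \<le> p j \<or> p (Suc j) \<le> p i" using assms(2) by (meson nat_neq_iff)
  then show ?thesis by auto
qed

lemma chain_sum_less:
  assumes "acd F e d" "mono p" "p n - p 0 < d"
  shows "chain_sum F p n < e"
  unfolding chain_sum_def
proof (rule acd_finite[OF assms(1)])
  show "(\<Sum>k<n. p (Suc k) - p k) < d" using assms(3) by (simp add: sum_lessThan_telescope)
qed (use mono_chain_disjoint[OF assms(2)] assms(2) in \<open>auto simp: mono_iff_le_Suc\<close>)

text \<open>Chains may repeat points, so clipping with \<open>min\<close> and \<open>max\<close>
  gives chains of the same length. Only the step that crosses \<open>s\<close> is cut in two, at the
  price of a triangle inequality.\<close>

lemma chain_sum_split:
  assumes "mono p"
  shows "chain_sum F p n \<le> chain_sum F (\<lambda>i. min s (p i)) n + chain_sum F (\<lambda>i. max s (p i)) n"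
proof -
  have "dist (F (p i)) (F (p (Suc i))) \<le> dist (F (min s (p i))) (F (min s (p (Suc i)))) +
     dist (F (max s (p i))) (F (max s (p (Suc i))))" for i
  proof -
    have "p i \<le> p (Suc i)" using assms by (simp add: mono_iff_le_Suc)
    then consider "s \<le> p i" | "p (Suc i) \<le> s" | "p i \<le> s" "s \<le> p (Suc i)" by linarith
    then show ?thesis
      using \<open>p i \<le> p (Suc i)\<close> by cases (auto simp: min_def max_def dist_triangle)
  qed
  then show ?thesis unfolding chain_sum_def sum.distrib[symmetric] by (intro sum_mono) auto
qed

text \<open>Each window of length \<open>d / 2\<close> contributes less than 1, and
  \<open>chain_sum_split\<close> peels off the windows one at a time. Constancy on the negative
  half-line lets chains start arbitrarily far to the left.\<close>

lemma chain_sum_bounded: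
  assumes F: "acd F 1 d" and d: "d > 0" and c: "\<And>t. t \<le> 0 \<Longrightarrow> F t = F 0"
  shows "\<exists>B. \<forall>p n. mono p \<longrightarrow> p n \<le> t \<longrightarrow> chain_sum F p n \<le> B"
proof -
  have *: "chain_sum F p n \<le> real k" if "mono p" "p n \<le> real k * (d/2)" for k p n
    using that
  proof (induction k arbitrary: p)
    case 0
    have "p i \<le> 0" if "i \<le> n" for i using 0 that by (metis mono_def mult_zero_left of_nat_0 order_trans)
    then have "chain_sum F p n = 0" unfolding chain_sum_def 
      by (intro sum.neutral) (metis Suc_leI c dist_self lessThan_iff less_imp_le_nat)
    then show ?case by simp
  next
    case (Suc k)
    let ?s = "real k * (d/2)"
    have "chain_sum F (\<lambda>i. min ?s (p i)) n \<le> real k"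
      by (rule Suc.IH) (use Suc.prems in \<open>auto simp: mono_def min_def intro: order_trans\<close>)
    moreover have "chain_sum F (\<lambda>i. max ?s (p i)) n < 1"
    proof (rule chain_sum_less[OF F])
      show "mono (\<lambda>i. max ?s (p i))" using Suc.prems(1) by (fastforce simp: mono_def max_def intro: order_trans)
      have "max ?s (p n) \<le> real (Suc k) * (d/2)" using Suc.prems(2) d by (auto simp: algebra_simps)
      moreover have "max ?s (p 0) \<ge> ?s" by simp
      ultimately have "max ?s (p n) - max ?s (p 0) \<le> d/2" by (simp add: algebra_simps)
      then show "max ?s (p n) - max ?s (p 0) < d" using d by linarith
    qed
    ultimately show ?case using chain_sum_split[OF Suc.prems(1), of F n ?s] by simp
  qed
  obtain k::nat where "t / (d/2) \<le> real k" using real_arch_simple by blast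
  then have "t \<le> real k * (d/2)" using d by (simp add: field_simps)
  then show ?thesis using * by (meson order_trans)
qed

text \<open>The total variation on the half-line up to \<open>t\<close>. Fixing no left endpoint
  makes it a single function of \<open>t\<close>, finite for paths that are constant at negative
  times.\<close>

definition variation :: "(real \<Rightarrow> 'a::metric_space) \<Rightarrow> real \<Rightarrow> real" where
  "variation F t = (SUP (p, n)\<in>{(p, n). mono p \<and> p n \<le> t}. chain_sum F p n)"

context
  fixes F :: "real \<Rightarrow> 'a::metric_space"
  assumes bdd: "\<And>t. \<exists>B. \<forall>p n. mono p \<longrightarrow> p n \<le> t \<longrightarrow> chain_sum F p n \<le> B"
begin

lemma variation_upper: "mono p \<Longrightarrow> p n \<le> t \<Longrightarrow> chain_sum F p n \<le> variation F t"
  unfolding variation_def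
  using bdd[of t] by (intro cSUP_upper2[where x="(p,n)"]) (auto simp: bdd_above_def)

lemma variation_least:
  assumes "\<And>p n. mono p \<Longrightarrow> p n \<le> t \<Longrightarrow> chain_sum F p n \<le> B"
  shows "variation F t \<le> B"
proof -
  have "((\<lambda>i. t), 0::nat) \<in> {(p, n). mono p \<and> p n \<le> t}" by (auto simp: mono_def)
  then show ?thesis unfolding variation_def
    by (intro cSUP_least) (use assms in auto)
qed

lemma variation_increment_ge:
  assumes "s \<le> t" shows "variation F s + dist (F s) (F t) \<le> variation F t"
proof -
  have "variation F s \<le> variation F t - dist (F s) (F t)"
  proof (rule variation_least)
    fix p :: "nat \<Rightarrow> real" and n assume p: "mono p" "p n \<le> s"
    \<comment> \<open>The chain is continued by \<open>s\<close> and \<open>t\<close>; the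
      connecting step from \<open>p n\<close> to \<open>s\<close> only adds to the sum.\<close>
    let ?q = "\<lambda>i. if i \<le> n then p i else if i = Suc n then s else t"
    have le: "p i \<le> s" if "i \<le> n" for i using p that by (meson monoD order_trans)
    have m: "mono ?q" using p le assms by (auto simp: mono_def intro: order_trans)
    have "chain_sum F ?q (Suc (Suc n)) = chain_sum F p n + dist (F (p n)) (F s) + dist (F s) (F t)"
      by (simp add: chain_sum_def)
    moreover have "chain_sum F ?q (Suc (Suc n)) \<le> variation F t"
      by (rule variation_upper[OF m]) simp
    ultimately show "chain_sum F p n \<le> variation F t - dist (F s) (F t)" 
      using zero_le_dist[of "F (p n)" "F s"] by linarith
  qed
  then show ?thesis by simp
qed

lemma variation_increment_le:
  assumes "s \<le> t" and W: "\<And>p n. mono p \<Longrightarrow> s \<le> p 0 \<Longrightarrow> p n \<le> t \<Longrightarrow> chain_sum F p n \<le> W"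
  shows "variation F t \<le> variation F s + W"
proof (rule variation_least)
  fix p :: "nat \<Rightarrow> real" and n assume p: "mono p" "p n \<le> t"
  have m: "mono (\<lambda>i. min s (p i))" "mono (\<lambda>i. max s (p i))"
    using p(1) by (fastforce simp: mono_def max_def min_def intro: order_trans)+
  have "chain_sum F (\<lambda>i. min s (p i)) n \<le> variation F s" by (rule variation_upper[OF m(1)]) simp
  moreover have "chain_sum F (\<lambda>i. max s (p i)) n \<le> W" by (rule W[OF m(2)]) (use p assms in auto)
  ultimately show "chain_sum F p n \<le> variation F s + W" using chain_sum_split[OF p(1), of F n s] by linarith
qed

text \<open>Inside every interval a chain is chosen that almost exhausts the increment of the
  variation. The steps of all these chains are again non-overlapping, of total length below
  \<open>d\<close>, so the same \<open>d\<close> works. Passing from \<open>e\<close> to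
  \<open>e'\<close> pays for suprema that need not be attained.\<close>

lemma variation_acd:
  assumes F: "acd F e d" and e: "e < e'"
  shows "acd (variation F) e' d"
  unfolding acd_def
proof (intro allI impI)
  fix n :: nat and \<alpha> \<beta> :: "nat \<Rightarrow> real"
  assume le: "\<forall>k<n. \<alpha> k \<le> \<beta> k"
    and disj: "\<forall>k<n. \<forall>l<n. k \<noteq> l \<longrightarrow> {\<alpha> k<..<\<beta> k} \<inter> {\<alpha> l<..<\<beta> l} = {}"
    and sm: "(\<Sum>k<n. \<beta> k - \<alpha> k) < d"
  \<comment> \<open>The gap is shared among \<open>n\<close> intervals; the \<open>+ 1\<close>
    covers \<open>n = 0\<close>.\<close>
  define \<eta> where "\<eta> = (e' - e) / (real n + 1)"
  have \<eta>: "\<eta> > 0" "real n * \<eta> \<le> e' - e" using e by (auto simp: \<eta>_def field_simps)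
  have "\<exists>p m. mono p \<and> \<alpha> k \<le> p 0 \<and> p m \<le> \<beta> k \<and> variation F (\<beta> k) - variation F (\<alpha> k) \<le> chain_sum F p m + \<eta>"
    if "k < n" for k
  proof (rule ccontr)
    assume "\<not> ?thesis"
    then have "variation F (\<beta> k) \<le> variation F (\<alpha> k) + (variation F (\<beta> k) - variation F (\<alpha> k) - \<eta>)"
      using le that by (intro variation_increment_le) force+
    then show False using \<eta> by simp
  qed
  then obtain q m where q: "\<And>k. k < n \<Longrightarrow> mono (q k)" "\<And>k. k < n \<Longrightarrow> \<alpha> k \<le> q k 0" "\<And>k. k < n \<Longrightarrow> q k (m k) \<le> \<beta> k"
      "\<And>k. k < n \<Longrightarrow> variation F (\<beta> k) - variation F (\<alpha> k) \<le> chain_sum F (q k) (m k) + \<eta>"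
    by metis
  let ?I = "SIGMA k:{..<n}. {..<m k}"
  have sub: "{q k i<..<q k (Suc i)} \<subseteq> {\<alpha> k<..<\<beta> k}" if "k < n" "i < m k" for k i
  proof -
    have "\<alpha> k \<le> q k i" using q(1,2)[OF that(1)] by (meson le0 monoD order_trans)
    moreover have "q k (Suc i) \<le> \<beta> k" using q(1,3)[OF that(1)] that(2) by (meson Suc_leI monoD order_trans)
    ultimately show ?thesis by auto
  qed
  have "(\<Sum>x\<in>?I. dist (F (q (fst x) (snd x))) (F (q (fst x) (Suc (snd x))))) < e"
  proof (rule acd_finite[OF F])
    show "finite ?I" by auto
    show "q (fst x) (snd x) \<le> q (fst x) (Suc (snd x))" if "x \<in> ?I" for x
      using q(1) that by (auto simp: mono_iff_le_Suc)
    show "{q (fst x) (snd x)<..<q (fst x) (Suc (snd x))} \<inter> {q (fst y) (snd y)<..<q (fst y) (Suc (snd y))} = {}"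
      if "x \<in> ?I" "y \<in> ?I" "x \<noteq> y" for x y
    proof (cases "fst x = fst y")
      case True
      then have "snd x \<noteq> snd y" using that by (auto simp: prod_eq_iff)
      then show ?thesis using True mono_chain_disjoint[OF q(1)] that by (auto simp: mem_Sigma_iff split: prod.splits)
    next
      case False
      have "{\<alpha> (fst x)<..<\<beta> (fst x)} \<inter> {\<alpha> (fst y)<..<\<beta> (fst y)} = {}"
        using disj that False by auto
      moreover have "{q (fst x) (snd x)<..<q (fst x) (Suc (snd x))} \<subseteq> {\<alpha> (fst x)<..<\<beta> (fst x)}"
         "{q (fst y) (snd y)<..<q (fst y) (Suc (snd y))} \<subseteq> {\<alpha> (fst y)<..<\<beta> (fst y)}"
        using that by (intro sub; auto)+
      ultimately show ?thesis by blast
    qed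
    have "(\<Sum>x\<in>?I. q (fst x) (Suc (snd x)) - q (fst x) (snd x)) = (\<Sum>k<n. \<Sum>i<m k. q k (Suc i) - q k i)"
      by (simp add: sum.Sigma split_def)
    also have "\<dots> = (\<Sum>k<n. q k (m k) - q k 0)" by (simp add: sum_lessThan_telescope)
    also have "\<dots> \<le> (\<Sum>k<n. \<beta> k - \<alpha> k)" using q(2,3) by (intro sum_mono) (force intro: diff_mono)
    finally show "(\<Sum>x\<in>?I. q (fst x) (Suc (snd x)) - q (fst x) (snd x)) < d" using sm by simp
  qed
  also have "(\<Sum>x\<in>?I. dist (F (q (fst x) (snd x))) (F (q (fst x) (Suc (snd x))))) = (\<Sum>k<n. chain_sum F (q k) (m k))"
    by (simp add: sum.Sigma split_def chain_sum_def)
  finally have 1: "(\<Sum>k<n. chain_sum F (q k) (m k)) < e" .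
  have "dist (variation F (\<alpha> k)) (variation F (\<beta> k)) \<le> chain_sum F (q k) (m k) + \<eta>" if "k < n" for k
  proof -
    have "variation F (\<alpha> k) \<le> variation F (\<beta> k)"
      using variation_increment_ge[of "\<alpha> k" "\<beta> k"] le that by (smt (verit) zero_le_dist)
    then show ?thesis using q(4)[OF that] by (simp add: dist_real_def)
  qed
  then have "(\<Sum>k<n. dist (variation F (\<alpha> k)) (variation F (\<beta> k))) \<le> (\<Sum>k<n. chain_sum F (q k) (m k) + \<eta>)"
    by (intro sum_mono) auto
  also have "\<dots> = (\<Sum>k<n. chain_sum F (q k) (m k)) + real n * \<eta>" by (simp add: sum.distrib)
  also have "\<dots> < e'" using 1 \<eta> by linarith
  finally show "(\<Sum>k<n. dist (variation F (\<alpha> k)) (variation F (\<beta> k))) < e'" .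
qed

end

section \<open>Radon-Nikodym densities of absolutely continuous functions\<close>

lemma acd_continuous:
  assumes "\<And>e. e > 0 \<Longrightarrow> \<exists>d>0. acd F e d"
  shows "continuous_on UNIV F"
  unfolding continuous_on_iff
proof (intro ballI allI impI)
  fix x e :: real assume "e > 0"
  then obtain d where d: "d > 0" "acd F e d" using assms by blast
  have "dist (F y) (F x) < e" if "dist y x < d" for y
    using acd_finite[OF d(2), of "{0::nat}" "\<lambda>_. min x y" "\<lambda>_. max x y"] that
    by (cases "x \<le> y") (auto simp: min_def max_def dist_real_def dist_commute)
  then show "\<exists>d>0. \<forall>x'\<in>UNIV. dist x' x < d \<longrightarrow> dist (F x') (F x) < e" using d by auto
qed

text \<open>Outer regularity puts \<open>N\<close> in an open set of Lebesgue measure below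
  \<open>d\<close>, a countable union of boxes. Finite unions of these become non-overlapping
  intervals, on which absolute continuity bounds the Stieltjes measure by \<open>e\<close>;
  continuity from below passes to the countable union.\<close>

lemma increasing_acd_null_sets:
  fixes G :: "real \<Rightarrow> real"
  assumes "mono G" and G: "\<And>e. e > 0 \<Longrightarrow> \<exists>d>0. acd G e d" and N: "N \<in> null_sets lborel"
  shows "N \<in> null_sets (interval_measure G)"
proof -
  let ?M = "interval_measure G"
  have cont: "continuous_on UNIV G" using acd_continuous G by blast
  have Icc: "emeasure ?M {a..b} = ennreal (G b - G a)" if "a \<le> b" for a b
    by (rule emeasure_interval_measure_Icc[OF that]) (use assms(1) cont in \<open>auto simp: mono_def\<close>)
  have "emeasure ?M N \<le> ennreal e" if e: "e > 0" for e
  proof -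
    obtain d where d: "d > 0" "acd G e d" using G e by blast
    obtain U where U: "open U" "N \<subseteq> U" "emeasure lborel (U - N) < ennreal d"
      by (rule outer_regular_lborel[of N d]) (use N d in auto)
    have eU: "emeasure lborel U < ennreal d"
      using U N by (metis borel_open emeasure_Diff_null_set sets_lborel)
    obtain D where D: "countable D" "D \<subseteq> Pow U" "\<And>X. X \<in> D \<Longrightarrow> \<exists>a b. X = cbox a b" "\<Union>D = U"
      using open_countable_Union_open_cbox[OF U(1)] by blast
    show ?thesis
    proof (cases "D = {}")
      case True then show ?thesis using D U by auto
    next
      case False
      define X where "X = from_nat_into D"
      have X: "range X = D" using False D by (simp add: X_def range_from_nat_into)
      define A where "A n = (\<Union>i\<le>n. X i)" for n :: nat
      have X': "\<exists>a b. X i = cbox a b" for i using D(3) X by blast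
      have Aborel: "A n \<in> sets borel" for n
        unfolding A_def using X' by (metis (no_types, lifting) borel_closed closed_cbox finite_atMost sets.finite_UN)
      have An: "emeasure ?M (A n) \<le> ennreal e" for n
      proof -
        \<comment> \<open>The boxes may overlap, so the finite union is divided into intervals with
          disjoint interiors.\<close>
        obtain P where P: "P division_of (A n)"
          using elementary_unions_intervals[of "X ` {..n}"] X' unfolding A_def
          by (metis finite_imageI finite_atMost imageE)
        have fin: "finite P" using P by auto
        have cb: "\<exists>a b. k = {a..b} \<and> a \<le> b" if "k \<in> P" for k
          using P that unfolding division_of_def by (metis atLeastatMost_empty_iff cbox_interval)
        have k: "k = {Inf k..Sup k}" "Inf k \<le> Sup k" if "k \<in> P" for k
          using cb[OF that] by (auto)
        have "(\<Sum>k\<in>P. Sup k - Inf k) = (\<Sum>k\<in>P. measure lborel k)"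
          by (intro sum.cong refl) (metis k measure_lborel_Icc)
        also have "\<dots> = measure lborel (A n)" 
          proof -
            have "k \<in> sets borel" if "k \<in> P" for k using k(1)[OF that] by (metis borel_closed closed_atLeastAtMost)
            then show ?thesis using content_division[OF P] Aborel by (simp cong: sum.cong)
          qed
        also have "\<dots> < d"
        proof -
          have "emeasure lborel (A n) \<le> emeasure lborel U"
            using D X U by (intro emeasure_mono) (auto simp: A_def)
          then have "emeasure lborel (A n) < ennreal d" using eU by order
          moreover have "emeasure lborel (A n) = ennreal (measure lborel (A n))"
            using calculation by (intro emeasure_eq_ennreal_measure) auto
          ultimately show ?thesis by (simp add: ennreal_less_iff)
        qed
        finally have "(\<Sum>k\<in>P. Sup k - Inf k) < d" .
        then have "(\<Sum>k\<in>P. dist (G (Inf k)) (G (Sup k))) < e"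
        proof (rule acd_finite[OF d(2) fin, rotated 2])
          fix k l assume kl: "k \<in> P" "l \<in> P" "k \<noteq> l"
          then have "interior k \<inter> interior l = {}" using P unfolding division_of_def by blast
          then show "{Inf k<..<Sup k} \<inter> {Inf l<..<Sup l} = {}"
            by (metis interior_atLeastAtMost_real k(1) kl(1) kl(2))
        qed (use k in auto)
        also have "(\<Sum>k\<in>P. dist (G (Inf k)) (G (Sup k))) = (\<Sum>k\<in>P. G (Sup k) - G (Inf k))"
          using k(2) assms(1) by (intro sum.cong) (auto simp: dist_real_def mono_def)
        finally have s: "(\<Sum>k\<in>P. G (Sup k) - G (Inf k)) < e" .
        have "emeasure ?M (A n) = emeasure ?M (\<Union>k\<in>P. k)" using P by (simp add: division_of_def)
        also have "\<dots> \<le> (\<Sum>k\<in>P. emeasure ?M k)"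
          by (rule emeasure_subadditive_finite[OF fin]) (use k in \<open>auto, metis borel_closed closed_atLeastAtMost\<close>)
        also have "\<dots> = (\<Sum>k\<in>P. ennreal (G (Sup k) - G (Inf k)))"
          by (intro sum.cong refl) (metis Icc k)
        also have "\<dots> = ennreal (\<Sum>k\<in>P. G (Sup k) - G (Inf k))"
          using k(2) assms(1) by (intro sum_ennreal) (auto simp: mono_def)
        also have "\<dots> \<le> ennreal e" using s by (intro ennreal_leI) simp
        finally show ?thesis .
      qed
      have "incseq A" unfolding A_def incseq_def by (auto intro: order_trans)
      then have "emeasure ?M (\<Union>n. A n) = (SUP n. emeasure ?M (A n))"
        using Aborel by (intro SUP_emeasure_incseq[symmetric]) auto
      also have "\<dots> \<le> ennreal e" using An by (intro SUP_least)
      finally have "emeasure ?M (\<Union>n. A n) \<le> ennreal e" .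
      moreover have "N \<subseteq> (\<Union>n. A n)" 
      proof
        fix y assume "y \<in> N"
        then obtain Y where "Y \<in> D" "y \<in> Y" using U(2) D(4) by blast
        then obtain i where "y \<in> X i" using X by blast
        then show "y \<in> (\<Union>n. A n)" unfolding A_def by blast
      qed
      moreover have "(\<Union>n. A n) \<in> sets ?M" using Aborel by auto
      ultimately show ?thesis by (meson emeasure_mono order_trans)
    qed
  qed
  then have "emeasure ?M N \<le> 0"
    by (metis add.left_neutral ennreal_le_epsilon)
  then show ?thesis using N by (auto simp: null_sets_def)
qed

text \<open>Lebesgue null sets are null for the Stieltjes measure of \<open>G\<close>, so
  Radon-Nikodym provides a density. Its integral over a bounded interval is finite, hence so are its
  values almost everywhere, which justifies \<open>enn2real\<close>.\<close>

lemma increasing_acd_density: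
  fixes G :: "real \<Rightarrow> real"
  assumes "mono G" and G: "\<And>e. e > 0 \<Longrightarrow> \<exists>d>0. acd G e d"
  shows "\<exists>f. \<forall>s t. s \<le> t \<longrightarrow> (f has_integral (G t - G s)) {s..t}"
proof -
  let ?M = "interval_measure G"
  have cont: "continuous_on UNIV G" using acd_continuous G by blast
  have Icc: "emeasure ?M {a..b} = ennreal (G b - G a)" if "a \<le> b" for a b
    by (rule emeasure_interval_measure_Icc[OF that]) (use assms(1) cont in \<open>auto simp: mono_def\<close>)
  have "absolutely_continuous lborel ?M"
    unfolding absolutely_continuous_def using increasing_acd_null_sets assms by blast
  then obtain f where f[measurable]: "f \<in> borel_measurable lborel" and fM: "density lborel f = ?M"
    using sigma_finite_measure.Radon_Nikodym[OF sigma_finite_lborel, of ?M] by auto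
  have *: "(\<integral>\<^sup>+x. f x * indicator {s..t} x \<partial>lborel) = ennreal (G t - G s)" if "s \<le> t" for s t
    using Icc[OF that] by (simp flip: fM add: emeasure_density)
  have "((\<lambda>x. enn2real (f x)) has_integral (G t - G s)) {s..t}" if "s \<le> t" for s t
  proof -
    have ne: "AE x in lborel. f x * indicator {s..t} x \<noteq> \<infinity>"
      by (rule nn_integral_PInf_AE) (use *[OF that] in auto)
    have "(\<integral>\<^sup>+x. ennreal (enn2real (f x) * indicator {s..t} x) \<partial>lborel) = (\<integral>\<^sup>+x. f x * indicator {s..t} x \<partial>lborel)"
    proof (rule nn_integral_cong_AE, use ne in eventually_elim)
      case (elim x)
      then show ?case by (auto simp: indicator_def less_top)
    qed
    then have "(\<integral>\<^sup>+x. ennreal (enn2real (f x) * indicator {s..t} x) \<partial>lborel) = ennreal (G t - G s)"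
      using *[OF that] by simp
    then have "((\<lambda>x. enn2real (f x) * indicator {s..t} x) has_integral (G t - G s)) UNIV"
      by (intro nn_integral_has_integral) (use that assms(1) in \<open>auto simp: mono_def\<close>)
    moreover have "(\<lambda>x. enn2real (f x) * indicator {s..t} x) = (\<lambda>x. if x \<in> {s..t} then enn2real (f x) else 0)"
      by (auto simp: indicator_def)
    ultimately show ?thesis by (simp only: has_integral_restrict_UNIV)
  qed
  then show ?thesis by blast
qed


text \<open>Jordan decomposition by coordinates: increments of \<open>F\<close> are dominated by
  those of its variation, so variation plus coordinate is increasing. Each coordinate is thus a
  difference of two increasing absolutely continuous functions, with densities \<open>f i\<close>
  and \<open>f0\<close>.\<close>

lemma acd_has_density:
  fixes F :: "real \<Rightarrow> 'a::euclidean_space"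
  assumes F: "\<And>e. e > 0 \<Longrightarrow> \<exists>d>0. acd F e d" and c: "\<And>t. t \<le> 0 \<Longrightarrow> F t = F 0"
  shows "\<exists>g. \<forall>s t. s \<le> t \<longrightarrow> (g has_integral (F t - F s)) {s..t}"
proof -
  obtain d where d: "d > 0" "acd F 1 d" using F[of 1] by auto
  have bdd: "\<exists>B. \<forall>p n. mono p \<longrightarrow> p n \<le> t \<longrightarrow> chain_sum F p n \<le> B" for t
    by (rule chain_sum_bounded[OF d(2,1) c])
  note V = variation_increment_ge[OF bdd] variation_acd[OF bdd]
  let ?V = "variation F"
  have VF: "?V s + dist (F s) (F t) \<le> ?V t" if "s \<le> t" for s t using V(1) that by blast
  have Vacd: "\<exists>d>0. acd ?V e d" if e: "e > 0" for e
  proof -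
    obtain d where "d > 0" "acd F (e/2) d" using F[of "e/2"] e by auto
    then show ?thesis using V(2)[of "e/2" d e] e by auto
  qed
  have "mono ?V" by (rule monoI) (smt (verit) VF zero_le_dist)
  then obtain f0 where f0: "\<And>s t. s \<le> t \<Longrightarrow> (f0 has_integral (?V t - ?V s)) {s..t}"
    using increasing_acd_density Vacd by metis
  have "\<exists>f. \<forall>s t. s \<le> t \<longrightarrow> (f has_integral ((?V t + F t \<bullet> i) - (?V s + F s \<bullet> i))) {s..t}" if i: "i \<in> Basis" for i
  proof (rule increasing_acd_density)
    have *: "\<bar>F s \<bullet> i - F t \<bullet> i\<bar> \<le> dist (F s) (F t)" for s t
      using Basis_le_norm[OF i, of "F s - F t"] by (simp add: inner_diff_left dist_norm)
    show "mono (\<lambda>t. ?V t + F t \<bullet> i)" 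
    proof (rule monoI)
      fix s t :: real assume "s \<le> t"
      then show "?V s + F s \<bullet> i \<le> ?V t + F t \<bullet> i" using VF[of s t] *[of s t] by linarith
    qed
    fix e :: real assume "e > 0"
    then obtain d1 d2 where d12: "d1 > 0" "acd ?V (e/2) d1" "d2 > 0" "acd F (e/2) d2" 
      using Vacd[of "e/2"] F[of "e/2"] by auto
    have "acd (\<lambda>t. ?V t + F t \<bullet> i) e (min d1 d2)"
      unfolding acd_def
    proof (intro allI impI)
      fix n :: nat and \<alpha> \<beta> :: "nat \<Rightarrow> real"
      assume A: "\<forall>k<n. \<alpha> k \<le> \<beta> k"
        "\<forall>k<n. \<forall>l<n. k \<noteq> l \<longrightarrow> {\<alpha> k<..<\<beta> k} \<inter> {\<alpha> l<..<\<beta> l} = {}"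
        "(\<Sum>k<n. \<beta> k - \<alpha> k) < min d1 d2"
      have "(\<Sum>k<n. dist (?V (\<alpha> k)) (?V (\<beta> k))) < e/2" "(\<Sum>k<n. dist (F (\<alpha> k)) (F (\<beta> k))) < e/2"
        using d12(2,4) A unfolding acd_def by auto
      moreover have "(\<Sum>k<n. dist (?V (\<alpha> k) + F (\<alpha> k) \<bullet> i) (?V (\<beta> k) + F (\<beta> k) \<bullet> i)) \<le>
         (\<Sum>k<n. dist (?V (\<alpha> k)) (?V (\<beta> k)) + dist (F (\<alpha> k)) (F (\<beta> k)))"
        by (intro sum_mono) (use * in \<open>smt (verit) dist_real_def\<close>)
      ultimately show "(\<Sum>k<n. dist (?V (\<alpha> k) + F (\<alpha> k) \<bullet> i) (?V (\<beta> k) + F (\<beta> k) \<bullet> i)) < e"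
        by (simp add: sum.distrib)
    qed
    then show "\<exists>d>0. acd (\<lambda>t. ?V t + F t \<bullet> i) e d" using d12 by (metis min_less_iff_conj)
  qed
  then obtain f where f: "\<And>i s t. i \<in> Basis \<Longrightarrow> s \<le> t \<Longrightarrow>
      (f i has_integral ((?V t + F t \<bullet> i) - (?V s + F s \<bullet> i))) {s..t}"
    by metis
  let ?g = "\<lambda>x. \<Sum>i\<in>Basis. (f i x - f0 x) *\<^sub>R i"
  have "(?g has_integral (F t - F s)) {s..t}" if "s \<le> t" for s t
  proof -
    have "((\<lambda>x. ?g x \<bullet> i) has_integral (F t - F s) \<bullet> i) {s..t}" if i: "i \<in> Basis" for i
    proof -
      have "((\<lambda>x. f i x - f0 x) has_integral ((?V t + F t \<bullet> i) - (?V s + F s \<bullet> i) - (?V t - ?V s))) {s..t}"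
        by (intro has_integral_diff f f0 i \<open>s \<le> t\<close>)
      moreover have "(?V t + F t \<bullet> i) - (?V s + F s \<bullet> i) - (?V t - ?V s) = (F t - F s) \<bullet> i"
        by (simp add: inner_diff_left)
      ultimately show ?thesis using i by (simp add: inner_sum_left_Basis)
    qed
    then show ?thesis by (subst has_integral_componentwise_iff) blast
  qed
  then show ?thesis by blast
qed

section \<open>Almost everywhere differentiation of primitives\<close>

lemma indefinite_integral_right_derivative:
  fixes F :: "real \<Rightarrow> 'a::euclidean_space"
  assumes F: "\<And>s t. s \<le> t \<Longrightarrow> (g has_integral (F t - F s)) {s..t}"
  obtains N where "negligible N"
    "\<And>x e. x \<notin> N \<Longrightarrow> e > 0 \<Longrightarrow> \<exists>d>0. \<forall>h. 0 < h \<and> h < d \<longrightarrow> norm (F (x + h) - F x - h *\<^sub>R g x) \<le> e * h"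
proof -
  have "g integrable_on cbox a b" for a b
    using F[of a b] by (cases "a \<le> b") (auto simp: integrable_on_def)
  then obtain N where N: "negligible N" "\<And>x e. \<lbrakk>x \<notin> N; 0 < e\<rbrakk> \<Longrightarrow>
     \<exists>d>0. \<forall>h. 0 < h \<and> h < d \<longrightarrow> norm(integral (cbox x (x + h *\<^sub>R One)) g /\<^sub>R h ^ DIM(real) - g x) < e"
    using integrable_ccontinuous_explicit by blast
  have "\<exists>d>0. \<forall>h. 0 < h \<and> h < d \<longrightarrow> norm (F (x + h) - F x - h *\<^sub>R g x) \<le> e * h" if xe: "x \<notin> N" "e > 0" for x e
  proof -
    obtain d where d: "d > 0" "\<And>h. 0 < h \<and> h < d \<Longrightarrow> norm(integral (cbox x (x + h *\<^sub>R One)) g /\<^sub>R h ^ DIM(real) - g x) < e"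
      using N(2)[OF xe] by blast
    have "norm (F (x + h) - F x - h *\<^sub>R g x) \<le> e * h" if h: "0 < h" "h < d" for h
    proof -
      have "integral {x..x+h} g = F (x + h) - F x" using F[of x "x+h"] h by (simp add: integral_unique)
      then have "norm ((F (x + h) - F x) /\<^sub>R h - g x) < e" using d(2)[of h] h by simp
      moreover have "F (x + h) - F x - h *\<^sub>R g x = h *\<^sub>R ((F (x + h) - F x) /\<^sub>R h - g x)"
        using h by (simp add: scaleR_diff_right)
      ultimately show ?thesis using h by (simp add: mult.commute)
    qed
    then show ?thesis using d by blast
  qed
  with N(1) show ?thesis using that by blast
qed

text \<open>The preceding lemma treats right increments. Applied to the time-reversed primitive it
  yields the left increments, and the two exceptional sets are united.\<close>

lemma indefinite_integral_vector_derivative: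
  fixes F :: "real \<Rightarrow> 'a::euclidean_space"
  assumes F: "\<And>s t. s \<le> t \<Longrightarrow> (g has_integral (F t - F s)) {s..t}"
  obtains N where "negligible N" "\<And>x. x \<notin> N \<Longrightarrow> (F has_vector_derivative g x) (at x)"
proof -
  obtain N1 where N1: "negligible N1"
    "\<And>x e. x \<notin> N1 \<Longrightarrow> e > 0 \<Longrightarrow> \<exists>d>0. \<forall>h. 0 < h \<and> h < d \<longrightarrow> norm (F (x + h) - F x - h *\<^sub>R g x) \<le> e * h"
    using indefinite_integral_right_derivative[OF F] by blast
  have F': "((\<lambda>x. g (- x)) has_integral (- F (- t) - (- F (- s)))) {s..t}" if "s \<le> t" for s t
    using F[of "-t" "-s"] that has_integral_reflect_real[of g _ "-s" "-t"] by simp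
  obtain N2 where N2: "negligible N2"
    "\<And>x e. x \<notin> N2 \<Longrightarrow> e > 0 \<Longrightarrow> \<exists>d>0. \<forall>h. 0 < h \<and> h < d \<longrightarrow> norm (- F (- (x + h)) - (- F (- x)) - h *\<^sub>R g (- x)) \<le> e * h"
    using indefinite_integral_right_derivative[OF F'] by blast
  have "negligible (uminus ` N2)"
    by (rule negligible_differentiable_image_negligible[OF order_refl N2(1)])
       (auto intro: differentiable_on_minus differentiable_on_ident)
  with N1(1) have N: "negligible (N1 \<union> uminus ` N2)" by (rule negligible_Un)
  have "(F has_vector_derivative g x) (at x)" if x: "x \<notin> N1 \<union> uminus ` N2" for x
    unfolding has_vector_derivative_def has_derivative_at_alt
  proof (intro conjI allI impI)
    show "bounded_linear (\<lambda>y. y *\<^sub>R g x)" by (rule bounded_linear_scaleR_left)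
    fix e :: real assume e: "e > 0"
    have x2: "- x \<notin> N2" using x by force
    obtain d1 where d1: "d1 > 0" "\<And>h. 0 < h \<and> h < d1 \<Longrightarrow> norm (F (x + h) - F x - h *\<^sub>R g x) \<le> e * h"
      using N1(2)[of x e] x e by blast
    obtain d2 where d2: "d2 > 0" "\<And>h. 0 < h \<and> h < d2 \<Longrightarrow> norm (- F (- (- x + h)) - (- F (- (- x))) - h *\<^sub>R g (- (- x))) \<le> e * h"
      using N2(2)[OF x2 e] by blast
    have "norm (F y - F x - (y - x) *\<^sub>R g x) \<le> e * norm (y - x)" if "norm (y - x) < min d1 d2" for y
    proof -
      consider "y = x" | "y > x" | "y < x" by linarith
      then show ?thesis
      proof cases
        case 2 then show ?thesis using d1(2)[of "y - x"] that by simp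
      next
        case 3
        have "norm (- F (- (- x + (x - y))) - (- F (- (- x))) - (x - y) *\<^sub>R g (- (- x))) \<le> e * (x - y)"
          using 3 that by (intro d2(2)) auto
        then have "norm (F x - F y - (x - y) *\<^sub>R g x) \<le> e * (x - y)" by simp
        moreover have "F x - F y - (x - y) *\<^sub>R g x = - (F y - F x - (y - x) *\<^sub>R g x)"
          by (simp add: algebra_simps)
        ultimately have "norm (F y - F x - (y - x) *\<^sub>R g x) \<le> e * (x - y)" by (metis norm_minus_cancel)
        then show ?thesis using 3 by simp
      qed simp
    qed
    then show "\<exists>d>0. \<forall>y. norm (y - x) < d \<longrightarrow> norm (F y - F x - (y - x) *\<^sub>R g x) \<le> e * norm (y - x)"
      using d1(1) d2(1) by (metis min_less_iff_conj)
  qed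
  then show ?thesis using N that by blast
qed

text \<open>Freezing the path outside \<open>{0..T}\<close> gives a function on the whole line,
  where \<open>acd\<close> carries no containment condition. The clamp is nondecreasing and shortens
  intervals, so disjoint families stay disjoint and do not gain length.\<close>

lemma clamped_path_acd:
  fixes T :: real
  assumes \<gamma>: "abs_continuous_on {0..T} \<gamma>" and T: "T \<ge> 0" and e: "e > 0"
  shows "\<exists>d>0. acd (\<lambda>t. \<gamma> (min T (max 0 t))) e d"
proof -
  from \<gamma>[unfolded abs_continuous_on_def, rule_format, OF e]
  obtain d where d: "d > 0" "\<forall>(n::nat) \<alpha> \<beta>.
        (\<forall>k<n. \<alpha> k \<le> \<beta> k \<and> {\<alpha> k..\<beta> k} \<subseteq> {0..T}) \<and>
        (\<forall>k<n. \<forall>l<n. k \<noteq> l \<longrightarrow> {\<alpha> k<..<\<beta> k} \<inter> {\<alpha> l<..<\<beta> l} = {}) \<and>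
        (\<Sum>k<n. \<beta> k - \<alpha> k) < d \<longrightarrow>
        (\<Sum>k<n. dist (\<gamma> (\<alpha> k)) (\<gamma> (\<beta> k))) < e"
    by (elim exE conjE)
  let ?c = "\<lambda>t. min T (max 0 t)"
  have "acd (\<lambda>t. \<gamma> (?c t)) e d"
    unfolding acd_def
  proof (intro allI impI)
    fix n :: nat and \<alpha> \<beta> :: "nat \<Rightarrow> real"
    assume A: "\<forall>k<n. \<alpha> k \<le> \<beta> k"
      "\<forall>k<n. \<forall>l<n. k \<noteq> l \<longrightarrow> {\<alpha> k<..<\<beta> k} \<inter> {\<alpha> l<..<\<beta> l} = {}"
      "(\<Sum>k<n. \<beta> k - \<alpha> k) < d"
    have sub: "{?c s<..<?c t} \<subseteq> {s<..<t}" for s t using T by auto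
    have "(\<Sum>k<n. ?c (\<beta> k) - ?c (\<alpha> k)) \<le> (\<Sum>k<n. \<beta> k - \<alpha> k)"
      by (intro sum_mono) (use A(1) in \<open>auto simp: min_def max_def\<close>)
    then have "(\<Sum>k<n. ?c (\<beta> k) - ?c (\<alpha> k)) < d" using A(3) by linarith
    moreover have "{?c (\<alpha> k)<..<?c (\<beta> k)} \<inter> {?c (\<alpha> l)<..<?c (\<beta> l)} = {}" if "k < n" "l < n" "k \<noteq> l" for k l
      using A(2) that sub[of "\<alpha> k" "\<beta> k"] sub[of "\<alpha> l" "\<beta> l"] by blast
    moreover have "?c (\<alpha> k) \<le> ?c (\<beta> k) \<and> {?c (\<alpha> k)..?c (\<beta> k)} \<subseteq> {0..T}" if "k < n" for k
      using A(1) that T by auto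
    ultimately show "(\<Sum>k<n. dist (\<gamma> (?c (\<alpha> k))) (\<gamma> (?c (\<beta> k)))) < e"
      by (intro d(2)[rule_format] conjI allI impI) blast+
  qed
  then show ?thesis using d by blast
qed

lemma AC_path_FTC_bounded:
  fixes \<gamma> :: "real \<Rightarrow> 'a::euclidean_space"
  assumes "abs_continuous_on {0..T} \<gamma>" "T \<ge> 0"
  obtains N where "negligible N" "\<And>s. 0 < s \<Longrightarrow> s < T \<Longrightarrow> s \<notin> N \<Longrightarrow> \<gamma> differentiable (at s)"
    "((\<lambda>s. vector_derivative \<gamma> (at s)) has_integral (\<gamma> T - \<gamma> 0)) {0..T}"
proof -
  let ?F = "\<lambda>t. \<gamma> (min T (max 0 t))"
  obtain g where g: "\<And>s t. s \<le> t \<Longrightarrow> (g has_integral (?F t - ?F s)) {s..t}"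
    using acd_has_density[of ?F, OF clamped_path_acd[OF assms]] by (metis max.absorb1 order_refl)
  obtain N where N: "negligible N" "\<And>x. x \<notin> N \<Longrightarrow> (?F has_vector_derivative g x) (at x)"
    using indefinite_integral_vector_derivative[OF g] by blast
  have der: "(\<gamma> has_vector_derivative g s) (at s)" if "0 < s" "s < T" "s \<notin> N" for s
    by (rule has_vector_derivative_transform_within_open[OF N(2)[OF that(3)], of "{0<..<T}"]) (use that in auto)
  show thesis
  proof (rule that[OF N(1)])
    show "\<gamma> differentiable (at s)" if "0 < s" "s < T" "s \<notin> N" for s
      using der[OF that] differentiableI_vector by blast
    have "negligible (N \<union> {0, T})" using N(1) by (simp add: negligible_insert)
    then show "((\<lambda>s. vector_derivative \<gamma> (at s)) has_integral (\<gamma> T - \<gamma> 0)) {0..T}"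
      by (rule has_integral_spike) (use g[of 0 T] assms(2) der in \<open>auto simp: vector_derivative_at\<close>)
  qed
qed

theorem AC_path_FTC:
  fixes \<gamma> :: "real \<Rightarrow> 'a::euclidean_space"
  assumes \<gamma>: "\<gamma> \<in> AC_paths"
  shows "continuous_on {0..} \<gamma>"
    and "negligible {s. s \<ge> 0 \<and> \<not> \<gamma> differentiable (at s)}"
    and "t \<ge> 0 \<Longrightarrow> ((\<lambda>s. vector_derivative \<gamma> (at s)) has_integral (\<gamma> t - \<gamma> 0)) {0..t}"
proof -
  have ac: "abs_continuous_on {0..T} \<gamma>" if "T \<ge> 0" for T using \<gamma> that by (auto simp: AC_paths_def)
  show "((\<lambda>s. vector_derivative \<gamma> (at s)) has_integral (\<gamma> t - \<gamma> 0)) {0..t}" if "t \<ge> 0"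
    using AC_path_FTC_bounded[OF ac[OF that] that] by metis
  have "\<exists>N. negligible N \<and> (\<forall>s. 0 < s \<longrightarrow> s < real n \<longrightarrow> s \<notin> N \<longrightarrow> \<gamma> differentiable (at s))" for n :: nat
    using AC_path_FTC_bounded[OF ac, of "real n"] by (metis of_nat_0_le_iff)
  then obtain N where N: "\<And>n. negligible (N n)" "\<And>n s. 0 < s \<Longrightarrow> s < real n \<Longrightarrow> s \<notin> N n \<Longrightarrow> \<gamma> differentiable (at s)"
    by metis
  \<comment> \<open>Time 0 is added because the path is arbitrary at negative times, so nothing is
    known of a two-sided derivative there.\<close>
  have "negligible ((\<Union>n. N n) \<union> {0})" using N(1) by (auto intro: negligible_Union_nat)
  moreover have "{s. s \<ge> 0 \<and> \<not> \<gamma> differentiable (at s)} \<subseteq> (\<Union>n. N n) \<union> {0}"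
  proof
    fix s assume s: "s \<in> {s. s \<ge> 0 \<and> \<not> \<gamma> differentiable (at s)}"
    obtain n where "s < real n" using reals_Archimedean2 by blast
    then show "s \<in> (\<Union>n. N n) \<union> {0}" using N(2)[of s n] s by fastforce
  qed
  ultimately show "negligible {s. s \<ge> 0 \<and> \<not> \<gamma> differentiable (at s)}" by (rule negligible_subset)
  show "continuous_on {0..} \<gamma>"
    unfolding continuous_on_iff
  proof (intro ballI allI impI)
    fix x e :: real assume x: "x \<in> {0..}" and e: "e > 0"
    \<comment> \<open>Clamping at \<open>x + 1\<close> leaves the path unchanged at nonnegative
      times near \<open>x\<close>.\<close>
    let ?F = "\<lambda>t. \<gamma> (min (x + 1) (max 0 t))"
    have "continuous_on UNIV ?F" using clamped_path_acd[OF ac] x by (intro acd_continuous) auto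
    then obtain d where d: "d > 0" "\<And>y. dist y x < d \<Longrightarrow> dist (?F y) (?F x) < e"
      using e unfolding continuous_on_iff by (metis UNIV_I)
    have "dist (\<gamma> y) (\<gamma> x) < e" if "y \<ge> 0" "dist y x < min d 1" for y
      using d(2)[of y] that x by (auto simp: dist_real_def min_def max_def abs_if split: if_splits)
    then show "\<exists>d>0. \<forall>x'\<in>{0..}. dist x' x < d \<longrightarrow> dist (\<gamma> x') (\<gamma> x) < e"
      using d(1) by (intro exI[of _ "min d 1"]) auto
  qed
qed

section \<open>Smooth test functions\<close>

lemma Ck_imp_continuous: "Ck k f \<Longrightarrow> continuous_on UNIV f"
  by (cases k) (auto intro!: continuous_at_imp_continuous_on differentiable_imp_continuous_within)

lemma Ck_SucD: "Ck (Suc k) f \<Longrightarrow> Ck k f"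
proof (induction k arbitrary: f)
  case 0 then show ?case using Ck_imp_continuous by fastforce
qed simp

lemma Ck_SucI:
  assumes "\<And>x. (f has_derivative f' x) (at x)" "\<And>v. Ck k (\<lambda>x. f' x v)"
  shows "Ck (Suc k) f"
proof -
  have "frechet_derivative f (at x) = f' x" for x using frechet_derivative_at[OF assms(1)] by simp
  then show ?thesis using assms by (auto simp: differentiable_def)
qed

lemma Ck_Suc_has_derivative:
  "Ck (Suc k) f \<Longrightarrow> (f has_derivative frechet_derivative f (at x)) (at x)"
  by (meson Ck.simps(2) frechet_derivative_works)

lemma Ck_const: "Ck k (\<lambda>x. c)"
proof (induction k arbitrary: c)
  case (Suc k)
  show ?case by (rule Ck_SucI[where f'="\<lambda>x v. 0"]) (use Suc in auto)
qed simp

lemma Ck_add: "Ck k f \<Longrightarrow> Ck k g \<Longrightarrow> Ck k (\<lambda>x. f x + g x)"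
proof (induction k arbitrary: f g)
  case 0 then show ?case by (auto intro: continuous_on_add)
next
  case (Suc k)
  note d = Suc.prems[THEN Ck_Suc_has_derivative]
  show ?case
    by (rule Ck_SucI[OF has_derivative_add[OF d]]) (use Suc in auto)
qed

lemma Ck_mult: "Ck k f \<Longrightarrow> Ck k g \<Longrightarrow> Ck k (\<lambda>x. f x * g x)"
proof (induction k arbitrary: f g)
  case 0 then show ?case by (auto intro: continuous_on_mult)
next
  case (Suc k)
  note d = Suc.prems[THEN Ck_Suc_has_derivative]
  show ?case
    by (rule Ck_SucI[OF has_derivative_mult[OF d]])
       (use Suc.IH Suc.prems Ck_SucD in \<open>auto intro!: Ck_add Suc.IH\<close>)
qed

lemma Ck_compose:
  fixes g :: "real \<Rightarrow> real"
  shows "Ck k g \<Longrightarrow> Ck k f \<Longrightarrow> Ck k (\<lambda>x. g (f x))"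
proof (induction k arbitrary: f g)
  case 0 then show ?case by (auto intro: continuous_on_compose2)
next
  case (Suc k)
  note d = Suc.prems[THEN Ck_Suc_has_derivative]
  \<comment> \<open>A linear map of the line is multiplication by its value at 1. This separates the
    direction from the base point and turns the chain rule into a product to which the induction
    applies.\<close>
  have lin: "frechet_derivative g (at y) w = w * frechet_derivative g (at y) 1" for y w
  proof -
    have "linear (frechet_derivative g (at y))" using d(1) has_derivative_linear by blast
    then show ?thesis using linear_scale[of "frechet_derivative g (at y)" w 1] by simp
  qed
  show ?case
  proof (rule Ck_SucI)
    show "((\<lambda>x. g (f x)) has_derivative (\<lambda>v. frechet_derivative g (at (f x)) (frechet_derivative f (at x) v))) (at x)" for x
      by (rule has_derivative_compose[OF d(2,1)])
    show "Ck k (\<lambda>x. frechet_derivative g (at (f x)) (frechet_derivative f (at x) v))" for v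
    proof (subst lin, rule Ck_mult)
      show "Ck k (\<lambda>x. frechet_derivative g (at (f x)) 1)"
        using Suc.prems(1) by (intro Suc.IH[where g="\<lambda>y. frechet_derivative g (at y) 1"] Ck_SucD[OF Suc.prems(2)]) auto
      show "Ck k (\<lambda>x. frechet_derivative f (at x) v)" using Suc.prems(2) by auto
    qed
  qed
qed

lemma Ck_uminus: "Ck k f \<Longrightarrow> Ck k (\<lambda>x. - f x)"
  using Ck_mult[OF Ck_const[of k "-1"], of f] by simp

lemma Ck_diff: "Ck k f \<Longrightarrow> Ck k g \<Longrightarrow> Ck k (\<lambda>x. f x - g x)"
  using Ck_add[OF _ Ck_uminus, of k f g] by simp

lemma Ck_inverse: "Ck k f \<Longrightarrow> (\<And>x. f x \<noteq> 0) \<Longrightarrow> Ck k (\<lambda>x. inverse (f x))"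
proof (induction k arbitrary: f)
  case 0 then show ?case by (auto intro: continuous_on_inverse)
next
  case (Suc k)
  note d = Suc.prems(1)[THEN Ck_Suc_has_derivative]
  show ?case
    by (rule Ck_SucI[OF Deriv.has_derivative_inverse[OF Suc.prems(2) d]])
       (use Suc.prems Ck_SucD[OF Suc.prems(1)] in \<open>auto intro!: Ck_mult Ck_uminus Suc.IH\<close>)
qed

lemma Ck_divide: "Ck k f \<Longrightarrow> Ck k g \<Longrightarrow> (\<And>x. g x \<noteq> 0) \<Longrightarrow> Ck k (\<lambda>x. f x / g x)"
  unfolding divide_inverse by (intro Ck_mult Ck_inverse)

lemma Ck_ln:
  assumes "Ck k f" "\<And>x. f x > 0" shows "Ck k (\<lambda>x. ln (f x))"
proof (cases k)
  case 0 then show ?thesis using assms by (auto intro!: continuous_on_ln simp: less_imp_neq[symmetric])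
next
  case (Suc l)
  have d: "(f has_derivative frechet_derivative f (at x)) (at x)" for x
    using Ck_Suc_has_derivative assms(1)[unfolded Suc] .
  have nz: "f x \<noteq> 0" for x using assms(2)[of x] by simp
  show ?thesis unfolding Suc
  proof (rule Ck_SucI)
    show "((\<lambda>x. ln (f x)) has_derivative (\<lambda>v. frechet_derivative f (at x) v * inverse (f x))) (at x)" for x
      using has_derivative_ln[OF assms(2) d] by (simp add: field_simps)
    show "Ck l (\<lambda>x. frechet_derivative f (at x) v * inverse (f x))" for v
      using assms(1) Suc nz Ck_SucD by (intro Ck_mult Ck_inverse) auto
  qed
qed

lemma Ck_inner: "Ck k (\<lambda>x. (x - y) \<bullet> v)"
\<comment> \<open>Passing to order \<open>Suc k\<close> replaces an induction by one
  differentiation, since the derivative is constant in \<open>x\<close>.\<close>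
proof (rule Ck_SucD, rule Ck_SucI)
  show "((\<lambda>x. (x - y) \<bullet> v) has_derivative (\<lambda>h. h \<bullet> v)) (at x)" for x
    by (auto intro!: derivative_eq_intros)
qed (rule Ck_const)

lemma has_derivative_norm_square:
  "((\<lambda>x. (norm (x - y))\<^sup>2) has_derivative (\<lambda>h. h \<bullet> (2 *\<^sub>R (x - y)))) (at (x::'a::euclidean_space))"
  unfolding power2_norm_eq_inner by (auto intro!: derivative_eq_intros simp: inner_commute)

lemma Ck_norm_square: "Ck k (\<lambda>x. (norm (x - y))\<^sup>2)"
proof (rule Ck_SucD, rule Ck_SucI[OF has_derivative_norm_square])
  show "Ck k (\<lambda>x. v \<bullet> (2 *\<^sub>R (x - y)))" for v
    using Ck_inner[of k y "2 *\<^sub>R v"] by (simp add: inner_commute)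
qed

lemma Ck_id: "Ck k (\<lambda>x::real. x)"
  using Ck_inner[of k 0 "1::real"] by simp

text \<open>The functions \<open>t^-m exp (- 1 / t)\<close>, set to zero on the left, are closed
  under differentiation up to linear combinations. Taking all \<open>m\<close> together makes the
  smoothness of each an induction on the order.\<close>

definition flat_exp :: "nat \<Rightarrow> real \<Rightarrow> real" where
  "flat_exp m t = (if t > 0 then inverse t ^ m * exp (- inverse t) else 0)"

lemma flat_exp_tendsto: "((\<lambda>t. flat_exp m t) \<longlongrightarrow> 0) (at_right 0)"
proof -
  have "((\<lambda>t. (inverse t :: real) ^ m / exp (inverse t)) \<longlongrightarrow> 0) (at_right 0)"
    by (rule filterlim_compose[OF tendsto_power_div_exp_0 filterlim_inverse_at_top_right])
  then show ?thesis
    by (rule Lim_transform_eventually)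
      (auto simp: flat_exp_def exp_minus field_simps eventually_at_right_less intro!: eventually_mono[OF eventually_at_right_less])
qed

lemma flat_exp_DERIV:
  "(flat_exp m has_real_derivative (flat_exp (m + 2) t - real m * flat_exp (m + 1) t)) (at t)"
proof -
  consider "t > 0" | "t < 0" | "t = 0" by linarith
  then show ?thesis
  proof cases
    case 1
    have "((\<lambda>t. inverse t ^ m * exp (- inverse t)) has_real_derivative (flat_exp (m + 2) t - real m * flat_exp (m + 1) t)) (at t)"
    proof (cases m)
      case 0
      then show ?thesis using 1 by (auto intro!: derivative_eq_intros simp: flat_exp_def power2_eq_square)
    next
      case (Suc l)
      then show ?thesis using 1 by (auto intro!: derivative_eq_intros simp: flat_exp_def power2_eq_square algebra_simps)
          (cases l; simp)
    qed
    then show ?thesis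
      by (rule has_field_derivative_transform_within_open[of _ _ _ "{0<..}"]) (use 1 in \<open>auto simp: flat_exp_def\<close>)
  next
    case 2
    have "((\<lambda>t. 0) has_real_derivative (flat_exp (m + 2) t - real m * flat_exp (m + 1) t)) (at t)"
      using 2 by (simp add: flat_exp_def)
    then show ?thesis
      by (rule has_field_derivative_transform_within_open[of _ _ _ "{..<0}"]) (use 2 in \<open>auto simp: flat_exp_def\<close>)
  next
    case 3
    \<comment> \<open>From the right, the difference quotient at 0 is
      \<open>flat_exp (Suc m)\<close>, which tends to 0.\<close>
    have r: "((\<lambda>h. (flat_exp m (0 + h) - flat_exp m 0) / h) \<longlongrightarrow> 0) (at_right 0)"
      by (rule Lim_transform_eventually[OF flat_exp_tendsto[of "Suc m"]])
         (auto simp: flat_exp_def field_simps intro!: eventually_mono[OF eventually_at_right_less])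
    have l: "((\<lambda>h. (flat_exp m (0 + h) - flat_exp m 0) / h) \<longlongrightarrow> 0) (at_left 0)"
      by (rule Lim_transform_eventually[OF tendsto_const])
         (auto simp: flat_exp_def eventually_at_filter)
    have "((\<lambda>h. (flat_exp m (0 + h) - flat_exp m 0) / h) \<longlongrightarrow> 0) (at 0)"
      using r l by (simp add: filterlim_split_at)
    then show ?thesis using 3 by (simp add: DERIV_def) (simp add: flat_exp_def)
  qed
qed

lemma Ck_flat_exp: "Ck k (flat_exp m)"
proof (induction k arbitrary: m)
  case 0
  then show ?case 
    by simp (intro DERIV_continuous_on[OF has_field_derivative_at_within[OF flat_exp_DERIV]])
next
  case (Suc k)
  show ?case
    by (rule Ck_SucI[OF flat_exp_DERIV[unfolded has_field_derivative_def]])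
       (intro Ck_mult Ck_diff Ck_const Suc)
qed

text \<open>\<open>\<kappa>\<close> interpolates between the identity and the constant
  \<open>R + 1\<close> over the window from \<open>R\<close> to \<open>R + 1\<close>. Beyond
  \<open>R\<close> both are at least \<open>R\<close>, hence so is every mixture.\<close>

lemma smooth_cutoff:
  obtains \<kappa> :: "real \<Rightarrow> real" where "\<And>k. Ck k \<kappa>" "\<And>t. t \<le> R \<Longrightarrow> \<kappa> t = t"
    "\<And>t. t \<ge> R + 1 \<Longrightarrow> \<kappa> t = R + 1" "\<And>t. t \<ge> R \<Longrightarrow> \<kappa> t \<ge> R"
proof -
  let ?b = "flat_exp 0"
  have nn: "?b t \<ge> 0" for t by (simp add: flat_exp_def)
  have pos: "?b t + ?b (1 - t) > 0" for t
    using nn[of t] nn[of "1 - t"] by (cases "t > 0") (auto simp: flat_exp_def intro: add_pos_nonneg)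
  \<comment> \<open>The standard smooth step: 0 for \<open>t \<le> 0\<close> and 1 for
    \<open>t \<ge> 1\<close>, with a denominator that never vanishes.\<close>
  define \<psi> where "\<psi> t = ?b t / (?b t + ?b (1 - t))" for t
  have \<psi>01: "0 \<le> \<psi> t" "\<psi> t \<le> 1" for t
    using nn[of t] nn[of "1 - t"] pos[of t] by (auto simp: \<psi>_def divide_simps)
  have "Ck k (\<lambda>t. ?b (1 - t))" for k
    by (rule Ck_compose[OF Ck_flat_exp]) (intro Ck_diff Ck_const Ck_id)
  then have \<psi>C: "Ck k \<psi>" for k
    unfolding \<psi>_def by (intro Ck_divide Ck_add Ck_flat_exp less_imp_neq[OF pos, symmetric])
  define \<kappa> where "\<kappa> t = t * (1 - \<psi> (t - R)) + (R + 1) * \<psi> (t - R)" for t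
  show thesis
  proof (rule that[of \<kappa>])
    show "Ck k \<kappa>" for k unfolding \<kappa>_def
      by (intro Ck_add Ck_mult Ck_id Ck_const Ck_diff Ck_compose[OF \<psi>C])
    show "\<kappa> t = t" if "t \<le> R" for t using that by (simp add: \<kappa>_def \<psi>_def flat_exp_def)
    show "\<kappa> t = R + 1" if "t \<ge> R + 1" for t using that pos[of "t - R"] by (simp add: \<kappa>_def \<psi>_def flat_exp_def)
    show "\<kappa> t \<ge> R" if "t \<ge> R" for t
    proof -
      have "R * (1 - \<psi> (t - R)) + R * \<psi> (t - R) \<le> \<kappa> t" unfolding \<kappa>_def
        using that \<psi>01 by (intro add_mono mult_right_mono) auto
      then show ?thesis by (simp add: algebra_simps)
    qed
  qed
qed

section \<open>Gradients and truncation of test functions\<close>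

lemma grad_eq:
  assumes "(f has_derivative (\<lambda>h. h \<bullet> D)) (at x)" shows "grad f x = D"
  unfolding grad_def
proof (rule the_equality)
  show "GDERIV f x :> D" using assms by (simp add: gderiv_def)
  show "D' = D" if "GDERIV f x :> D'" for D'
  proof -
    have "(\<lambda>h. h \<bullet> D') = (\<lambda>h. h \<bullet> D)"
      using that assms by (auto simp: gderiv_def intro: has_derivative_unique)
    then have "\<forall>h. h \<bullet> D' = h \<bullet> D" by meson
    then show ?thesis by (simp only: vector_eq_ldot)
  qed
qed

lemma Ck_has_grad:
  assumes "Ck (Suc k) f"
  shows "(f has_derivative (\<lambda>h. h \<bullet> grad f x)) (at x)"
    and "grad f = (\<lambda>x. \<Sum>b\<in>Basis. frechet_derivative f (at x) b *\<^sub>R b)"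
proof -
  note d = Ck_Suc_has_derivative[OF assms]
  have eq: "frechet_derivative f (at x) = (\<lambda>h. h \<bullet> (\<Sum>b\<in>Basis. frechet_derivative f (at x) b *\<^sub>R b))" for x
  proof
    fix h
    show "frechet_derivative f (at x) h = h \<bullet> (\<Sum>b\<in>Basis. frechet_derivative f (at x) b *\<^sub>R b)"
      using Linear_Algebra.linear_componentwise[OF has_derivative_linear[OF d], of x h 1]
      by (simp add: inner_sum_right mult.commute)
  qed
  have D: "(f has_derivative (\<lambda>h. h \<bullet> (\<Sum>b\<in>Basis. frechet_derivative f (at x) b *\<^sub>R b))) (at x)" for x
    using d[of x] by (subst (asm) eq)
  then show g: "grad f = (\<lambda>x. \<Sum>b\<in>Basis. frechet_derivative f (at x) b *\<^sub>R b)"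
    using grad_eq by blast
  show "(f has_derivative (\<lambda>h. h \<bullet> grad f x)) (at x)" unfolding g by (rule D)
qed

lemma Ck_continuous_grad:
  assumes "Ck (Suc k) f" shows "continuous_on UNIV (grad f)"
  unfolding Ck_has_grad(2)[OF assms]
proof (intro continuous_on_sum continuous_on_scaleR continuous_on_const)
  show "continuous_on UNIV (\<lambda>x. frechet_derivative f (at x) b)" for b
    by (rule Ck_imp_continuous[of k]) (use assms in simp)
qed

lemma Ccc_smooth_Ck: "f \<in> Ccc_smooth \<Longrightarrow> Ck k f"
  by (simp add: Ccc_smooth_def smooth_def)

lemma Ccc_smooth_uminus: "f \<in> Ccc_smooth \<Longrightarrow> (\<lambda>x. - f x) \<in> Ccc_smooth"
  unfolding Ccc_smooth_def smooth_def
proof (elim CollectE conjE exE, intro CollectI conjI allI)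
  fix K c assume "compact K" "\<forall>x. x \<notin> K \<longrightarrow> f x = c"
  then show "\<exists>K c. compact K \<and> (\<forall>x. x \<notin> K \<longrightarrow> - f x = c)" by (intro exI[of _ K] exI[of _ "- c"]) auto
next
  fix k assume "\<forall>k. Ck k f"
  then show "Ck k (\<lambda>x. - f x)" by (intro Ck_uminus) blast
qed

lemmas Ccc_smooth_has_derivative = Ck_has_grad(1)[OF Ccc_smooth_Ck]
lemmas Ccc_smooth_continuous = Ck_imp_continuous[OF Ccc_smooth_Ck]
lemmas Ccc_smooth_continuous_grad = Ck_continuous_grad[OF Ccc_smooth_Ck]

lemma grad_uminus:
  assumes "f \<in> Ccc_smooth" shows "grad (\<lambda>x. - f x) x = - grad f x"
  using has_derivative_minus[OF Ccc_smooth_has_derivative[OF assms]] by (intro grad_eq) simp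

lemma Ccc_smooth_grad_zero:
  assumes "f \<in> Ccc_smooth"
  obtains K where "compact K" "\<And>x. x \<notin> K \<Longrightarrow> grad f x = 0"
proof -
  obtain K c where K: "compact K" "\<And>x. x \<notin> K \<Longrightarrow> f x = c" using assms unfolding Ccc_smooth_def by blast
  have "grad f x = 0" if "x \<notin> K" for x
  proof (rule grad_eq)
    have "((\<lambda>x. c) has_derivative (\<lambda>h. h \<bullet> 0)) (at x)" by simp
    then show "(f has_derivative (\<lambda>h. h \<bullet> 0)) (at x)"
      by (rule has_derivative_transform_within_open[of _ _ _ _ "- K"])
         (use K that compact_imp_closed in \<open>auto simp: open_Compl\<close>)
  qed
  then show thesis using that K by blast
qed

lemma Ccc_smooth_bounded:
  assumes "f \<in> Ccc_smooth"
  obtains B where "\<And>x. \<bar>f x\<bar> \<le> B"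
proof -
  obtain K c where K: "compact K" "\<And>x. x \<notin> K \<Longrightarrow> f x = c" using assms unfolding Ccc_smooth_def by blast
  have "compact (f ` K)"
    using K Ccc_smooth_continuous[OF assms] by (meson compact_continuous_image continuous_on_subset subset_UNIV)
  then obtain B where "\<forall>y\<in>f ` K. norm y \<le> B" using compact_imp_bounded bounded_iff by blast
  then have "\<And>x. x \<in> K \<Longrightarrow> \<bar>f x\<bar> \<le> B" by auto
  then have "\<bar>f x\<bar> \<le> max B \<bar>c\<bar>" for x using K(2)[of x] by (cases "x \<in> K") (auto simp: le_max_iff_disj)
  then show thesis using that by blast
qed

text \<open>Functions that grow at infinity lie outside the domain of the operator. Composition with
  the cutoff keeps values and gradient below level \<open>R\<close>; above it the lower bound
  \<open>R\<close> survives, which is enough to keep maxima of \<open>u - f\<close> away.\<close>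

lemma Ccc_smooth_truncation:
  fixes \<phi> :: "'a::euclidean_space \<Rightarrow> real"
  assumes \<phi>: "\<And>k. Ck k \<phi>" and bd: "\<And>c. bounded {x. \<phi> x \<le> c}"
  obtains f where "f \<in> Ccc_smooth" "\<And>x. \<phi> x \<le> R \<Longrightarrow> f x = \<phi> x" "\<And>x. \<phi> x \<ge> R \<Longrightarrow> f x \<ge> R"
     "\<And>x. \<phi> x < R \<Longrightarrow> grad f x = grad \<phi> x"
proof -
  obtain \<kappa> :: "real \<Rightarrow> real" where \<kappa>: "\<And>k. Ck k \<kappa>" "\<And>t. t \<le> R \<Longrightarrow> \<kappa> t = t"
    "\<And>t. t \<ge> R + 1 \<Longrightarrow> \<kappa> t = R + 1" "\<And>t. t \<ge> R \<Longrightarrow> \<kappa> t \<ge> R" using smooth_cutoff by blast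
  have cont: "continuous_on UNIV \<phi>" using \<phi> Ck_imp_continuous by blast
  let ?f = "\<lambda>x. \<kappa> (\<phi> x)"
  show thesis
  proof (rule that[of ?f])
    have "closed {x. \<phi> x \<le> R + 1}" using cont by (intro closed_Collect_le) auto
    then have "compact {x. \<phi> x \<le> R + 1}" using bd compact_eq_bounded_closed by blast
    moreover have "\<forall>x. x \<notin> {x. \<phi> x \<le> R + 1} \<longrightarrow> ?f x = R + 1" using \<kappa>(3) by auto
    moreover have "smooth ?f" unfolding smooth_def using Ck_compose[OF \<kappa>(1) \<phi>] by blast
    ultimately show "?f \<in> Ccc_smooth" unfolding Ccc_smooth_def by blast
    show "grad ?f x = grad \<phi> x" if "\<phi> x < R" for x
    proof (rule grad_eq)
      have "open {x. \<phi> x < R}" using cont by (intro open_Collect_less) auto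
      then show "(?f has_derivative (\<lambda>h. h \<bullet> grad \<phi> x)) (at x)"
        by (rule has_derivative_transform_within_open[OF Ck_has_grad(1)[OF \<phi>]]) (use that \<kappa>(2) in auto)
    qed
  qed (use \<kappa> in auto)
qed

text \<open>Reflecting \<open>v\<close> and \<open>f\<close> exchanges infimum and supremum.
  Arguments about subsolutions thereby serve for supersolutions, with the dual operator in place of
  \<open>A\<close>.\<close>

lemma supersolution_iff_subsolution_dual:
  assumes D: "\<And>f. f \<in> D \<Longrightarrow> (\<lambda>x. - f x) \<in> D"
  shows "viscosity_supersolution D A lam h v \<longleftrightarrow>
    viscosity_subsolution D (\<lambda>f x. - A (\<lambda>y. - f y) x) lam (\<lambda>x. - h x) (\<lambda>x. - v x)"
    (is "?L \<longleftrightarrow> ?R")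
proof -
  have 1: "bdd_below (range v) \<longleftrightarrow> bdd_above (range (\<lambda>x. - v x))"
    unfolding bdd_below_def bdd_above_def by (auto intro: exI[of _ "- _"]) (metis minus_le_iff neg_le_iff_le minus_minus)+
  have 2: "lsc v \<longleftrightarrow> usc (\<lambda>x. - v x)"
    unfolding lsc_def usc_def by (metis (no_types, lifting) Collect_cong minus_less_iff minus_minus)
  have sup: "(SUP y. - v y - f y) = - (INF y. v y - (- f y))" for f
    by (simp add: Inf_real_def image_image o_def)
  have lim: "(\<lambda>n. - v (x n) - f (x n)) \<longlonglongrightarrow> (SUP y. - v y - f y) \<longleftrightarrow>
     (\<lambda>n. v (x n) - (- f (x n))) \<longlonglongrightarrow> (INF y. v y - (- f y))" for f and x :: "nat \<Rightarrow> _"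
  proof -
    have "(\<lambda>n. - (- v (x n) - f (x n))) = (\<lambda>n. v (x n) - (- f (x n)))" by auto
    then show ?thesis
      unfolding sup using tendsto_minus_cancel_left[of "\<lambda>n. - v (x n) - f (x n)" "INF y. v y - (- f y)" sequentially]
      by simp
  qed
  have lim2: "(\<lambda>n. - v (x n) - lam * (- a (x n)) - (- h (x n))) \<longlonglongrightarrow> l \<longleftrightarrow>
     (\<lambda>n. v (x n) - lam * a (x n) - h (x n)) \<longlonglongrightarrow> - l" for a l and x :: "nat \<Rightarrow> _"
  proof -
    have "(\<lambda>n. - (- v (x n) - lam * (- a (x n)) - (- h (x n)))) = (\<lambda>n. v (x n) - lam * a (x n) - h (x n))" by auto
    then show ?thesis
      using tendsto_minus_cancel_left[of "\<lambda>n. - v (x n) - lam * (- a (x n)) - (- h (x n))" "- l" sequentially]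
      by simp
  qed
  let ?P = "\<lambda>f. \<exists>(x :: nat \<Rightarrow> 'a) l. (\<lambda>n. v (x n) - f (x n)) \<longlonglongrightarrow> (INF y. v y - f y) \<and>
        (\<lambda>n. v (x n) - lam * A f (x n) - h (x n)) \<longlonglongrightarrow> l \<and> l \<ge> 0"
  let ?Q = "\<lambda>f. \<exists>(x :: nat \<Rightarrow> 'a) l. (\<lambda>n. - v (x n) - f (x n)) \<longlonglongrightarrow> (SUP y. - v y - f y) \<and>
        (\<lambda>n. - v (x n) - lam * (- A (\<lambda>y. - f y) (x n)) - (- h (x n))) \<longlonglongrightarrow> l \<and> l \<le> 0"
  have PQ: "?Q f \<longleftrightarrow> ?P (\<lambda>y. - f y)" for f
  proof
    assume "?Q f"
    then obtain x l where "(\<lambda>n. v (x n) - (- f (x n))) \<longlonglongrightarrow> (INF y. v y - (- f y))"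
      "(\<lambda>n. v (x n) - lam * A (\<lambda>y. - f y) (x n) - h (x n)) \<longlonglongrightarrow> - l" "l \<le> 0"
      unfolding lim lim2 by blast
    then show "?P (\<lambda>y. - f y)" by (intro exI[of _ x] exI[of _ "- l"]) simp
  next
    assume "?P (\<lambda>y. - f y)"
    then obtain x l where "(\<lambda>n. v (x n) - (- f (x n))) \<longlonglongrightarrow> (INF y. v y - (- f y))"
      "(\<lambda>n. v (x n) - lam * A (\<lambda>y. - f y) (x n) - h (x n)) \<longlonglongrightarrow> l" "l \<ge> 0"
      by blast
    then show "?Q f" unfolding lim lim2 by (intro exI[of _ x] exI[of _ "- l"]) simp
  qed
  have 3: "(\<forall>f\<in>D. ?P f) \<longleftrightarrow> (\<forall>f\<in>D. ?Q f)"
  proof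
    assume "\<forall>f\<in>D. ?Q f"
    then have Q: "?Q f" if "f \<in> D" for f using that by blast
    show "\<forall>f\<in>D. ?P f"
    proof
      fix f assume "f \<in> D"
      from iffD1[OF PQ[of "\<lambda>x. - f x"] Q[OF D[OF this]]]
      show "?P f" by (simp only: minus_minus)
    qed
  next
    assume "\<forall>f\<in>D. ?P f"
    then have P: "?P f" if "f \<in> D" for f using that by blast
    show "\<forall>f\<in>D. ?Q f"
    proof
      fix f assume "f \<in> D"
      from iffD2[OF PQ[of f] P[OF D[OF this]]] show "?Q f" .
    qed
  qed
  show ?thesis
    unfolding viscosity_subsolution_def viscosity_supersolution_def
    by (intro arg_cong2[of _ _ _ _ "(\<and>)"] 1 2 3)
qed

text \<open>The definition speaks only of sequences that almost maximise \<open>u - f\<close>. Once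
  the maximum is made strict they converge to the maximiser, and continuity of \<open>H\<close> and
  \<open>h\<close> carries the inequality to that point.\<close>

lemma subsolution_touching:
  fixes H :: "'a::euclidean_space \<Rightarrow> 'a \<Rightarrow> real"
  assumes u: "viscosity_subsolution Ccc_smooth (\<lambda>f x. H x (grad f x)) lam h u"
    and H: "continuous_on UNIV (\<lambda>(x, p). H x p)" and h: "continuous_on UNIV h"
    and \<phi>: "\<And>k. Ck k \<phi>" "\<And>x. \<phi> x \<ge> 0"
    and touch: "\<And>x. u x - \<phi> x \<le> u z - \<phi> z"
  shows "u z - lam * H z (grad \<phi> z) - h z \<le> 0"
proof -
  obtain M where M: "\<And>x. u x \<le> M" using u by (auto simp: viscosity_subsolution_def bdd_above_def)
  \<comment> \<open>The added square leaves the gradient at \<open>z\<close> unchanged, makes the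
    maximum strict and gives bounded sublevel sets.\<close>
  let ?\<phi> = "\<lambda>x. \<phi> x + (norm (x - z))\<^sup>2"
  have C: "Ck k ?\<phi>" for k by (intro Ck_add \<phi> Ck_norm_square)
  have bd: "bounded {x. ?\<phi> x \<le> c}" for c
  proof (rule boundedI)
    fix x assume "x \<in> {x. ?\<phi> x \<le> c}"
    then have "(norm (x - z))\<^sup>2 \<le> c" using \<phi>(2)[of x] by simp
    then have "norm (x - z) \<le> sqrt c" by (rule real_le_rsqrt)
    then show "norm x \<le> norm z + sqrt c" by (smt (verit) norm_triangle_sub)
  qed
  have gz: "grad ?\<phi> z = grad \<phi> z"
    by (rule grad_eq) (use has_derivative_add[OF Ck_has_grad(1)[OF \<phi>(1)] has_derivative_norm_square[of z z]] in simp)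
  \<comment> \<open>Where \<open>f\<close> is at least \<open>R\<close>, the bound on
    \<open>u\<close> gives \<open>u - f \<le> M - R\<close>, which is 1 below the value at
    \<open>z\<close>.\<close>
  define R where "R = M - u z + \<phi> z + 1"
  have R: "\<phi> z < R" using M[of z] by (simp add: R_def)
  obtain f where f: "f \<in> Ccc_smooth" "\<And>x. ?\<phi> x \<le> R \<Longrightarrow> f x = ?\<phi> x" "\<And>x. ?\<phi> x \<ge> R \<Longrightarrow> f x \<ge> R"
     "\<And>x. ?\<phi> x < R \<Longrightarrow> grad f x = grad ?\<phi> x" using Ccc_smooth_truncation[OF C bd] by blast
  have fz: "f z = \<phi> z" "grad f z = grad \<phi> z" using f(2,4)[of z] R gz by simp_all
  have le: "u x - f x \<le> u z - f z - min ((norm (x - z))\<^sup>2) 1" for x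
  proof (cases "?\<phi> x \<le> R")
    case True then show ?thesis using f(2)[OF True] touch[of x] fz by simp
  next
    case False then have "f x \<ge> R" using f(3) by simp
    then show ?thesis using M[of x] fz by (simp add: R_def)
  qed
  have sup: "(SUP y. u y - f y) = u z - f z"
    by (rule cSup_eq_maximum) (auto intro: order_trans[OF le])
  obtain x l where x: "(\<lambda>n. u (x n) - f (x n)) \<longlonglongrightarrow> u z - f z"
    "(\<lambda>n. u (x n) - lam * H (x n) (grad f (x n)) - h (x n)) \<longlonglongrightarrow> l" "l \<le> 0"
    using u f(1) unfolding viscosity_subsolution_def sup[symmetric] by blast
  have "(\<lambda>n. min ((norm (x n - z))\<^sup>2) 1) \<longlonglongrightarrow> 0"
  proof (rule tendsto_sandwich[of "\<lambda>_. 0"])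
    show "(\<lambda>n. (u z - f z) - (u (x n) - f (x n))) \<longlonglongrightarrow> 0" using tendsto_diff[OF tendsto_const[of "u z - f z"] x(1)] by simp
    show "\<forall>\<^sub>F n in sequentially. min ((norm (x n - z))\<^sup>2) 1 \<le> (u z - f z) - (u (x n) - f (x n))"
      using le by (intro always_eventually allI) (smt (verit))
  qed auto
  moreover from this have "\<forall>\<^sub>F n in sequentially. min ((norm (x n - z))\<^sup>2) 1 < 1" by (simp add: order_tendstoD)
  ultimately have "(\<lambda>n. (norm (x n - z))\<^sup>2) \<longlonglongrightarrow> 0"
    by (elim Lim_transform_eventually) (auto elim: eventually_mono simp: min_def split: if_splits)
  then have "(\<lambda>n. norm (x n - z)) \<longlonglongrightarrow> 0"
    using tendsto_real_sqrt[of "\<lambda>n. (norm (x n - z))\<^sup>2" 0] by simp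
  then have xz: "x \<longlonglongrightarrow> z" by (simp add: LIM_zero_iff tendsto_norm_zero_iff)
  have tc: "(\<lambda>n. g (x n)) \<longlonglongrightarrow> g z" if "continuous_on UNIV g" for g :: "'a \<Rightarrow> 'b::topological_space"
    by (rule continuous_on_tendsto_compose[OF that xz]) auto
  have "(\<lambda>n. (x n, grad f (x n))) \<longlonglongrightarrow> (z, grad f z)"
    by (intro tendsto_Pair xz tc Ccc_smooth_continuous_grad f(1))
  then have Hl: "(\<lambda>n. H (x n) (grad f (x n))) \<longlonglongrightarrow> H z (grad f z)"
    using continuous_on_tendsto_compose[OF H] by fastforce
  \<comment> \<open>\<open>u\<close> is only semicontinuous; its values converge because those of
    \<open>u - f\<close> and of \<open>f\<close> do.\<close>
  have "(\<lambda>n. (u (x n) - f (x n)) + f (x n)) \<longlonglongrightarrow> (u z - f z) + f z"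
    by (intro tendsto_add x(1) tc Ccc_smooth_continuous f(1))
  then have ul: "(\<lambda>n. u (x n)) \<longlonglongrightarrow> u z" by simp
  have "(\<lambda>n. u (x n) - lam * H (x n) (grad f (x n)) - h (x n)) \<longlonglongrightarrow> u z - lam * H z (grad f z) - h z"
    by (intro tendsto_diff tendsto_mult tendsto_const Hl ul tc[OF h])
  then show ?thesis using LIMSEQ_unique[OF x(2)] x(3) fz by simp
qed

section \<open>The comparison principle\<close>

text \<open>Without a maximum the open sets \<open>{x. F x < F y}\<close> would cover the compact
  superlevel set. Among the points \<open>y\<close> of a finite subcover, one with the largest value
  would belong to no member of it.\<close>

lemma usc_attains_max:
  fixes F :: "'a::euclidean_space \<Rightarrow> real"
  assumes F: "usc F" and bd: "bounded {x. F z0 \<le> F x}"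
  obtains z where "\<And>x. F x \<le> F z"
proof -
  let ?S = "{x. F z0 \<le> F x}"
  have "?S = - {x. F x < F z0}" by auto
  then have S: "compact ?S" using F bd unfolding usc_def compact_eq_bounded_closed by (simp add: closed_Compl)
  have "\<exists>z\<in>?S. \<forall>x\<in>?S. F x \<le> F z"
  proof (rule ccontr)
    assume "\<not> ?thesis"
    then have "\<exists>y\<in>?S. F x < F y" if "x \<in> ?S" for x using that by (meson not_le)
    then have "?S \<subseteq> (\<Union>y\<in>?S. {x. F x < F y})" by blast
    then obtain T where T: "T \<subseteq> ?S" "finite T" "?S \<subseteq> (\<Union>y\<in>T. {x. F x < F y})"
      using compactE_image[OF S, of ?S "\<lambda>y. {x. F x < F y}"] F unfolding usc_def by blast
    have "z0 \<in> ?S" by simp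
    then have ne: "T \<noteq> {}" using T(3) by blast
    then obtain y where y: "y \<in> T" "F y = Max (F ` T)" using T(2) by (metis (no_types, lifting) Max_in empty_is_image finite_imageI imageE)
    then obtain y' where "y' \<in> T" "F y < F y'" using T by blast
    then show False using y T(2) by (metis Max_ge finite_imageI imageI not_le)
  qed
  then obtain z where z: "F z0 \<le> F z" "\<And>x. F z0 \<le> F x \<Longrightarrow> F x \<le> F z" by blast
  then have "F x \<le> F z" for x by (meson linear order_trans)
  then show thesis using that by blast
qed

lemma usc_add: assumes "usc f" "usc g" shows "usc (\<lambda>x. f x + g x)"
  unfolding usc_def
proof
  fix c
  have "{x. f x + g x < c} = (\<Union>r. {x. f x < r} \<inter> {x. g x < c - r})"
  proof (intro set_eqI iffI)
    fix x assume "x \<in> {x. f x + g x < c}"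
    then obtain r where "f x < r" "r < c - g x" using dense[of "f x" "c - g x"] by auto
    then show "x \<in> (\<Union>r. {x. f x < r} \<inter> {x. g x < c - r})" by (auto intro: exI[of _ r])
  qed auto
  then show "open {x. f x + g x < c}"
    by (simp only:) (intro open_UN ballI open_Int assms[unfolded usc_def, rule_format])
qed

lemma usc_cmult: assumes "usc f" "c > 0" shows "usc (\<lambda>x. c * f x)"
proof -
  have "{x. c * f x < r} = {x. f x < r / c}" for r using assms(2) by (auto simp: field_simps)
  then show ?thesis using assms(1) unfolding usc_def by simp
qed

lemma usc_compose: assumes "usc f" "continuous_on UNIV g" shows "usc (\<lambda>x. f (g x))"
  unfolding usc_def
proof
  fix c
  have "open (g -` {x. f x < c})" using assms by (intro open_vimage) (auto simp: usc_def)
  then show "open {x. f (g x) < c}" by (simp add: vimage_def)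
qed

lemma usc_continuous: "continuous_on UNIV f \<Longrightarrow> usc f"
  unfolding usc_def by (auto intro!: open_Collect_less continuous_on_const)

lemma viscosity_subsolution_cong:
  assumes "\<And>f x. f \<in> D \<Longrightarrow> A f x = B f x"
  shows "viscosity_subsolution D A lam h u \<longleftrightarrow> viscosity_subsolution D B lam h u"
  unfolding viscosity_subsolution_def using assms by simp

text \<open>Logarithmic growth is the right scale: sublevel sets are bounded, while the gradient
  \<open>x / (1 + |x|^2)\<close> decays like \<open>1 / |x|\<close>, fast enough to offset linear
  growth of \<open>a\<close> and of the outward part of \<open>b\<close>.\<close>

definition lyapunov :: "'a::euclidean_space \<Rightarrow> real" where
  "lyapunov x = ln (1 + (norm x)\<^sup>2) / 2"

lemma lyapunov_nonneg: "lyapunov x \<ge> 0" by (simp add: lyapunov_def)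

lemma Ck_lyapunov: "Ck k lyapunov"
proof -
  have "Ck k (\<lambda>x::'a. (1/2) * ln (1 + (norm (x - 0))\<^sup>2))"
    by (intro Ck_mult Ck_const Ck_ln Ck_add Ck_norm_square) (simp add: add_pos_nonneg)
  moreover have "lyapunov = (\<lambda>x::'a. (1/2) * ln (1 + (norm (x - 0))\<^sup>2))" by (auto simp: lyapunov_def)
  ultimately show ?thesis by simp
qed

lemma has_derivative_lyapunov:
  "(lyapunov has_derivative (\<lambda>h. h \<bullet> (x /\<^sub>R (1 + (norm x)\<^sup>2)))) (at x)"
proof -
  have pos: "1 + (norm x)\<^sup>2 > 0" by (simp add: add_pos_nonneg)
  have "((\<lambda>x. 1 + (norm x)\<^sup>2) has_derivative (\<lambda>h. h \<bullet> (2 *\<^sub>R x))) (at x)"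
    using has_derivative_add[OF has_derivative_const has_derivative_norm_square[of 0 x], of 1] by simp
  from has_derivative_ln[OF pos this]
  have "((\<lambda>x. ln (1 + (norm x)\<^sup>2) * (1/2)) has_derivative (\<lambda>h. (h \<bullet> (2 *\<^sub>R x)) * inverse (1 + (norm x)\<^sup>2) * (1/2))) (at x)"
    by (intro has_derivative_mult_left) (simp add: field_simps)
  moreover have "lyapunov = (\<lambda>x::'a. ln (1 + (norm x)\<^sup>2) * (1/2))" by (auto simp: lyapunov_def)
  moreover have "(\<lambda>h. (h \<bullet> (2 *\<^sub>R x)) * inverse (1 + (norm x)\<^sup>2) * (1/2)) = (\<lambda>h. h \<bullet> (x /\<^sub>R (1 + (norm x)\<^sup>2)))"
    by (auto simp: field_simps)
  ultimately show ?thesis by simp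
qed

lemma norm_le_of_lyapunov: "lyapunov x \<le> c \<Longrightarrow> norm x \<le> sqrt (exp (2 * c))"
proof (rule real_le_rsqrt)
  assume "lyapunov x \<le> c"
  then have "ln (1 + (norm x)\<^sup>2) \<le> 2 * c" by (simp add: lyapunov_def)
  then have "1 + (norm x)\<^sup>2 \<le> exp (2 * c)" by (metis add_pos_nonneg exp_le_cancel_iff exp_ln zero_le_power2 zero_less_one)
  then show "(norm x)\<^sup>2 \<le> exp (2 * c)" by simp
qed

text \<open>The properties of the Hamiltonian on which comparison and existence rest. Subgradients
  are required only up to \<open>e\<close>, which suits a supremum over measures whose attainment is
  left open, but with a norm bound uniform in \<open>e\<close>. Convexity is a consequence.\<close>

locale coercive_hamiltonian =
  fixes H :: "'a::euclidean_space \<Rightarrow> 'a \<Rightarrow> real"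
  assumes H_continuous: "continuous_on UNIV (\<lambda>(x, p). H x p)"
    and H_zero: "H x 0 = 0"
    and H_coercive: "compact K \<Longrightarrow> \<exists>c>0. \<exists>C. \<forall>x\<in>K. \<forall>p. c * (norm p)\<^sup>2 - C \<le> H x p"
    and H_subgradient: "compact K \<Longrightarrow>
      \<exists>Q. \<forall>x\<in>K. \<forall>p\<in>K. \<forall>e>0. \<exists>q. norm q \<le> Q \<and> (\<forall>p'. H x p + q \<bullet> (p' - p) - e \<le> H x p')"
    and H_lyapunov: "\<exists>C. \<forall>x. H x (x /\<^sub>R (1 + (norm x)\<^sup>2)) \<le> C"
begin

lemma H_convex:
  assumes "0 \<le> t" "t \<le> 1"
  shows "H x ((1 - t) *\<^sub>R p + t *\<^sub>R p') \<le> (1 - t) * H x p + t * H x p'"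
proof (rule field_le_epsilon)
  fix e :: real assume "e > 0"
  \<comment> \<open>Average the two affine bounds given by an almost exact subgradient at the
    intermediate point; the linear terms cancel. The compact set in \<open>H_subgradient\<close>
    only has to contain position and momentum.\<close>
  let ?m = "(1 - t) *\<^sub>R p + t *\<^sub>R p'"
  have "compact {x, ?m}" by simp
  then obtain q where q: "\<And>p'. H x ?m + q \<bullet> (p' - ?m) - e \<le> H x p'"
    using H_subgradient[of "{x, ?m}"] \<open>e > 0\<close> by blast
  have "(1 - t) * (H x ?m + q \<bullet> (p - ?m) - e) + t * (H x ?m + q \<bullet> (p' - ?m) - e) \<le> (1 - t) * H x p + t * H x p'"
    using assms q by (intro add_mono mult_left_mono) auto
  moreover have "(1 - t) * (H x ?m + q \<bullet> (p - ?m) - e) + t * (H x ?m + q \<bullet> (p' - ?m) - e)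
     = H x ?m - e + q \<bullet> ((1 - t) *\<^sub>R (p - ?m) + t *\<^sub>R (p' - ?m))"
    by (simp add: inner_add_right algebra_simps)
  moreover have "(1 - t) *\<^sub>R (p - ?m) + t *\<^sub>R (p' - ?m) = 0"
    by (simp add: algebra_simps flip: scaleR_add_left)
  ultimately show "H x ?m \<le> (1 - t) * H x p + t * H x p' + e" by simp
qed

theorem comparison:
  assumes h: "continuous_on UNIV h" "\<And>x. \<bar>h x\<bar> \<le> B" and lam: "lam > 0"
    and u: "viscosity_subsolution Ccc_smooth (\<lambda>f x. H x (grad f x)) lam h u"
    and v: "viscosity_supersolution Ccc_smooth (\<lambda>f x. H x (grad f x)) lam h v"
  shows "u x0 \<le> v x0"
proof -
  \<comment> \<open>With \<open>- v\<close> a subsolution for the Hamiltonian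
    \<open>- H x (- p)\<close>, \<open>subsolution_touching\<close> serves both sides.\<close>
  have v': "viscosity_subsolution Ccc_smooth (\<lambda>f x. - H x (- grad f x)) lam (\<lambda>x. - h x) (\<lambda>x. - v x)"
  proof (rule viscosity_subsolution_cong[THEN iffD1])
    show "viscosity_subsolution Ccc_smooth (\<lambda>f x. - H x (grad (\<lambda>y. - f y) x)) lam (\<lambda>x. - h x) (\<lambda>x. - v x)"
      by (rule iffD1[OF supersolution_iff_subsolution_dual v]) (rule Ccc_smooth_uminus)
  qed (simp add: grad_uminus)
  have H': "continuous_on UNIV (\<lambda>(x, p). - H x (- p))"
  proof -
    have "continuous_on UNIV (\<lambda>z. (\<lambda>(x, p). H x p) (fst z, - snd z))"
      by (rule continuous_on_compose2[OF H_continuous]) (auto intro!: continuous_intros)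
    then show ?thesis by (auto simp: split_def intro: continuous_on_minus)
  qed
  have h': "continuous_on UNIV (\<lambda>x. - h x)" by (intro continuous_on_minus h)
  obtain Cl where Cl: "\<And>x. H x (x /\<^sub>R (1 + (norm x)\<^sup>2)) \<le> Cl" using H_lyapunov by blast
  obtain M1 where M1: "\<And>x. u x \<le> M1" using u by (auto simp: viscosity_subsolution_def bdd_above_def)
  obtain M2 where M2: "\<And>x. M2 \<le> v x" using v by (auto simp: viscosity_supersolution_def bdd_below_def)
  define M where "M = max 0 (max M1 (- M2))"
  have M: "u x \<le> M" "- v x \<le> M" "M \<ge> 0" for x using M1[of x] M2[of x] by (auto simp: M_def)
  \<comment> \<open>The weight \<open>1 - e\<close> on \<open>v\<close> matches the convex
    combination of \<open>p\<close> and the gradient of the logarithm on the other side, so that the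
    differences of \<open>H\<close> and of \<open>h\<close> appear with a common factor.\<close>
  have main: "u x0 - (1 - e) * v x0 - e * lyapunov x0 \<le> e * (lam * Cl + B)" if e: "0 < e" "e < 1" for e
  proof -
    \<comment> \<open>The value of the penalised difference at \<open>(x0, x0)\<close> for every
      \<open>\<alpha>\<close>, hence a lower bound for all its maxima.\<close>
    define m0 where "m0 = u x0 - (1 - e) * v x0 - e * lyapunov x0"
    define \<Phi> where "\<Phi> \<alpha> z = u (fst z) - (1 - e) * v (snd z) - (1 - e) * (\<alpha> / 2) * (norm (fst z - snd z))\<^sup>2 - e * lyapunov (fst z)"
      for \<alpha> :: real and z :: "'a \<times> 'a"
    define W where "W = 2 * M - m0"
    have me: "- ((1 - e) * v y) \<le> M" for y
    proof -
      have "(1 - e) * (- v y) \<le> (1 - e) * M" using M(2)[of y] e by (intro mult_left_mono) auto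
      also have "\<dots> \<le> 1 * M" using M(3) e by (intro mult_right_mono) auto
      finally show ?thesis by simp
    qed
    \<comment> \<open>Each penalty is at most the drop from the upper bound \<open>2 * M\<close> to
      \<open>m0\<close>, independently of \<open>\<alpha>\<close>.\<close>
    have W: "e * lyapunov x \<le> W" "(1 - e) * (\<alpha> / 2) * (norm (x - y))\<^sup>2 \<le> W" "(1 - e) * v y \<le> M - m0"
      if "m0 \<le> \<Phi> \<alpha> (x, y)" "\<alpha> > 0" for \<alpha> x y
    proof -
      have "0 \<le> (1 - e) * (\<alpha> / 2) * (norm (x - y))\<^sup>2" "0 \<le> e * lyapunov x" using e that lyapunov_nonneg[of x] by auto
      moreover have "m0 \<le> u x - (1 - e) * v y - (1 - e) * (\<alpha> / 2) * (norm (x - y))\<^sup>2 - e * lyapunov x"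
        using that(1) unfolding \<Phi>_def fst_conv snd_conv .
      moreover note M(1)[of x] me[of y]
      ultimately have "e * lyapunov x \<le> 2 * M - m0 \<and> (1 - e) * (\<alpha> / 2) * (norm (x - y))\<^sup>2 \<le> 2 * M - m0
          \<and> (1 - e) * v y \<le> M - m0" by (intro conjI; linarith)
      then show "e * lyapunov x \<le> W" "(1 - e) * (\<alpha> / 2) * (norm (x - y))\<^sup>2 \<le> W" "(1 - e) * v y \<le> M - m0"
        unfolding W_def by auto
    qed
    define R1 where "R1 = sqrt (exp (2 * (W / e)))"
    have xR: "norm x \<le> R1" if "m0 \<le> \<Phi> \<alpha> (x, y)" "\<alpha> > 0" for \<alpha> x y
    proof -
      have "lyapunov x \<le> W / e" using W(1)[OF that] e by (simp add: field_simps)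
      then show ?thesis unfolding R1_def by (rule norm_le_of_lyapunov)
    qed
    have d2: "(norm (x - y))\<^sup>2 \<le> 2 * W / ((1 - e) * \<alpha>)" if "m0 \<le> \<Phi> \<alpha> (x, y)" "\<alpha> > 0" for \<alpha> x y
      using W(2)[OF that] e that(2) by (simp add: field_simps)
    have \<Phi>x0: "\<Phi> \<alpha> (x0, x0) = m0" for \<alpha> by (simp add: \<Phi>_def m0_def)
    \<comment> \<open>Superlevel sets are bounded: the logarithm confines \<open>x\<close>, and the
      quadratic penalty keeps \<open>y\<close> near it.\<close>
    have "\<exists>z. \<forall>w. \<Phi> \<alpha> w \<le> \<Phi> \<alpha> z" if \<alpha>: "\<alpha> > 0" for \<alpha>
    proof -
      let ?r = "\<lambda>z::'a\<times>'a. - ((1 - e) * (\<alpha> / 2) * (norm (fst z - snd z))\<^sup>2 + e * lyapunov (fst z))"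
      have cl: "continuous_on UNIV (\<lambda>z::'a\<times>'a. lyapunov (fst z))"
        by (rule continuous_on_compose2[OF Ck_imp_continuous[OF Ck_lyapunov[of 0]]]) (auto intro!: continuous_intros)
      have "usc (\<lambda>z. u (fst z) + ((1 - e) * - v (snd z) + ?r z))"
      proof (intro usc_add usc_cmult)
        show "usc (\<lambda>z::'a\<times>'a. u (fst z))" 
          by (rule usc_compose) (use u in \<open>auto simp: viscosity_subsolution_def intro!: continuous_intros\<close>)
        have "usc (\<lambda>x. - v x)" using v' by (simp add: viscosity_subsolution_def)
        then show "usc (\<lambda>z::'a\<times>'a. - v (snd z))"
          by (rule usc_compose) (auto intro!: continuous_intros)
        show "usc ?r" by (intro usc_continuous continuous_intros cl)
      qed (use e in auto)
      moreover have "(\<lambda>z. u (fst z) + ((1 - e) * - v (snd z) + ?r z)) = \<Phi> \<alpha>"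
        by (auto simp: \<Phi>_def algebra_simps)
      ultimately have us: "usc (\<Phi> \<alpha>)" by simp
      have "bounded {z. \<Phi> \<alpha> (x0, x0) \<le> \<Phi> \<alpha> z}"
      proof (rule bounded_subset)
        show "bounded (cball (0::'a) R1 \<times> cball (0::'a) (R1 + sqrt (2 * W / ((1 - e) * \<alpha>))))"
          by (intro bounded_Times bounded_cball)
        show "{z. \<Phi> \<alpha> (x0, x0) \<le> \<Phi> \<alpha> z} \<subseteq> cball 0 R1 \<times> cball 0 (R1 + sqrt (2 * W / ((1 - e) * \<alpha>)))"
        proof
          fix z assume "z \<in> {z. \<Phi> \<alpha> (x0, x0) \<le> \<Phi> \<alpha> z}"
          then obtain x y where z: "z = (x, y)" "m0 \<le> \<Phi> \<alpha> (x, y)" using \<Phi>x0 by (cases z) auto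
          have "norm (x - y) \<le> sqrt (2 * W / ((1 - e) * \<alpha>))" using d2[OF z(2) \<alpha>] by (rule real_le_rsqrt)
          moreover have "norm y \<le> norm x + norm (x - y)" using norm_triangle_sub[of y x] by (simp add: norm_minus_commute)
          ultimately show "z \<in> cball 0 R1 \<times> cball 0 (R1 + sqrt (2 * W / ((1 - e) * \<alpha>)))"
            using xR[OF z(2) \<alpha>] z(1) by auto
        qed
      qed
      then show ?thesis using usc_attains_max[OF us] by metis
    qed
    then have "\<exists>x y. \<forall>w. \<Phi> (real (Suc n)) w \<le> \<Phi> (real (Suc n)) (x, y)" for n
      by (metis of_nat_0_less_iff surj_pair zero_less_Suc)
    then obtain x y where xy: "\<And>n w. \<Phi> (real (Suc n)) w \<le> \<Phi> (real (Suc n)) (x n, y n)" by metis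
    define p where "p n = real (Suc n) *\<^sub>R (x n - y n)" for n
    have m0: "m0 \<le> \<Phi> (real (Suc n)) (x n, y n)" for n using xy[of n "(x0, x0)"] \<Phi>x0 by simp
    \<comment> \<open>With \<open>x n\<close> fixed and after division by \<open>1 - e\<close>, the
      point \<open>y n\<close> maximises \<open>- v\<close> minus the quadratic penalty.\<close>
    have super: "lam * H (y n) (p n) + h (y n) \<le> v (y n)" for n
    proof -
      let ?\<phi> = "\<lambda>z. (real (Suc n) / 2) * (norm (z - x n))\<^sup>2"
      have g: "grad ?\<phi> (y n) = - p n"
      proof (rule grad_eq)
        have "(?\<phi> has_derivative (\<lambda>h. (real (Suc n) / 2) * (h \<bullet> (2 *\<^sub>R (y n - x n))))) (at (y n))"
          by (intro has_derivative_mult_right has_derivative_norm_square)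
        moreover have "(\<lambda>h. (real (Suc n) / 2) * (h \<bullet> (2 *\<^sub>R (y n - x n)))) = (\<lambda>h. h \<bullet> (- p n))"
        proof -
          have "(N / 2) * (h \<bullet> (2 *\<^sub>R (v - w))) = h \<bullet> (- (N *\<^sub>R (w - v)))" for h v w :: 'a and N
            by (simp add: inner_diff_right algebra_simps)
          then show ?thesis unfolding p_def by (intro ext) (simp only:)
        qed
        ultimately show "(?\<phi> has_derivative (\<lambda>h. h \<bullet> (- p n))) (at (y n))" by simp
      qed
      have "- v (y n) - lam * (- H (y n) (- grad ?\<phi> (y n))) - (- h (y n)) \<le> 0"
      proof (rule subsolution_touching[OF v' H' h'])
        show "Ck k ?\<phi>" for k by (intro Ck_mult Ck_const Ck_norm_square)
        show "- v z - ?\<phi> z \<le> - v (y n) - ?\<phi> (y n)" for z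
        proof -
          have "(1 - e) * (- v z - ?\<phi> z) \<le> (1 - e) * (- v (y n) - ?\<phi> (y n))"
            using xy[of n "(x n, z)"] by (simp add: \<Phi>_def algebra_simps norm_minus_commute)
          then show ?thesis using e by simp
        qed
      qed auto
      then show ?thesis using g by simp
    qed
    \<comment> \<open>With \<open>y n\<close> fixed, the gradient of the penalty at
      \<open>x n\<close> is a convex combination, and \<open>H_convex\<close> splits off its
      logarithmic part at the cost \<open>e * Cl\<close>.\<close>
    have sub: "u (x n) \<le> lam * ((1 - e) * H (x n) (p n) + e * Cl) + h (x n)" for n
    proof -
      let ?\<phi> = "\<lambda>z. ((1 - e) * (real (Suc n) / 2)) * (norm (z - y n))\<^sup>2 + e * lyapunov z"
      let ?q = "(1 - e) *\<^sub>R p n + e *\<^sub>R (x n /\<^sub>R (1 + (norm (x n))\<^sup>2))"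
      have g: "grad ?\<phi> (x n) = ?q"
      proof (rule grad_eq)
        have "(?\<phi> has_derivative (\<lambda>h. ((1 - e) * (real (Suc n) / 2)) * (h \<bullet> (2 *\<^sub>R (x n - y n))) + e * (h \<bullet> (x n /\<^sub>R (1 + (norm (x n))\<^sup>2))))) (at (x n))"
          by (intro has_derivative_add has_derivative_mult_right has_derivative_norm_square has_derivative_lyapunov)
        moreover have "(\<lambda>h. ((1 - e) * (real (Suc n) / 2)) * (h \<bullet> (2 *\<^sub>R (x n - y n))) + e * (h \<bullet> (x n /\<^sub>R (1 + (norm (x n))\<^sup>2)))) = (\<lambda>h. h \<bullet> ?q)"
        proof -
          have "((1 - e) * (N / 2)) * (h \<bullet> (2 *\<^sub>R d)) + e * (h \<bullet> w) = h \<bullet> ((1 - e) *\<^sub>R (N *\<^sub>R d) + e *\<^sub>R w)"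
            for h d w :: 'a and N by (simp add: inner_add_right)
          then show ?thesis unfolding p_def by (intro ext) (simp only:)
        qed
        ultimately show "(?\<phi> has_derivative (\<lambda>h. h \<bullet> ?q)) (at (x n))" by simp
      qed
      have "u (x n) - lam * H (x n) (grad ?\<phi> (x n)) - h (x n) \<le> 0"
      proof (rule subsolution_touching[OF u H_continuous h(1)])
        show "Ck k ?\<phi>" for k by (intro Ck_add Ck_mult Ck_const Ck_norm_square Ck_lyapunov)
        show "?\<phi> z \<ge> 0" for z using e lyapunov_nonneg[of z] by simp
        show "u z - ?\<phi> z \<le> u (x n) - ?\<phi> (x n)" for z
          using xy[of n "(z, y n)"] by (simp add: \<Phi>_def algebra_simps)
      qed
      moreover have "H (x n) ?q \<le> (1 - e) * H (x n) (p n) + e * Cl"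
        using H_convex[of e "x n" "p n" "x n /\<^sub>R (1 + (norm (x n))\<^sup>2)"] mult_left_mono[OF Cl[of "x n"], of e] e by linarith
      then have "lam * H (x n) ?q \<le> lam * ((1 - e) * H (x n) (p n) + e * Cl)" using lam by simp
      ultimately show ?thesis using g by simp
    qed
    define R2 where "R2 = R1 + sqrt (2 * W / (1 - e))"
    have "0 \<le> (1 - e) * (real (Suc 0) / 2) * (norm (x 0 - y 0))\<^sup>2" using e by simp
    then have W0: "W \<ge> 0" using W(2)[OF m0[of 0]] by linarith
    have dn: "(norm (x n - y n))\<^sup>2 \<le> (2 * W / (1 - e)) * inverse (real (Suc n))" for n
      using d2[OF m0[of n]] by (simp add: field_simps)
    have lim: "(\<lambda>n. norm (x n - y n)) \<longlonglongrightarrow> 0"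
    proof -
      have "(\<lambda>n. (2 * W / (1 - e)) * inverse (real (Suc n))) \<longlonglongrightarrow> 0"
        by (rule tendsto_mult_right_zero[OF LIMSEQ_inverse_real_of_nat])
      then have "(\<lambda>n. (norm (x n - y n))\<^sup>2) \<longlonglongrightarrow> 0"
        by (rule tendsto_sandwich[OF _ _ tendsto_const, rotated 2]) (use dn in auto)
      from tendsto_real_sqrt[OF this] show ?thesis by simp
    qed
    have xB: "x n \<in> cball 0 R2" "y n \<in> cball 0 R2" for n
    proof -
      have xn: "norm (x n) \<le> R1" using xR[OF m0[of n]] by simp
      have "(2 * W / (1 - e)) * inverse (real (Suc n)) \<le> (2 * W / (1 - e)) * 1"
        by (intro mult_left_mono) (use W0 e in \<open>auto simp: field_simps\<close>)
      then have "norm (x n - y n) \<le> sqrt (2 * W / (1 - e))" using dn[of n] by (intro real_le_rsqrt) linarith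
      moreover have "norm (y n) \<le> norm (x n) + norm (x n - y n)" using norm_triangle_sub[of "y n" "x n"] by (simp add: norm_minus_commute)
      moreover have "0 \<le> sqrt (2 * W / (1 - e))" using W0 e by simp
      ultimately have "norm (x n) \<le> R2 \<and> norm (y n) \<le> R2" using xn unfolding R2_def by linarith
      then show "x n \<in> cball 0 R2" "y n \<in> cball 0 R2" by auto
    qed
    obtain c C where c: "c > 0" "\<And>x p. x \<in> cball 0 R2 \<Longrightarrow> c * (norm p)\<^sup>2 - C \<le> H x p"
      using H_coercive[OF compact_cball[of 0 R2]] by blast
    define Z where "Z = ((M - m0) / (1 - e) + B) / lam"
    have pB: "p n \<in> cball 0 (sqrt ((Z + C) / c))" for n
    proof -
      have "v (y n) \<le> (M - m0) / (1 - e)" using W(3)[OF m0[of n]] e by (simp add: field_simps)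
      then have "lam * H (y n) (p n) \<le> (M - m0) / (1 - e) + B" using super[of n] h(2)[of "y n"] by linarith
      then have "H (y n) (p n) \<le> Z" using lam by (simp add: Z_def field_simps)
      then have "c * (norm (p n))\<^sup>2 \<le> Z + C" using c(2)[OF xB(2)[of n], of "p n"] by linarith
      then have "(norm (p n))\<^sup>2 \<le> (Z + C) / c" using c(1) by (simp add: field_simps)
      then show ?thesis by (auto intro: real_le_rsqrt)
    qed
    have uc: "(\<lambda>n. dist (f (X n)) (f (Y n))) \<longlonglongrightarrow> 0"
      if "continuous_on UNIV f" "compact S" "\<And>n. X n \<in> S" "\<And>n. Y n \<in> S" "(\<lambda>n. dist (X n) (Y n)) \<longlonglongrightarrow> 0"
      for f :: "'b::metric_space \<Rightarrow> real" and S X Y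
    proof -
      have "uniformly_continuous_on S f"
        using that by (intro compact_uniformly_continuous) (auto intro: continuous_on_subset)
      then show ?thesis using that unfolding uniformly_continuous_on_sequentially by blast
    qed
    have Hl: "(\<lambda>n. dist (H (x n) (p n)) (H (y n) (p n))) \<longlonglongrightarrow> 0"
    proof -
      have "(\<lambda>n. dist ((\<lambda>(x, p). H x p) (x n, p n)) ((\<lambda>(x, p). H x p) (y n, p n))) \<longlonglongrightarrow> 0"
        by (rule uc[OF H_continuous, of "cball 0 R2 \<times> cball 0 (sqrt ((Z + C) / c))"])
           (use xB pB lim in \<open>auto intro!: compact_Times simp: dist_Pair_Pair dist_norm\<close>)
      then show ?thesis by simp
    qed
    have hl: "(\<lambda>n. dist (h (x n)) (h (y n))) \<longlonglongrightarrow> 0"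
      by (rule uc[OF h(1), of "cball 0 R2"]) (use xB lim in \<open>auto simp: dist_norm\<close>)
    \<comment> \<open>Once the differences are paired off, an excess
      \<open>e * (lam * Cl + h (x n))\<close> remains, which is bounded uniformly in
      \<open>n\<close>.\<close>
    have est: "m0 \<le> lam * (1 - e) * dist (H (x n) (p n)) (H (y n) (p n)) + (1 - e) * dist (h (x n)) (h (y n)) + e * (lam * Cl + B)" for n
    proof -
      have "0 \<le> (1 - e) * (real (Suc n) / 2) * (norm (x n - y n))\<^sup>2" "0 \<le> e * lyapunov (x n)"
        using e lyapunov_nonneg[of "x n"] by auto
      then have "m0 \<le> u (x n) - (1 - e) * v (y n)" using m0[of n] by (simp add: \<Phi>_def)
      also have "\<dots> \<le> lam * ((1 - e) * H (x n) (p n) + e * Cl) + h (x n) - (1 - e) * (lam * H (y n) (p n) + h (y n))"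
        using sub[of n] mult_left_mono[OF super[of n], of "1 - e"] e by linarith
      also have "\<dots> = lam * (1 - e) * (H (x n) (p n) - H (y n) (p n)) + (1 - e) * (h (x n) - h (y n)) + e * (lam * Cl + h (x n))"
        by (simp add: algebra_simps)
      also have "\<dots> \<le> lam * (1 - e) * dist (H (x n) (p n)) (H (y n) (p n)) + (1 - e) * dist (h (x n)) (h (y n)) + e * (lam * Cl + B)"
        using lam e h(2)[of "x n"] by (intro add_mono mult_left_mono) (auto simp: dist_real_def)
      finally show ?thesis .
    qed
    have "(\<lambda>n. lam * (1 - e) * dist (H (x n) (p n)) (H (y n) (p n)) + (1 - e) * dist (h (x n)) (h (y n)) + e * (lam * Cl + B))
       \<longlonglongrightarrow> lam * (1 - e) * 0 + (1 - e) * 0 + e * (lam * Cl + B)"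
      by (intro tendsto_intros Hl hl)
    then have "m0 \<le> lam * (1 - e) * 0 + (1 - e) * 0 + e * (lam * Cl + B)"
      by (rule LIMSEQ_le_const) (use est in auto)
    then show ?thesis by (simp add: m0_def)
  qed
  \<comment> \<open>Since \<open>x0\<close> is fixed, the penalty and the missing weight on
    \<open>v x0\<close> vanish with \<open>e\<close>; \<open>D\<close> bounds their common
    coefficient.\<close>
  define D where "D = \<bar>lam * Cl + B - v x0 + lyapunov x0\<bar> + 1"
  have D: "D > 0" "lam * Cl + B - v x0 + lyapunov x0 \<le> D" by (auto simp: D_def)
  have "u x0 \<le> v x0 + \<delta>" if \<delta>: "\<delta> > 0" for \<delta>
  proof -
    define e where "e = min (1/2) (\<delta> / D)"
    have e: "0 < e" "e < 1" "e * D \<le> \<delta>" using \<delta> D by (auto simp: e_def min_def field_simps)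
    have "u x0 - v x0 \<le> e * (lam * Cl + B - v x0 + lyapunov x0)"
      using main[OF e(1,2)] by (simp add: algebra_simps)
    also have "\<dots> \<le> e * D" using D(2) e(1) by simp
    finally show ?thesis using e(3) by simp
  qed
  then show ?thesis by (rule field_le_epsilon)
qed

end

section \<open>The Hamiltonian of the switching model\<close>

lemma norm_matrix_vector_mult_le: "norm (A *v p) \<le> norm A * norm (p :: real ^ 'n)"
  for A :: "real ^ 'n ^ 'm"
proof -
  have "norm (A *v p) = L2_set (\<lambda>i. norm ((A *v p) $ i)) UNIV" by (simp add: norm_vec_def)
  also have "\<dots> \<le> L2_set (\<lambda>i. norm p * norm (A $ i)) UNIV"
  proof (rule L2_set_mono)
    fix i :: 'm
    have "(A *v p) $ i = A $ i \<bullet> p" by (simp add: matrix_vector_mult_def inner_vec_def)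
    then show "norm ((A *v p) $ i) \<le> norm p * norm (A $ i)"
      using Cauchy_Schwarz_ineq2[of "A $ i" p] by (simp add: mult.commute)
  qed simp
  also have "\<dots> = norm p * norm A" by (simp add: norm_vec_def L2_set_right_distrib)
  finally show ?thesis by (simp add: mult.commute)
qed

lemma continuous_on_matrix_vector_mult [continuous_intros]:
  fixes A :: "'a::topological_space \<Rightarrow> real ^ 'n ^ 'm"
  assumes "continuous_on S A" "continuous_on S p"
  shows "continuous_on S (\<lambda>x. A x *v p x)"
  unfolding matrix_vector_mult_def using assms by (intro continuous_intros)

text \<open>A stationary law is a fixed point of an Euler step of the forward equation on the
  simplex, found by Brouwer. Diagonal rates occur on both sides of the balance equation and
  cancel.\<close>

lemma stationary_distribution_exists:
  fixes r :: "'j::finite \<Rightarrow> 'j \<Rightarrow> real"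
  assumes r: "\<And>i j. r i j \<ge> 0"
  obtains \<theta> :: "'j pmf" where "\<And>j. (\<Sum>i\<in>UNIV. pmf \<theta> i * r i j) = pmf \<theta> j * (\<Sum>k\<in>UNIV. r j k)"
proof -
  define S where "S = {v :: real ^ 'j. (\<forall>i. 0 \<le> v $ i) \<and> (\<Sum>i\<in>UNIV. v $ i) = 1}"
  \<comment> \<open>Small enough that \<open>c\<close> times a row sum is at most 1, so that the map
    keeps coordinates nonnegative; the \<open>1 +\<close> avoids division by zero.\<close>
  define c where "c = inverse (1 + (\<Sum>i\<in>UNIV. \<Sum>j\<in>UNIV. r i j))"
  define f where "f v = (\<chi> j. v $ j + c * ((\<Sum>i\<in>UNIV. v $ i * r i j) - v $ j * (\<Sum>k\<in>UNIV. r j k)))" for v :: "real ^ 'j"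
  have tot: "(\<Sum>i\<in>UNIV. \<Sum>j\<in>UNIV. r i j) \<ge> 0" using r by (intro sum_nonneg) auto
  have c: "c > 0" using tot by (simp add: c_def)
  have row: "c * (\<Sum>k\<in>UNIV. r j k) \<le> 1" for j
  proof -
    have "(\<Sum>k\<in>UNIV. r j k) \<le> (\<Sum>i\<in>UNIV. \<Sum>k\<in>UNIV. r i k)"
      using r by (intro member_le_sum) (auto intro: sum_nonneg)
    then show ?thesis using tot by (simp add: c_def divide_simps)
  qed
  have "closed S" unfolding S_def
    by (intro closed_Collect_conj closed_Collect_all closed_Collect_le closed_Collect_eq continuous_intros)
  moreover have "bounded S"
  proof (rule boundedI)
    fix v assume "v \<in> S"
    then have "(\<Sum>i\<in>UNIV. \<bar>v $ i\<bar>) = 1" unfolding S_def by auto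
    then show "norm v \<le> 1" using norm_le_l1_cart[of v] by simp
  qed
  ultimately have "compact S" by (simp add: compact_eq_bounded_closed)
  moreover have "convex S"
    unfolding convex_def S_def by (auto simp: sum.distrib sum_distrib_left[symmetric])
  moreover have "S \<noteq> {}"
  proof -
    have "axis undefined 1 \<in> S" unfolding S_def by (simp add: axis_def)
    then show ?thesis by blast
  qed
  moreover have "continuous_on S f" unfolding f_def by (intro continuous_intros)
  moreover have "f \<in> S \<rightarrow> S"
  proof
    fix v assume v: "v \<in> S"
    have "0 \<le> f v $ j" for j
    proof -
      have "0 \<le> v $ j * (1 - c * (\<Sum>k\<in>UNIV. r j k))" using v row[of j] by (auto simp: S_def)
      moreover have "0 \<le> c * (\<Sum>i\<in>UNIV. v $ i * r i j)"
        using c v r by (auto simp: S_def intro!: mult_nonneg_nonneg sum_nonneg)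
      ultimately show ?thesis by (simp add: f_def algebra_simps)
    qed
    moreover have "(\<Sum>j\<in>UNIV. f v $ j) = 1"
    proof -
      have "(\<Sum>j\<in>UNIV. \<Sum>i\<in>UNIV. v $ i * r i j) = (\<Sum>j\<in>UNIV. v $ j * (\<Sum>k\<in>UNIV. r j k))"
        by (subst sum.swap) (simp add: sum_distrib_left)
      then show ?thesis using v
        by (simp add: f_def S_def sum.distrib sum_subtractf flip: sum_distrib_left)
    qed
    ultimately show "f v \<in> S" by (simp add: S_def)
  qed
  ultimately obtain v where v: "v \<in> S" "f v = v" by (rule brouwer) blast
  define \<theta> where "\<theta> = embed_pmf (\<lambda>i. v $ i)"
  have "pmf \<theta> i = v $ i" for i
    unfolding \<theta>_def using v(1)
    by (intro pmf_embed_pmf) (auto simp: S_def nn_integral_count_space_finite sum_ennreal)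
  moreover have "(\<Sum>i\<in>UNIV. v $ i * r i j) = v $ j * (\<Sum>k\<in>UNIV. r j k)" for j
  proof -
    have "f v $ j = v $ j" by (simp add: v(2))
    then show ?thesis using c by (simp add: f_def)
  qed
  ultimately show thesis by (intro that[of \<theta>]) simp
qed

section \<open>The Donsker-Varadhan functional of the jump rates\<close>

context
  fixes r :: "'j::finite \<Rightarrow> 'j \<Rightarrow> 'a \<Rightarrow> real"
  assumes r_nonneg: "\<And>i j x. r i j x \<ge> 0"
begin

definition total_rate :: "'a \<Rightarrow> real" where
  "total_rate x = (\<Sum>i\<in>UNIV. \<Sum>j\<in>UNIV. r i j x)"

lemma total_rate_ge: "(\<Sum>i\<in>UNIV. \<Sum>j\<in>UNIV. r i j x * pmf \<theta> i) \<le> total_rate x"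
  unfolding total_rate_def using r_nonneg
  by (intro sum_mono) (auto intro!: mult_left_le pmf_le_1)

lemma I_fun_bdd: "bdd_above (range (\<lambda>w :: real ^ 'j. \<Sum>i\<in>UNIV. \<Sum>j\<in>UNIV. r i j x * pmf \<theta> i * (1 - exp (w $ j - w $ i))))"
proof (rule bdd_aboveI2)
  fix w :: "real ^ 'j"
  have "(\<Sum>i\<in>UNIV. \<Sum>j\<in>UNIV. r i j x * pmf \<theta> i * (1 - exp (w $ j - w $ i))) \<le> (\<Sum>i\<in>UNIV. \<Sum>j\<in>UNIV. r i j x * pmf \<theta> i)"
    using r_nonneg by (intro sum_mono mult_left_le) auto
  then show "(\<Sum>i\<in>UNIV. \<Sum>j\<in>UNIV. r i j x * pmf \<theta> i * (1 - exp (w $ j - w $ i))) \<le> total_rate x"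
    using total_rate_ge order_trans by blast
qed

lemma I_fun_upper: "(\<Sum>i\<in>UNIV. \<Sum>j\<in>UNIV. r i j x * pmf \<theta> i * (1 - exp (w $ j - w $ i))) \<le> I_fun r x \<theta>"
  unfolding I_fun_def by (rule cSUP_upper[OF UNIV_I I_fun_bdd])

lemma I_fun_nonneg: "I_fun r x \<theta> \<ge> 0"
  using I_fun_upper[of x \<theta> 0] by simp

lemma I_fun_le_total_rate: "I_fun r x \<theta> \<le> total_rate x"
  unfolding I_fun_def
proof (rule cSUP_least)
  fix w :: "real ^ 'j"
  have "(\<Sum>i\<in>UNIV. \<Sum>j\<in>UNIV. r i j x * pmf \<theta> i * (1 - exp (w $ j - w $ i))) \<le> (\<Sum>i\<in>UNIV. \<Sum>j\<in>UNIV. r i j x * pmf \<theta> i)"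
    using r_nonneg by (intro sum_mono mult_left_le) auto
  then show "(\<Sum>i\<in>UNIV. \<Sum>j\<in>UNIV. r i j x * pmf \<theta> i * (1 - exp (w $ j - w $ i))) \<le> total_rate x"
    using total_rate_ge order_trans by blast
qed simp

text \<open>By \<open>1 - exp z \<le> - z\<close> the expression under the supremum is at most the
  sum of \<open>w $ i - w $ j\<close> weighted by the jump flow under \<open>\<theta>\<close>, which
  vanishes when inflow and outflow balance.\<close>

lemma I_fun_stationary_zero:
  obtains \<theta> where "I_fun r x \<theta> = 0"
proof -
  obtain \<theta> where \<theta>: "\<And>j. (\<Sum>i\<in>UNIV. pmf \<theta> i * r i j x) = pmf \<theta> j * (\<Sum>k\<in>UNIV. r j k x)"
    using stationary_distribution_exists[of "\<lambda>i j. r i j x"] r_nonneg by blast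
  have "I_fun r x \<theta> \<le> 0" unfolding I_fun_def
  proof (rule cSUP_least)
    fix w :: "real ^ 'j"
    have "(\<Sum>i\<in>UNIV. \<Sum>j\<in>UNIV. r i j x * pmf \<theta> i * (1 - exp (w $ j - w $ i)))
       \<le> (\<Sum>i\<in>UNIV. \<Sum>j\<in>UNIV. r i j x * pmf \<theta> i * (w $ i - w $ j))"
    proof (intro sum_mono mult_left_mono)
      show "1 - exp (w $ j - w $ i) \<le> w $ i - w $ j" for i j
        using exp_ge_add_one_self[of "w $ j - w $ i"] by linarith
    qed (simp add: r_nonneg)
    also have "\<dots> = (\<Sum>i\<in>UNIV. w $ i * (pmf \<theta> i * (\<Sum>j\<in>UNIV. r i j x))) - (\<Sum>i\<in>UNIV. \<Sum>j\<in>UNIV. w $ j * (pmf \<theta> i * r i j x))"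
      by (simp add: sum_subtractf[symmetric] sum_distrib_left algebra_simps)
    also have "(\<Sum>i\<in>UNIV. \<Sum>j\<in>UNIV. w $ j * (pmf \<theta> i * r i j x)) = (\<Sum>j\<in>UNIV. w $ j * (\<Sum>i\<in>UNIV. pmf \<theta> i * r i j x))"
      by (subst sum.swap) (simp add: sum_distrib_left)
    also have "\<dots> = (\<Sum>i\<in>UNIV. w $ i * (pmf \<theta> i * (\<Sum>j\<in>UNIV. r i j x)))" by (simp add: \<theta>)
    finally show "(\<Sum>i\<in>UNIV. \<Sum>j\<in>UNIV. r i j x * pmf \<theta> i * (1 - exp (w $ j - w $ i))) \<le> 0" by simp
  qed simp
  then have "I_fun r x \<theta> = 0" using I_fun_nonneg[of x \<theta>] by simp
  then show thesis using that by blast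
qed

text \<open>The exponentials under the supremum are arbitrarily large, so absolute closeness of the
  rates would not do. With relative closeness the constant terms grow at most by the factor
  \<open>1 + \<epsilon>\<close> and the exponential terms shrink at most by
  \<open>1 - \<epsilon>\<close>, which leaves \<open>1 - \<epsilon>\<close> times the old expression
  plus an error free of \<open>w\<close>.\<close>

lemma I_fun_relative_perturbation:
  assumes \<epsilon>: "0 \<le> \<epsilon>" "\<epsilon> \<le> 1" and rel: "\<And>i j. \<bar>r i j x - r i j y\<bar> \<le> \<epsilon> * r i j y"
  shows "I_fun r x \<theta> \<le> I_fun r y \<theta> + 2 * \<epsilon> * total_rate y"
  unfolding I_fun_def[of r x]
proof (rule cSUP_least)
  fix w :: "real ^ 'j"
  have *: "r i j x * pmf \<theta> i * (1 - exp (w $ j - w $ i)) \<le>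
     (1 - \<epsilon>) * (r i j y * pmf \<theta> i * (1 - exp (w $ j - w $ i))) + 2 * \<epsilon> * (r i j y * pmf \<theta> i)" for i j
  proof -
    have "r i j x \<le> (1 + \<epsilon>) * r i j y" "(1 - \<epsilon>) * r i j y \<le> r i j x" using rel[of i j] by (auto simp: algebra_simps)
    then have "r i j x * pmf \<theta> i \<le> (1 + \<epsilon>) * r i j y * pmf \<theta> i"
      "(1 - \<epsilon>) * r i j y * pmf \<theta> i * exp (w $ j - w $ i) \<le> r i j x * pmf \<theta> i * exp (w $ j - w $ i)"
      by (auto intro!: mult_right_mono)
    then show ?thesis by (simp add: algebra_simps)
  qed
  have "(\<Sum>i\<in>UNIV. \<Sum>j\<in>UNIV. r i j x * pmf \<theta> i * (1 - exp (w $ j - w $ i))) \<le>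
    (\<Sum>i\<in>UNIV. \<Sum>j\<in>UNIV. (1 - \<epsilon>) * (r i j y * pmf \<theta> i * (1 - exp (w $ j - w $ i))) + 2 * \<epsilon> * (r i j y * pmf \<theta> i))"
    by (intro sum_mono *)
  also have "\<dots> = (1 - \<epsilon>) * (\<Sum>i\<in>UNIV. \<Sum>j\<in>UNIV. r i j y * pmf \<theta> i * (1 - exp (w $ j - w $ i)))
      + 2 * \<epsilon> * (\<Sum>i\<in>UNIV. \<Sum>j\<in>UNIV. r i j y * pmf \<theta> i)"
    by (simp only: sum.distrib sum_distrib_left)
  also have "\<dots> \<le> (1 - \<epsilon>) * I_fun r y \<theta> + 2 * \<epsilon> * total_rate y"
    using \<epsilon> by (intro add_mono mult_left_mono I_fun_upper total_rate_ge) auto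
  also have "\<dots> \<le> 1 * I_fun r y \<theta> + 2 * \<epsilon> * total_rate y"
    using mult_right_mono[of "1 - \<epsilon>" 1 "I_fun r y \<theta>"] \<epsilon>(1) I_fun_nonneg[of y \<theta>] by linarith
  finally show "(\<Sum>i\<in>UNIV. \<Sum>j\<in>UNIV. r i j x * pmf \<theta> i * (1 - exp (w $ j - w $ i))) \<le> I_fun r y \<theta> + 2 * \<epsilon> * total_rate y"
    by simp
qed simp

end

section \<open>The switching model as an instance of a coercive Hamiltonian\<close>

locale switching_model =
  fixes a :: "real ^ 'd \<Rightarrow> 'j::finite \<Rightarrow> real ^ 'd ^ 'd"
    and b :: "real ^ 'd \<Rightarrow> 'j \<Rightarrow> real ^ 'd"
    and r :: "'j \<Rightarrow> 'j \<Rightarrow> real ^ 'd \<Rightarrow> real"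
  assumes r_nonneg: "\<And>i j x. r i j x \<ge> 0"
    and r_cont: "\<And>i j. continuous_on UNIV (r i j)"
    and r_pos: "\<And>i j. (\<forall>x. r i j x = 0) \<or>
                  (\<forall>K. compact K \<longrightarrow> (INF x\<in>K. ereal (r i j x)) > 0)"
    and a_cont: "\<And>i. continuous_on UNIV (\<lambda>x. a x i)"
    and b_cont: "\<And>i. continuous_on UNIV (\<lambda>x. b x i)"
    and a_lower: "\<And>K. compact K \<Longrightarrow>
          (INF (x, i, p)\<in>K \<times> UNIV \<times> sphere 0 1. ereal ((a x i *v p) \<bullet> p)) > 0"
    and a_Lipschitz: "\<exists>L>0. \<forall>x y i. norm (a x i - a y i) \<le> L * norm (x - y)"
    and b_one_sided: "one_sided_Lipschitz b"
begin

abbreviation "drift x p i \<equiv> (a x i *v p) \<bullet> p + b x i \<bullet> p"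

lemmas I_nonneg = I_fun_nonneg[of r, OF r_nonneg]
lemmas I_le_total_rate = I_fun_le_total_rate[of r, OF r_nonneg]

lemma pmf_mult_le_abs: "v * pmf \<theta> i \<le> \<bar>v\<bar>"
proof -
  have "v * pmf \<theta> i \<le> \<bar>v\<bar> * pmf \<theta> i" by (intro mult_right_mono) auto
  also have "\<dots> \<le> \<bar>v\<bar>" by (intro mult_left_le pmf_le_1) auto
  finally show ?thesis .
qed

lemma Lambda_fun_le: "Lambda_fun a b x p \<theta> \<le> (\<Sum>i\<in>UNIV. \<bar>drift x p i\<bar>)"
  unfolding Lambda_fun_def
  by (intro sum_mono pmf_mult_le_abs)

lemma Lambda_fun_diff_le:
  "Lambda_fun a b x p \<theta> - Lambda_fun a b y q \<theta> \<le> (\<Sum>i\<in>UNIV. \<bar>drift x p i - drift y q i\<bar>)"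
proof -
  have "Lambda_fun a b x p \<theta> - Lambda_fun a b y q \<theta> = (\<Sum>i\<in>UNIV. (drift x p i - drift y q i) * pmf \<theta> i)"
    by (simp add: Lambda_fun_def sum_subtractf left_diff_distrib)
  also have "\<dots> \<le> (\<Sum>i\<in>UNIV. \<bar>drift x p i - drift y q i\<bar>)"
    by (intro sum_mono pmf_mult_le_abs)
  finally show ?thesis .
qed

lemma Hamiltonian_bdd: "bdd_above (range (\<lambda>\<theta>. Lambda_fun a b x p \<theta> - I_fun r x \<theta>))"
proof (rule bdd_aboveI2)
  fix \<theta>
  show "Lambda_fun a b x p \<theta> - I_fun r x \<theta> \<le> (\<Sum>i\<in>UNIV. \<bar>drift x p i\<bar>)"
    using Lambda_fun_le[of x p \<theta>] I_nonneg[of x \<theta>] by linarith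
qed

lemma Hamiltonian_upper: "Lambda_fun a b x p \<theta> - I_fun r x \<theta> \<le> Hamiltonian a b r x p"
  unfolding Hamiltonian_def by (rule cSUP_upper[OF UNIV_I Hamiltonian_bdd])

lemma Hamiltonian_least: "(\<And>\<theta>. Lambda_fun a b x p \<theta> - I_fun r x \<theta> \<le> C) \<Longrightarrow> Hamiltonian a b r x p \<le> C"
  unfolding Hamiltonian_def by (rule cSUP_least) auto

text \<open>Singletons are compact, so the hypothesis on the rates becomes a pointwise dichotomy; in
  both cases continuity gives closeness in ratio at nearby points.\<close>

lemma rate_pos: "(\<forall>x. r i j x = 0) \<or> (\<forall>x. r i j x > 0)"
proof -
  have "r i j x > 0" if "\<forall>K. compact K \<longrightarrow> (INF x\<in>K. ereal (r i j x)) > 0" for x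
    using that[rule_format, of "{x}"] by simp
  then show ?thesis using r_pos by blast
qed

lemma total_rate_continuous: "continuous_on UNIV (total_rate r)"
  unfolding total_rate_def[of r, OF r_nonneg] by (intro continuous_intros r_cont)

lemma Hamiltonian_perturbation:
  assumes \<epsilon>: "0 \<le> \<epsilon>" "\<epsilon> \<le> 1" and rel: "\<And>i j. \<bar>r i j y - r i j x\<bar> \<le> \<epsilon> * r i j x"
  shows "Hamiltonian a b r x p \<le> Hamiltonian a b r y q + (\<Sum>i\<in>UNIV. \<bar>drift x p i - drift y q i\<bar>) + 2 * \<epsilon> * total_rate r x"
proof (rule Hamiltonian_least)
  fix \<theta>
  show "Lambda_fun a b x p \<theta> - I_fun r x \<theta> \<le> Hamiltonian a b r y q + (\<Sum>i\<in>UNIV. \<bar>drift x p i - drift y q i\<bar>) + 2 * \<epsilon> * total_rate r x"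
    using I_fun_relative_perturbation[of r, OF r_nonneg \<epsilon> rel, of \<theta>] Hamiltonian_upper[of y q \<theta>]
      Lambda_fun_diff_le[of x p \<theta> y q] by linarith
qed

lemma drift_continuous: "continuous_on UNIV (\<lambda>z. drift (fst z) (snd z) i)"
  by (intro continuous_intros continuous_on_compose2[OF a_cont] continuous_on_compose2[OF b_cont]) auto

lemma Hamiltonian_continuous: "continuous_on UNIV (\<lambda>(x, p). Hamiltonian a b r x p)"
proof (rule continuous_at_imp_continuous_on, rule ballI)
  fix z0 :: "(real ^ 'd) \<times> (real ^ 'd)"
  obtain x0 p0 where z0: "z0 = (x0, p0)" by (cases z0) blast
  show "isCont (\<lambda>(x, p). Hamiltonian a b r x p) z0"
    unfolding isCont_def
  proof (rule tendstoI)
    fix e :: real assume e: "e > 0"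
    define T where "T = total_rate r x0 + 1"
    have T: "T \<ge> 1" using sum_nonneg[of UNIV "\<lambda>i. \<Sum>j\<in>UNIV. r i j x0"] r_nonneg
      by (auto simp: T_def total_rate_def[of r, OF r_nonneg] sum_nonneg)
    \<comment> \<open>\<open>T\<close> bounds the total rate near \<open>x0\<close>, so the rate
      error \<open>2 * \<epsilon> * T\<close> takes one half of \<open>e\<close>; the drift takes
      the other.\<close>
    define \<epsilon> where "\<epsilon> = min 1 (e / (4 * T))"
    have \<epsilon>: "0 < \<epsilon>" "\<epsilon> \<le> 1" "2 * \<epsilon> * T \<le> e / 2" using e T by (auto simp: \<epsilon>_def min_def field_simps)
    \<comment> \<open>Half of \<open>\<epsilon>\<close> relative to \<open>x0\<close> gives
      \<open>\<epsilon>\<close> relative to both points: it implies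
      \<open>r i j x0 \<le> 2 * r i j x\<close>, which moves the reference point to
      \<open>x\<close>.\<close>
    have *: "\<forall>\<^sub>F z in at z0. \<bar>r i j (fst z) - r i j x0\<bar> \<le> (\<epsilon> / 2) * r i j x0" for i j
      using rate_pos[of i j]
    proof
      assume pos: "\<forall>x. r i j x > 0"
      have "continuous_on UNIV (\<lambda>z :: (real ^ 'd) \<times> (real ^ 'd). r i j (fst z))"
        by (intro continuous_on_compose2[OF r_cont] continuous_intros) auto
      then have "((\<lambda>z. r i j (fst z)) \<longlongrightarrow> r i j (fst z0)) (at z0)"
        by (simp only: continuous_on_eq_continuous_at[OF open_UNIV] isCont_def) blast
      then have "\<forall>\<^sub>F z in at z0. dist (r i j (fst z)) (r i j (fst z0)) < (\<epsilon> / 2) * r i j x0"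
        using \<epsilon> pos by (intro tendstoD) auto
      then show ?thesis by eventually_elim (simp add: z0 dist_real_def)
    qed simp
    have ev1: "\<forall>\<^sub>F z in at z0. \<forall>i j. \<bar>r i j (fst z) - r i j x0\<bar> \<le> (\<epsilon> / 2) * r i j x0"
      by (intro eventually_all_finite *)
    have ev2: "\<forall>\<^sub>F z in at z0. dist (total_rate r (fst z)) (total_rate r x0) < 1"
    proof -
      have "continuous_on UNIV (\<lambda>z :: (real ^ 'd) \<times> (real ^ 'd). total_rate r (fst z))"
        by (intro continuous_on_compose2[OF total_rate_continuous] continuous_intros) auto
      then have "((\<lambda>z. total_rate r (fst z)) \<longlongrightarrow> total_rate r (fst z0)) (at z0)"
        by (simp only: continuous_on_eq_continuous_at[OF open_UNIV] isCont_def) blast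
      from tendstoD[OF this, of 1] show ?thesis by (simp add: z0)
    qed
    have ev3: "\<forall>\<^sub>F z in at z0. (\<Sum>i\<in>UNIV. \<bar>drift (fst z) (snd z) i - drift x0 p0 i\<bar>) < e / 2"
    proof -
      have "((\<lambda>z. \<Sum>i\<in>UNIV. \<bar>drift (fst z) (snd z) i - drift x0 p0 i\<bar>) \<longlongrightarrow> (\<Sum>i\<in>UNIV. \<bar>drift (fst z0) (snd z0) i - drift x0 p0 i\<bar>)) (at z0)"
      proof (intro tendsto_sum tendsto_rabs tendsto_diff[OF _ tendsto_const])
        show "((\<lambda>z. drift (fst z) (snd z) i) \<longlongrightarrow> drift (fst z0) (snd z0) i) (at z0)" for i
          using drift_continuous[of i] by (simp only: continuous_on_eq_continuous_at[OF open_UNIV] isCont_def) blast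
      qed
      then have "((\<lambda>z. \<Sum>i\<in>UNIV. \<bar>drift (fst z) (snd z) i - drift x0 p0 i\<bar>) \<longlongrightarrow> 0) (at z0)" by (simp add: z0)
      then show ?thesis using e by (intro order_tendstoD) auto
    qed
    from ev1 ev2 ev3
    show "\<forall>\<^sub>F z in at z0. dist (case z of (x, p) \<Rightarrow> Hamiltonian a b r x p) (case z0 of (x, p) \<Rightarrow> Hamiltonian a b r x p) < e"
    proof eventually_elim
      case (elim z)
      obtain x p where z: "z = (x, p)" by (cases z) blast
      have r1: "\<bar>r i j x - r i j x0\<bar> \<le> \<epsilon> * r i j x0" for i j
      proof -
        have "\<bar>r i j x - r i j x0\<bar> \<le> (\<epsilon> / 2) * r i j x0" using elim(1) z by simp
        also have "\<dots> \<le> \<epsilon> * r i j x0" using \<epsilon>(1) r_nonneg[of i j x0] by (intro mult_right_mono) auto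
        finally show ?thesis .
      qed
      have r2: "\<bar>r i j x0 - r i j x\<bar> \<le> \<epsilon> * r i j x" for i j
      proof -
        have 1: "\<bar>r i j x - r i j x0\<bar> \<le> (\<epsilon> / 2) * r i j x0" using elim(1) z by simp
        also have "\<dots> \<le> (1 / 2) * r i j x0" using \<epsilon> r_nonneg[of i j x0] by (intro mult_right_mono) auto
        finally have "r i j x0 \<le> 2 * r i j x" by linarith
        then have "(\<epsilon> / 2) * r i j x0 \<le> (\<epsilon> / 2) * (2 * r i j x)" using \<epsilon> by (intro mult_left_mono) auto
        then show ?thesis using 1 by (simp add: abs_minus_commute)
      qed
      have A: "Hamiltonian a b r x0 p0 \<le> Hamiltonian a b r x p + (\<Sum>i\<in>UNIV. \<bar>drift x0 p0 i - drift x p i\<bar>) + 2 * \<epsilon> * total_rate r x0"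
        using \<epsilon> r1 by (intro Hamiltonian_perturbation) auto
      have B: "Hamiltonian a b r x p \<le> Hamiltonian a b r x0 p0 + (\<Sum>i\<in>UNIV. \<bar>drift x p i - drift x0 p0 i\<bar>) + 2 * \<epsilon> * total_rate r x"
        using \<epsilon> r2 by (intro Hamiltonian_perturbation) auto
      have "(\<Sum>i\<in>UNIV. \<bar>drift x p i - drift x0 p0 i\<bar>) < e / 2" using elim(3) z by simp
      moreover have "(\<Sum>i\<in>UNIV. \<bar>drift x0 p0 i - drift x p i\<bar>) = (\<Sum>i\<in>UNIV. \<bar>drift x p i - drift x0 p0 i\<bar>)"
        by (simp add: abs_minus_commute)
      moreover have "total_rate r x \<le> T" "total_rate r x0 \<le> T" using elim(2) z by (auto simp: T_def dist_real_def)
      then have "2 * \<epsilon> * total_rate r x \<le> 2 * \<epsilon> * T" "2 * \<epsilon> * total_rate r x0 \<le> 2 * \<epsilon> * T"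
        using \<epsilon> by (auto intro!: mult_left_mono)
      ultimately have "\<bar>Hamiltonian a b r x p - Hamiltonian a b r x0 p0\<bar> < e" using A B \<epsilon>(3) by linarith
      then show ?case by (simp add: z z0 dist_real_def)
    qed
  qed
qed

lemma Hamiltonian_zero: "Hamiltonian a b r x 0 = 0"
proof (rule antisym)
  show "Hamiltonian a b r x 0 \<le> 0"
    by (rule Hamiltonian_least) (simp add: Lambda_fun_def I_nonneg)
  obtain \<theta> where "I_fun r x \<theta> = 0" using I_fun_stationary_zero[of r, OF r_nonneg] by blast
  then show "0 \<le> Hamiltonian a b r x 0" using Hamiltonian_upper[of x 0 \<theta>] by (simp add: Lambda_fun_def)
qed

lemma a_elliptic:
  assumes "compact K" obtains c where "c > 0" "\<And>x i p. x \<in> K \<Longrightarrow> c * (norm p)\<^sup>2 \<le> (a x i *v p) \<bullet> p"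
proof -
  \<comment> \<open>A number strictly between 0 and the infimum is finite even if the infimum is
    not, as for empty \<open>K\<close>.\<close>
  obtain c' where c': "0 < c'" "c' < (INF (x, i, p)\<in>K \<times> UNIV \<times> sphere 0 1. ereal ((a x i *v p) \<bullet> p))"
    using dense[OF a_lower[OF assms]] by blast
  obtain c where c: "c > 0" "ereal c \<le> (INF (x, i, p)\<in>K \<times> UNIV \<times> sphere 0 1. ereal ((a x i *v p) \<bullet> p))"
  proof (cases c')
    case (real c) then show thesis using that[of c] c' by auto
  next
    case PInf then show thesis using that[of 1] c' by auto
  qed (use c' in auto)
  have "c * (norm p)\<^sup>2 \<le> (a x i *v p) \<bullet> p" if "x \<in> K" for x i p
  proof (cases "p = 0")
    case False
    let ?q = "p /\<^sub>R norm p"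
    have "?q \<in> sphere 0 1" using False by simp
    then have "ereal c \<le> ereal ((a x i *v ?q) \<bullet> ?q)"
      using that by (intro order_trans[OF c(2)] INF_lower2[of "(x, i, ?q)"]) auto
    then have "c \<le> (a x i *v ?q) \<bullet> ?q" by simp
    also have "\<dots> = ((a x i *v p) \<bullet> p) / (norm p)\<^sup>2"
      by (simp add: matrix_vector_mult_scaleR power2_eq_square divide_simps)
    finally show ?thesis using False by (simp add: field_simps)
  qed simp
  then show thesis using that c(1) by blast
qed

lemma Hamiltonian_coercive:
  assumes "compact K" shows "\<exists>c>0. \<exists>C. \<forall>x\<in>K. \<forall>p. c * (norm p)\<^sup>2 - C \<le> Hamiltonian a b r x p"
proof -
  obtain c where c: "c > 0" "\<And>x i p. x \<in> K \<Longrightarrow> c * (norm p)\<^sup>2 \<le> (a x i *v p) \<bullet> p"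
    using a_elliptic[OF assms] by blast
  have "compact ((\<lambda>x. b x undefined) ` K)" "compact (total_rate r ` K)"
    using b_cont total_rate_continuous assms by (auto intro!: compact_continuous_image intro: continuous_on_subset)
  then have "bounded ((\<lambda>x. b x undefined) ` K)" "bounded (total_rate r ` K)" by (auto intro: compact_imp_bounded)
  then obtain B T where "\<forall>y\<in>(\<lambda>x. b x undefined) ` K. norm y \<le> B" "\<forall>y\<in>total_rate r ` K. norm y \<le> T"
    unfolding bounded_iff by blast
  then have B: "\<And>x. x \<in> K \<Longrightarrow> norm (b x undefined) \<le> B" and T: "\<And>x. x \<in> K \<Longrightarrow> norm (total_rate r x) \<le> T"
    by auto
  have "(c / 2) * (norm p)\<^sup>2 - (B\<^sup>2 / (2 * c) + T) \<le> Hamiltonian a b r x p" if x: "x \<in> K" for x p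
  proof -
    \<comment> \<open>One state is enough for a lower bound: a Dirac measure there retains the
      quadratic growth and has \<open>I_fun\<close> at most the total rate.\<close>
    let ?\<theta> = "return_pmf undefined :: 'j pmf"
    have "Lambda_fun a b x p ?\<theta> = (\<Sum>i\<in>{undefined}. drift x p i * pmf ?\<theta> i)"
      unfolding Lambda_fun_def by (rule sum.mono_neutral_right) (auto simp: indicator_def)
    then have "Lambda_fun a b x p ?\<theta> = drift x p undefined" by simp
    moreover have "\<bar>b x undefined \<bullet> p\<bar> \<le> B * norm p"
      using Cauchy_Schwarz_ineq2[of "b x undefined" p] B[OF x] by (meson mult_right_mono norm_ge_zero order_trans)
    moreover have "B * norm p \<le> (c / 2) * (norm p)\<^sup>2 + B\<^sup>2 / (2 * c)"
    proof -
      have "0 \<le> (c * norm p - B)\<^sup>2 / (2 * c)" using c(1) by simp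
      also have "\<dots> = (c / 2) * (norm p)\<^sup>2 + B\<^sup>2 / (2 * c) - B * norm p"
        using c(1) by (simp add: power2_eq_square field_simps)
      finally show ?thesis by simp
    qed
    moreover have "I_fun r x ?\<theta> \<le> T" using I_le_total_rate[of x ?\<theta>] T[OF x] by auto
    ultimately show ?thesis using c(2)[OF x, of p undefined] Hamiltonian_upper[of x p ?\<theta>]
      by (simp add: field_simps)
  qed
  then show ?thesis using c(1) by (metis half_gt_zero)
qed

text \<open>A measure that is optimal up to \<open>e\<close> supplies the affine minorant: each
  drift is a convex quadratic in the momentum, so its average lies above its tangent. Slopes are
  averages of gradients bounded on \<open>K \<times> K\<close>, hence the uniform
  \<open>Q\<close>.\<close>

lemma Hamiltonian_subgradient:
  assumes "compact K"
  shows "\<exists>Q. \<forall>x\<in>K. \<forall>p\<in>K. \<forall>e>0. \<exists>q. norm q \<le> Q \<and>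
     (\<forall>p'. Hamiltonian a b r x p + q \<bullet> (p' - p) - e \<le> Hamiltonian a b r x p')"
proof -
  \<comment> \<open>\<open>a\<close> need not be symmetric, so the gradient of its quadratic form
    contains the transpose.\<close>
  define g where "g x p i = a x i *v p + transpose (a x i) *v p + b x i" for x p i
  have gcont: "continuous_on UNIV (\<lambda>z. g (fst z) (snd z) i)" for i
  proof -
    have "continuous_on UNIV (\<lambda>z :: (real ^ 'd) \<times> (real ^ 'd). transpose (a (fst z) i))"
      unfolding transpose_def by (intro continuous_intros continuous_on_compose2[OF a_cont]) auto
    then show ?thesis unfolding g_def
      by (intro continuous_intros continuous_on_compose2[OF a_cont] continuous_on_compose2[OF b_cont]) auto
  qed
  have "\<exists>Q. \<forall>x\<in>K. \<forall>p\<in>K. norm (g x p i) \<le> Q" for i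
  proof -
    have "compact ((\<lambda>z. g (fst z) (snd z) i) ` (K \<times> K))"
      using gcont assms by (intro compact_continuous_image compact_Times) (auto intro: continuous_on_subset)
    then obtain Q where "\<forall>y\<in>(\<lambda>z. g (fst z) (snd z) i) ` (K \<times> K). norm y \<le> Q"
      using compact_imp_bounded bounded_iff by blast
    then have "\<forall>x\<in>K. \<forall>p\<in>K. norm (g x p i) \<le> Q" by force
    then show ?thesis by blast
  qed
  then obtain Q where Q: "\<And>i x p. x \<in> K \<Longrightarrow> p \<in> K \<Longrightarrow> norm (g x p i) \<le> Q i" by metis
  have "\<exists>q. norm q \<le> (\<Sum>i\<in>UNIV. Q i) \<and> (\<forall>p'. Hamiltonian a b r x p + q \<bullet> (p' - p) - e \<le> Hamiltonian a b r x p')"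
    if x: "x \<in> K" and p: "p \<in> K" and e: "e > 0" for x p e
  proof -
    have "Hamiltonian a b r x p - e < Hamiltonian a b r x p" using e by simp
    then obtain \<theta> where \<theta>: "Hamiltonian a b r x p - e < Lambda_fun a b x p \<theta> - I_fun r x \<theta>"
      unfolding Hamiltonian_def less_cSUP_iff[OF UNIV_not_empty Hamiltonian_bdd] by blast
    define q where "q = (\<Sum>i\<in>UNIV. pmf \<theta> i *\<^sub>R g x p i)"
    have "norm q \<le> (\<Sum>i\<in>UNIV. norm (pmf \<theta> i *\<^sub>R g x p i))" unfolding q_def by (rule norm_sum)
    also have "\<dots> \<le> (\<Sum>i\<in>UNIV. Q i)"
    proof (rule sum_mono)
      fix i
      have "norm (pmf \<theta> i *\<^sub>R g x p i) \<le> 1 * norm (g x p i)"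
        unfolding norm_scaleR by (intro mult_right_mono) (auto simp: pmf_le_1)
      then show "norm (pmf \<theta> i *\<^sub>R g x p i) \<le> Q i" using Q[OF x p, of i] by simp
    qed
    finally have "norm q \<le> (\<Sum>i\<in>UNIV. Q i)" .
    moreover have "Hamiltonian a b r x p + q \<bullet> (p' - p) - e \<le> Hamiltonian a b r x p'" for p'
    proof -
      have "drift x p i + g x p i \<bullet> (p' - p) \<le> drift x p' i" for i
      proof -
        obtain c where c: "c > 0" "\<And>x i p. x \<in> K \<Longrightarrow> c * (norm p)\<^sup>2 \<le> (a x i *v p) \<bullet> p"
          using a_elliptic[OF assms] by blast
        have "0 \<le> c * (norm (p' - p))\<^sup>2" using c(1) by simp
        also have "\<dots> \<le> (a x i *v (p' - p)) \<bullet> (p' - p)" by (rule c(2)[OF x])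
        also have "\<dots> = (a x i *v p') \<bullet> p' - (a x i *v p') \<bullet> p - (a x i *v p) \<bullet> p' + (a x i *v p) \<bullet> p"
          by (simp add: matrix_vector_mult_diff_distrib inner_diff_left inner_diff_right)
        finally have "0 \<le> \<dots>" .
        moreover have "(transpose (a x i) *v p) \<bullet> w = (a x i *v w) \<bullet> p" for w
          by (metis dot_lmul_matrix inner_commute transpose_matrix_vector)
        ultimately show ?thesis by (simp add: g_def inner_add_left inner_diff_right)
      qed
      then have "(\<Sum>i\<in>UNIV. (drift x p i + g x p i \<bullet> (p' - p)) * pmf \<theta> i) \<le> Lambda_fun a b x p' \<theta>"
        unfolding Lambda_fun_def by (intro sum_mono mult_right_mono) auto
      moreover have "(\<Sum>i\<in>UNIV. (drift x p i + g x p i \<bullet> (p' - p)) * pmf \<theta> i) = Lambda_fun a b x p \<theta> + q \<bullet> (p' - p)"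
        unfolding Lambda_fun_def q_def inner_sum_left
        by (simp add: sum.distrib[symmetric] algebra_simps)
      ultimately show ?thesis using \<theta> Hamiltonian_upper[of x p' \<theta>] by linarith
    qed
    ultimately show ?thesis by blast
  qed
  then show ?thesis by blast
qed

text \<open>Lipschitz continuity makes \<open>a\<close> grow at most linearly, and the one-sided
  condition with \<open>y = 0\<close> bounds \<open>b x i \<bullet> x\<close> by a multiple of
  \<open>1 + |x|^2\<close>. Division by the powers of \<open>1 + |x|^2\<close> leaves constants,
  uniformly in the state.\<close>

lemma Hamiltonian_lyapunov: "\<exists>C. \<forall>x. Hamiltonian a b r x (x /\<^sub>R (1 + (norm x)\<^sup>2)) \<le> C"
proof -
  obtain L where L: "L > 0" "\<And>x y i. norm (a x i - a y i) \<le> L * norm (x - y)" using a_Lipschitz by blast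
  obtain M where M: "\<And>x y i. (b x i - b y i) \<bullet> (x - y) \<le> M * (norm (x - y))\<^sup>2"
    using b_one_sided unfolding one_sided_Lipschitz_def by blast
  define A0 where "A0 = (\<Sum>i\<in>UNIV. norm (a 0 i))"
  define B0 where "B0 = (\<Sum>i\<in>UNIV. norm (b 0 i))"
  have A0: "norm (a 0 i) \<le> A0" for i unfolding A0_def by (intro member_le_sum) auto
  have B0: "norm (b 0 i) \<le> B0" for i unfolding B0_def by (intro member_le_sum) auto
  have A0n: "A0 \<ge> 0" and B0n: "B0 \<ge> 0" by (auto simp: A0_def B0_def intro: sum_nonneg)
  define C where "C = A0 + L + \<bar>M\<bar> + B0"
  have C0: "C \<ge> 0" using A0n B0n L(1) by (simp add: C_def)
  have V: "drift x (x /\<^sub>R (1 + (norm x)\<^sup>2)) i \<le> C" for x i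
  proof -
    define n where "n = norm x"
    define s where "s = 1 + n\<^sup>2"
    have n: "n \<ge> 0" and s: "s \<ge> 1" "s > 0" "n \<le> s" "n\<^sup>2 \<le> s"
      using sum_squares_bound[of n 1] zero_le_power2[of n] by (auto simp: n_def s_def add_pos_nonneg) (smt (verit) mult_cancel_left2 power2_eq_square mult_left_mono zero_le_power2)
    have "norm (a x i) \<le> A0 + L * n" using A0[of i] L(2)[of x i 0] norm_triangle_sub[of "a x i" "a 0 i"] by (simp add: n_def)
    moreover have "(a x i *v x) \<bullet> x \<le> norm (a x i) * n\<^sup>2"
    proof -
      have "(a x i *v x) \<bullet> x \<le> norm (a x i *v x) * norm x" by (rule norm_cauchy_schwarz)
      also have "\<dots> \<le> (norm (a x i) * norm x) * norm x" by (intro mult_right_mono norm_matrix_vector_mult_le) auto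
      finally show ?thesis by (simp add: n_def power2_eq_square mult.assoc)
    qed
    ultimately have "(a x i *v x) \<bullet> x \<le> (A0 + L * n) * n\<^sup>2" by (meson mult_right_mono order_trans zero_le_power2)
    also have "\<dots> \<le> (A0 * s + L * s) * s"
    proof (intro mult_mono add_mono mult_left_mono)
      show "A0 \<le> A0 * s" using A0n s(1) by (simp add: mult_le_cancel_left1)
    qed (use A0n L(1) s n in auto)
    finally have 1: "(a x i *v x) \<bullet> x \<le> (A0 + L) * s\<^sup>2" by (simp add: power2_eq_square algebra_simps)
    have "b x i \<bullet> x = (b x i - b 0 i) \<bullet> (x - 0) + b 0 i \<bullet> x" by (simp add: inner_diff_left)
    also have "\<dots> \<le> M * n\<^sup>2 + B0 * n"
      using M[of x i 0] norm_cauchy_schwarz[of "b 0 i" x] mult_right_mono[OF B0[of i] n] by (simp add: n_def)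
    also have "\<dots> \<le> \<bar>M\<bar> * s + B0 * s"
      using s n B0n by (intro add_mono mult_mono) auto
    finally have 2: "b x i \<bullet> x \<le> (\<bar>M\<bar> + B0) * s" by (simp add: algebra_simps)
    have "drift x (x /\<^sub>R s) i = ((a x i *v x) \<bullet> x) / s\<^sup>2 + (b x i \<bullet> x) / s"
      using s by (simp add: matrix_vector_mult_scaleR power2_eq_square divide_simps)
    also have "\<dots> \<le> (A0 + L) + (\<bar>M\<bar> + B0)"
      using 1 2 s(2) by (intro add_mono) (auto simp: divide_le_eq)
    finally show ?thesis by (simp add: C_def s_def n_def)
  qed
  have "Hamiltonian a b r x (x /\<^sub>R (1 + (norm x)\<^sup>2)) \<le> C" for x
  proof (rule Hamiltonian_least)
    fix \<theta> :: "'j pmf"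
    have "Lambda_fun a b x (x /\<^sub>R (1 + (norm x)\<^sup>2)) \<theta> \<le> (\<Sum>i\<in>UNIV. C * pmf \<theta> i)"
      unfolding Lambda_fun_def by (intro sum_mono mult_right_mono V) auto
    also have "\<dots> = C" by (simp add: sum_distrib_left[symmetric] sum_pmf_eq_1)
    finally show "Lambda_fun a b x (x /\<^sub>R (1 + (norm x)\<^sup>2)) \<theta> - I_fun r x \<theta> \<le> C"
      using I_nonneg[of x \<theta>] by linarith
  qed
  then show ?thesis by blast
qed

sublocale coercive_hamiltonian "Hamiltonian a b r"
  by unfold_locales
    (use Hamiltonian_continuous Hamiltonian_zero Hamiltonian_coercive Hamiltonian_subgradient Hamiltonian_lyapunov in auto)

end

section \<open>Operations on absolutely continuous paths\<close>

text \<open>Intervals without interior satisfy the disjointness condition wherever they lie, hence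
  the first two alternatives.\<close>

lemma disjoint_greaterThanLessThanD:
  fixes a b c d :: real
  assumes "{a<..<b} \<inter> {c<..<d} = {}" "a \<le> b" "c \<le> d"
  shows "a = b \<or> c = d \<or> b \<le> c \<or> d \<le> a"
proof (rule ccontr)
  assume "\<not> ?thesis"
  then have "max a c < min b d" using assms by auto
  then obtain z where "max a c < z" "z < min b d" using dense[of "max a c" "min b d"] by blast
  then have "z \<in> {a<..<b} \<inter> {c<..<d}" by auto
  then show False using assms by blast
qed

text \<open>A nondecreasing time change that does not expand lengths maps admissible families of
  intervals to admissible ones of no larger total length.\<close>

lemma abs_continuous_on_transform:
  assumes \<gamma>: "abs_continuous_on {0..T1} \<gamma>" and e: "e > 0"
    and \<phi>: "\<forall>s t. 0 \<le> s \<longrightarrow> s \<le> t \<longrightarrow> t \<le> T \<longrightarrow> \<phi> s \<le> \<phi> t \<and> \<phi> t - \<phi> s \<le> t - s \<and> 0 \<le> \<phi> s \<and> \<phi> t \<le> T1"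
  shows "\<exists>d>0. \<forall>(n::nat) \<alpha> \<beta>. (\<forall>k<n. \<alpha> k \<le> \<beta> k \<and> {\<alpha> k..\<beta> k} \<subseteq> {0..T}) \<and>
        (\<forall>k<n. \<forall>l<n. k \<noteq> l \<longrightarrow> {\<alpha> k<..<\<beta> k} \<inter> {\<alpha> l<..<\<beta> l} = {}) \<and>
        (\<Sum>k<n. \<beta> k - \<alpha> k) < d \<longrightarrow>
        (\<Sum>k<n. dist (\<gamma> (\<phi> (\<alpha> k))) (\<gamma> (\<phi> (\<beta> k)))) < e"
proof -
  from \<gamma>[unfolded abs_continuous_on_def, rule_format, OF e]
  obtain d where d: "d > 0" "\<forall>(n::nat) \<alpha> \<beta>. (\<forall>k<n. \<alpha> k \<le> \<beta> k \<and> {\<alpha> k..\<beta> k} \<subseteq> {0..T1}) \<and>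
        (\<forall>k<n. \<forall>l<n. k \<noteq> l \<longrightarrow> {\<alpha> k<..<\<beta> k} \<inter> {\<alpha> l<..<\<beta> l} = {}) \<and>
        (\<Sum>k<n. \<beta> k - \<alpha> k) < d \<longrightarrow> (\<Sum>k<n. dist (\<gamma> (\<alpha> k)) (\<gamma> (\<beta> k))) < e"
    by (elim exE conjE)
  have "(\<Sum>k<n. dist (\<gamma> (\<phi> (\<alpha> k))) (\<gamma> (\<phi> (\<beta> k)))) < e"
    if A: "\<forall>k<n. \<alpha> k \<le> \<beta> k \<and> {\<alpha> k..\<beta> k} \<subseteq> {0..T}"
      and disj: "\<forall>k<n. \<forall>l<n. k \<noteq> l \<longrightarrow> {\<alpha> k<..<\<beta> k} \<inter> {\<alpha> l<..<\<beta> l} = {}"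
      and sm: "(\<Sum>k<n. \<beta> k - \<alpha> k) < d" for n :: nat and \<alpha> \<beta>
  proof -
    have bd: "0 \<le> \<alpha> k" "\<alpha> k \<le> \<beta> k" "\<beta> k \<le> T" if "k < n" for k using A that by auto
    have disj': "{\<phi> (\<alpha> k)<..<\<phi> (\<beta> k)} \<inter> {\<phi> (\<alpha> l)<..<\<phi> (\<beta> l)} = {}" if kl: "k < n" "l < n" "k \<noteq> l" for k l
    proof -
      have "{\<alpha> k<..<\<beta> k} \<inter> {\<alpha> l<..<\<beta> l} = {}" using disj kl by blast
      from disjoint_greaterThanLessThanD[OF this bd(2)[OF kl(1)] bd(2)[OF kl(2)]]
      have "\<phi> (\<alpha> k) = \<phi> (\<beta> k) \<or> \<phi> (\<alpha> l) = \<phi> (\<beta> l) \<or> \<phi> (\<beta> k) \<le> \<phi> (\<alpha> l) \<or> \<phi> (\<beta> l) \<le> \<phi> (\<alpha> k)"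
        using \<phi>[rule_format, of "\<beta> k" "\<alpha> l"] \<phi>[rule_format, of "\<beta> l" "\<alpha> k"] bd[OF kl(1)] bd[OF kl(2)] by fastforce
      then show ?thesis by auto
    qed
    have "(\<Sum>k<n. \<phi> (\<beta> k) - \<phi> (\<alpha> k)) \<le> (\<Sum>k<n. \<beta> k - \<alpha> k)"
      by (intro sum_mono) (use \<phi> bd in auto)
    then have "(\<Sum>k<n. \<phi> (\<beta> k) - \<phi> (\<alpha> k)) < d" using sm by linarith
    moreover have "\<phi> (\<alpha> k) \<le> \<phi> (\<beta> k) \<and> {\<phi> (\<alpha> k)..\<phi> (\<beta> k)} \<subseteq> {0..T1}" if "k < n" for k
      using \<phi>[rule_format, OF bd[OF that]] by auto
    ultimately show ?thesis using disj' by (intro d(2)[rule_format]) blast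
  qed
  then show ?thesis using d(1) by blast
qed

text \<open>One criterion for all path operations: shifting, joining and composing with Lipschitz
  functions each bound increments of \<open>\<eta>\<close> by those of two time-changed paths plus
  elapsed time.\<close>

lemma abs_continuous_on_dominated:
  assumes \<gamma>: "abs_continuous_on {0..T1} \<gamma>" and \<zeta>: "abs_continuous_on {0..T2} \<zeta>"
    and \<phi>: "\<forall>s t. 0 \<le> s \<longrightarrow> s \<le> t \<longrightarrow> t \<le> T \<longrightarrow> \<phi> s \<le> \<phi> t \<and> \<phi> t - \<phi> s \<le> t - s \<and> 0 \<le> \<phi> s \<and> \<phi> t \<le> T1"
    and \<psi>: "\<forall>s t. 0 \<le> s \<longrightarrow> s \<le> t \<longrightarrow> t \<le> T \<longrightarrow> \<psi> s \<le> \<psi> t \<and> \<psi> t - \<psi> s \<le> t - s \<and> 0 \<le> \<psi> s \<and> \<psi> t \<le> T2"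
    and C: "C > 0"
    and dom: "\<And>s t. 0 \<le> s \<Longrightarrow> s \<le> t \<Longrightarrow> t \<le> T \<Longrightarrow>
       dist (\<eta> s) (\<eta> t) \<le> C * (dist (\<gamma> (\<phi> s)) (\<gamma> (\<phi> t)) + dist (\<zeta> (\<psi> s)) (\<zeta> (\<psi> t)) + (t - s))"
  shows "abs_continuous_on {0..T} \<eta>"
  unfolding abs_continuous_on_def
proof (intro allI impI)
  fix e :: real assume "e > 0"
  define e' where "e' = e / (3 * C)"
  have e': "e' > 0" "C * (e' + e' + e') = e" using \<open>e > 0\<close> C by (auto simp: e'_def field_simps)
  obtain d1 where d1: "d1 > 0" "\<forall>(n::nat) \<alpha> \<beta>. (\<forall>k<n. \<alpha> k \<le> \<beta> k \<and> {\<alpha> k..\<beta> k} \<subseteq> {0..T}) \<and>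
        (\<forall>k<n. \<forall>l<n. k \<noteq> l \<longrightarrow> {\<alpha> k<..<\<beta> k} \<inter> {\<alpha> l<..<\<beta> l} = {}) \<and>
        (\<Sum>k<n. \<beta> k - \<alpha> k) < d1 \<longrightarrow> (\<Sum>k<n. dist (\<gamma> (\<phi> (\<alpha> k))) (\<gamma> (\<phi> (\<beta> k)))) < e'"
    using abs_continuous_on_transform[OF \<gamma> e'(1) \<phi>] by (elim exE conjE)
  obtain d2 where d2: "d2 > 0" "\<forall>(n::nat) \<alpha> \<beta>. (\<forall>k<n. \<alpha> k \<le> \<beta> k \<and> {\<alpha> k..\<beta> k} \<subseteq> {0..T}) \<and>
        (\<forall>k<n. \<forall>l<n. k \<noteq> l \<longrightarrow> {\<alpha> k<..<\<beta> k} \<inter> {\<alpha> l<..<\<beta> l} = {}) \<and>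
        (\<Sum>k<n. \<beta> k - \<alpha> k) < d2 \<longrightarrow> (\<Sum>k<n. dist (\<zeta> (\<psi> (\<alpha> k))) (\<zeta> (\<psi> (\<beta> k)))) < e'"
    using abs_continuous_on_transform[OF \<zeta> e'(1) \<psi>] by (elim exE conjE)
  show "\<exists>d>0. \<forall>(n::nat) \<alpha> \<beta>. (\<forall>k<n. \<alpha> k \<le> \<beta> k \<and> {\<alpha> k..\<beta> k} \<subseteq> {0..T}) \<and>
        (\<forall>k<n. \<forall>l<n. k \<noteq> l \<longrightarrow> {\<alpha> k<..<\<beta> k} \<inter> {\<alpha> l<..<\<beta> l} = {}) \<and>
        (\<Sum>k<n. \<beta> k - \<alpha> k) < d \<longrightarrow> (\<Sum>k<n. dist (\<eta> (\<alpha> k)) (\<eta> (\<beta> k))) < e"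
  proof (intro exI[of _ "min d1 (min d2 e')"] conjI allI impI)
    show "min d1 (min d2 e') > 0" using d1 d2 e' by simp
    fix n :: nat and \<alpha> \<beta>
    assume A: "(\<forall>k<n. \<alpha> k \<le> \<beta> k \<and> {\<alpha> k..\<beta> k} \<subseteq> {0..T}) \<and>
        (\<forall>k<n. \<forall>l<n. k \<noteq> l \<longrightarrow> {\<alpha> k<..<\<beta> k} \<inter> {\<alpha> l<..<\<beta> l} = {}) \<and>
        (\<Sum>k<n. \<beta> k - \<alpha> k) < min d1 (min d2 e')"
    have "(\<Sum>k<n. dist (\<eta> (\<alpha> k)) (\<eta> (\<beta> k))) \<le> (\<Sum>k<n. C * (dist (\<gamma> (\<phi> (\<alpha> k))) (\<gamma> (\<phi> (\<beta> k))) + dist (\<zeta> (\<psi> (\<alpha> k))) (\<zeta> (\<psi> (\<beta> k))) + (\<beta> k - \<alpha> k)))"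
      using A by (intro sum_mono dom) auto
    also have "\<dots> = C * ((\<Sum>k<n. dist (\<gamma> (\<phi> (\<alpha> k))) (\<gamma> (\<phi> (\<beta> k)))) + (\<Sum>k<n. dist (\<zeta> (\<psi> (\<alpha> k))) (\<zeta> (\<psi> (\<beta> k)))) + (\<Sum>k<n. \<beta> k - \<alpha> k))"
      by (simp only: sum_distrib_left[symmetric] sum.distrib)
    also have "\<dots> < C * (e' + e' + e')"
    proof (intro mult_strict_left_mono[OF _ C] add_strict_mono)
      show "(\<Sum>k<n. dist (\<gamma> (\<phi> (\<alpha> k))) (\<gamma> (\<phi> (\<beta> k)))) < e'" using A by (intro d1(2)[rule_format]) auto
      show "(\<Sum>k<n. dist (\<zeta> (\<psi> (\<alpha> k))) (\<zeta> (\<psi> (\<beta> k)))) < e'" using A by (intro d2(2)[rule_format]) auto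
      show "(\<Sum>k<n. \<beta> k - \<alpha> k) < e'" using A by auto
    qed
    finally show "(\<Sum>k<n. dist (\<eta> (\<alpha> k)) (\<eta> (\<beta> k))) < e" using e'(2) by simp
  qed
qed

lemma AC_paths_dominated:
  assumes \<gamma>: "\<gamma> \<in> AC_paths"
    and dom: "\<And>T. \<exists>C>0. \<forall>s t. 0 \<le> s \<longrightarrow> s \<le> t \<longrightarrow> t \<le> T \<longrightarrow> dist (\<eta> s) (\<eta> t) \<le> C * (dist (\<gamma> s) (\<gamma> t) + (t - s))"
  shows "\<eta> \<in> AC_paths"
  unfolding AC_paths_def
proof (intro CollectI allI impI)
  fix T :: real assume T: "T \<ge> 0"
  then have ac: "abs_continuous_on {0..T} \<gamma>" using \<gamma> by (auto simp: AC_paths_def)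
  obtain C where C: "C > 0" "\<And>s t. 0 \<le> s \<Longrightarrow> s \<le> t \<Longrightarrow> t \<le> T \<Longrightarrow> dist (\<eta> s) (\<eta> t) \<le> C * (dist (\<gamma> s) (\<gamma> t) + (t - s))"
    using dom[of T] by blast
  show "abs_continuous_on {0..T} \<eta>"
  proof (rule abs_continuous_on_dominated[OF ac ac, of T "\<lambda>s. s" "\<lambda>s. s" C])
    fix s t assume st: "0 \<le> s" "s \<le> t" "t \<le> T"
    have "C * (dist (\<gamma> s) (\<gamma> t) + (t - s)) \<le> C * (dist (\<gamma> s) (\<gamma> t) + dist (\<gamma> s) (\<gamma> t) + (t - s))"
      using C(1) by (intro mult_left_mono) auto
    then show "dist (\<eta> s) (\<eta> t) \<le> C * (dist (\<gamma> s) (\<gamma> t) + dist (\<gamma> s) (\<gamma> t) + (t - s))"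
      using C(2)[OF st] by linarith
  qed (use C in auto)
qed

lemma AC_paths_const: "(\<lambda>t. c) \<in> AC_paths"
  unfolding AC_paths_def abs_continuous_on_def by (auto intro!: exI[of _ 1])

lemma AC_paths_locally_Lipschitz:
  assumes "\<And>T. \<exists>C. \<forall>s t. 0 \<le> s \<longrightarrow> s \<le> t \<longrightarrow> t \<le> T \<longrightarrow> dist (\<eta> s) (\<eta> t) \<le> C * (t - s)"
  shows "\<eta> \<in> AC_paths"
proof (rule AC_paths_dominated[OF AC_paths_const[of "0::real"]])
  fix T
  obtain C where C: "\<And>s t. 0 \<le> s \<Longrightarrow> s \<le> t \<Longrightarrow> t \<le> T \<Longrightarrow> dist (\<eta> s) (\<eta> t) \<le> C * (t - s)"
    using assms by metis
  have "dist (\<eta> s) (\<eta> t) \<le> max C 1 * (dist (0::real) 0 + (t - s))" if "0 \<le> s" "s \<le> t" "t \<le> T" for s t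
  proof -
    have "C * (t - s) \<le> max C 1 * (t - s)" using that by (intro mult_right_mono) auto
    then show ?thesis using C[OF that] by simp
  qed
  then show "\<exists>C>0. \<forall>s t. 0 \<le> s \<longrightarrow> s \<le> t \<longrightarrow> t \<le> T \<longrightarrow> dist (\<eta> s) (\<eta> t) \<le> C * (dist (0::real) 0 + (t - s))"
    by (intro exI[of _ "max C 1"]) auto
qed

lemma AC_paths_shift:
  assumes "\<gamma> \<in> AC_paths" "\<tau> \<ge> 0" shows "(\<lambda>t. \<gamma> (t + \<tau>)) \<in> AC_paths"
  unfolding AC_paths_def
proof (intro CollectI allI impI)
  fix T :: real assume T: "T \<ge> 0"
  have ac: "abs_continuous_on {0..T + \<tau>} \<gamma>" using assms T by (auto simp: AC_paths_def)
  show "abs_continuous_on {0..T} (\<lambda>t. \<gamma> (t + \<tau>))"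
    by (rule abs_continuous_on_dominated[OF ac ac, of T "\<lambda>s. s + \<tau>" "\<lambda>s. s + \<tau>" 1]) (use assms(2) in auto)
qed

definition join_paths_at :: "real \<Rightarrow> (real \<Rightarrow> 'a) \<Rightarrow> (real \<Rightarrow> 'a) \<Rightarrow> real \<Rightarrow> 'a" where
  "join_paths_at \<tau> \<gamma> \<zeta> t = (if t \<le> \<tau> then \<gamma> t else \<zeta> (t - \<tau>))"

lemma AC_paths_join:
  assumes \<gamma>: "\<gamma> \<in> AC_paths" and \<zeta>: "\<zeta> \<in> AC_paths" and "\<zeta> 0 = \<gamma> \<tau>" "\<tau> \<ge> 0"
  shows "join_paths_at \<tau> \<gamma> \<zeta> \<in> AC_paths"
  unfolding AC_paths_def
proof (intro CollectI allI impI)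
  fix T :: real assume T: "T \<ge> 0"
  have ac: "abs_continuous_on {0..T} \<gamma>" "abs_continuous_on {0..T} \<zeta>" using \<gamma> \<zeta> T by (auto simp: AC_paths_def)
  show "abs_continuous_on {0..T} (join_paths_at \<tau> \<gamma> \<zeta>)"
  \<comment> \<open>Each path runs on its own clock: \<open>\<gamma>\<close> stops at
    \<open>\<tau>\<close>, and \<open>\<zeta>\<close> waits at its starting point until
    then.\<close>
  proof (rule abs_continuous_on_dominated[OF ac, of T "\<lambda>s. min s \<tau>" "\<lambda>s. max 0 (s - \<tau>)" 1])
    fix s t :: real assume st: "0 \<le> s" "s \<le> t" "t \<le> T"
    consider "t \<le> \<tau>" | "s \<le> \<tau>" "\<tau> < t" | "\<tau> < s" by linarith
    then have "dist (join_paths_at \<tau> \<gamma> \<zeta> s) (join_paths_at \<tau> \<gamma> \<zeta> t) \<le>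
       dist (\<gamma> (min s \<tau>)) (\<gamma> (min t \<tau>)) + dist (\<zeta> (max 0 (s - \<tau>))) (\<zeta> (max 0 (t - \<tau>)))"
    proof cases
      case 2
      then show ?thesis using dist_triangle[of "\<gamma> s" "\<zeta> (t - \<tau>)" "\<gamma> \<tau>"] assms(3)
        by (simp add: join_paths_at_def min_def max_def)
    qed (use st in \<open>auto simp: join_paths_at_def min_def max_def\<close>)
    then show "dist (join_paths_at \<tau> \<gamma> \<zeta> s) (join_paths_at \<tau> \<gamma> \<zeta> t) \<le>
      1 * (dist (\<gamma> (min s \<tau>)) (\<gamma> (min t \<tau>)) + dist (\<zeta> (max 0 (s - \<tau>))) (\<zeta> (max 0 (t - \<tau>))) + (t - s))"
      using st by simp
  qed (use assms(4) in auto)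
qed

text \<open>Valid also where the path is not differentiable: both sides choose from the same set of
  candidate derivatives.\<close>

lemma vector_derivative_shift: "vector_derivative (\<lambda>t. \<gamma> (t + \<tau>)) (at s) = vector_derivative \<gamma> (at (s + \<tau>))"
proof -
  have "((\<lambda>t. \<gamma> (t + \<tau>)) has_vector_derivative D) (at s) \<longleftrightarrow> (\<gamma> has_vector_derivative D) (at (s + \<tau>))" for D
  proof
    assume "(\<gamma> has_vector_derivative D) (at (s + \<tau>))"
    then have "((\<gamma> \<circ> (\<lambda>t. t + \<tau>)) has_vector_derivative (1 *\<^sub>R D)) (at s)"
      by (intro vector_diff_chain_at) (auto intro!: derivative_eq_intros)
    then show "((\<lambda>t. \<gamma> (t + \<tau>)) has_vector_derivative D) (at s)" by (simp add: o_def)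
  next
    assume "((\<lambda>t. \<gamma> (t + \<tau>)) has_vector_derivative D) (at s)"
    then have "((\<lambda>t. \<gamma> (t + \<tau>)) has_vector_derivative D) (at ((s + \<tau>) - \<tau>))" by simp
    then have "(((\<lambda>t. \<gamma> (t + \<tau>)) \<circ> (\<lambda>t. t - \<tau>)) has_vector_derivative (1 *\<^sub>R D)) (at (s + \<tau>))"
      by (intro vector_diff_chain_at) (auto intro!: derivative_eq_intros)
    then show "(\<gamma> has_vector_derivative D) (at (s + \<tau>))" by (simp add: o_def)
  qed
  then show ?thesis unfolding vector_derivative_def by simp
qed

lemma vector_derivative_join:
  "s < \<tau> \<Longrightarrow> vector_derivative (join_paths_at \<tau> \<gamma> \<zeta>) (at s) = vector_derivative \<gamma> (at s)"
  "s > 0 \<Longrightarrow> vector_derivative (join_paths_at \<tau> \<gamma> \<zeta>) (at (s + \<tau>)) = vector_derivative \<zeta> (at s)"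
proof -
  assume "s < \<tau>"
  then have "\<forall>\<^sub>F x in nhds s. x \<in> {..<\<tau>}" by (intro eventually_nhds_in_open) auto
  then have "\<forall>\<^sub>F x in nhds s. x \<in> UNIV \<longrightarrow> join_paths_at \<tau> \<gamma> \<zeta> x = \<gamma> x"
    by eventually_elim (simp add: join_paths_at_def)
  then show "vector_derivative (join_paths_at \<tau> \<gamma> \<zeta>) (at s) = vector_derivative \<gamma> (at s)"
    by (intro vector_derivative_cong_eq) auto
next
  assume "s > 0"
  then have "\<forall>\<^sub>F x in nhds s. x \<in> {0<..}" by (intro eventually_nhds_in_open) auto
  then have "\<forall>\<^sub>F x in nhds s. x \<in> UNIV \<longrightarrow> join_paths_at \<tau> \<gamma> \<zeta> (x + \<tau>) = \<zeta> x"
    by eventually_elim (simp add: join_paths_at_def)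
  then have "vector_derivative (\<lambda>x. join_paths_at \<tau> \<gamma> \<zeta> (x + \<tau>)) (at s) = vector_derivative \<zeta> (at s)"
    by (intro vector_derivative_cong_eq) auto
  then show "vector_derivative (join_paths_at \<tau> \<gamma> \<zeta>) (at (s + \<tau>)) = vector_derivative \<zeta> (at s)"
    by (simp add: vector_derivative_shift)
qed

section \<open>Chain rule and averaging along paths\<close>

lemma Ccc_smooth_Lipschitz:
  assumes f: "f \<in> Ccc_smooth"
  obtains G where "G > 0" "\<And>x. norm (grad f x) \<le> G" "\<And>x y. \<bar>f x - f y\<bar> \<le> G * norm (x - y)"
proof -
  obtain K where K: "compact K" "\<And>x. x \<notin> K \<Longrightarrow> grad f x = 0" using Ccc_smooth_grad_zero[OF f] by blast
  have "compact (grad f ` K)"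
    using K Ccc_smooth_continuous_grad[OF f] by (meson compact_continuous_image continuous_on_subset subset_UNIV)
  then obtain G where G: "\<forall>y\<in>grad f ` K. norm y \<le> G" using compact_imp_bounded bounded_iff by blast
  have g: "norm (grad f x) \<le> max G 1" for x using G K(2)[of x] by (cases "x \<in> K") (auto simp: le_max_iff_disj)
  have "norm (f x - f y) \<le> max G 1 * norm (x - y)" for x y
  proof (rule differentiable_bound[OF convex_UNIV])
    show "(f has_derivative (\<lambda>h. h \<bullet> grad f x)) (at x within UNIV)" for x
      using Ccc_smooth_has_derivative[OF f] by simp
    show "onorm (\<lambda>h. h \<bullet> grad f x) \<le> max G 1" for x
    proof (rule onorm_bound)
      show "norm (h \<bullet> grad f x) \<le> max G 1 * norm h" for h
      proof -
        have "norm (h \<bullet> grad f x) \<le> norm h * norm (grad f x)" using Cauchy_Schwarz_ineq2[of h "grad f x"] by simp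
        also have "\<dots> \<le> norm h * max G 1" using g by (intro mult_left_mono) auto
        finally show ?thesis by (simp add: mult.commute)
      qed
    qed simp
  qed auto
  then show thesis using that[of "max G 1"] g by simp
qed

text \<open>The discounted composition is again absolutely continuous, so the fundamental theorem
  applies to it. The discount is built in to match that of the running payoff.\<close>

lemma AC_path_discounted_chain_rule:
  assumes \<gamma>: "\<gamma> \<in> AC_paths" and f: "f \<in> Ccc_smooth" and \<tau>: "\<tau> \<ge> 0" and lam: "lam > 0"
  shows "((\<lambda>s. exp (- s / lam) * (vector_derivative \<gamma> (at s) \<bullet> grad f (\<gamma> s) - f (\<gamma> s) / lam))
      has_integral (exp (- \<tau> / lam) * f (\<gamma> \<tau>) - f (\<gamma> 0))) {0..\<tau>}"
proof -
  obtain G where G: "G > 0" "\<And>x y. \<bar>f x - f y\<bar> \<le> G * norm (x - y)"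
    by (rule Ccc_smooth_Lipschitz[OF f]) (rule that; assumption)
  obtain B where B: "\<And>x. \<bar>f x\<bar> \<le> B" using Ccc_smooth_bounded[OF f] by blast
  have B0: "B \<ge> 0" using B[of undefined] by linarith
  let ?w = "\<lambda>t. exp (- t / lam) * f (\<gamma> t)"
  have w: "?w \<in> AC_paths"
  proof (rule AC_paths_dominated[OF \<gamma>])
    fix T :: real
    have "dist (?w s) (?w t) \<le> (G + B / lam) * (dist (\<gamma> s) (\<gamma> t) + (t - s))" if st: "0 \<le> s" "s \<le> t" for s t
    proof -
      have 1: "\<bar>exp (- s / lam) - exp (- t / lam)\<bar> \<le> (t - s) / lam"
      proof -
        define y where "y = (t - s) / lam"
        have y: "y \<ge> 0" "exp (- t / lam) = exp (- s / lam) * exp (- y)"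
          using st lam by (simp_all add: y_def exp_add[symmetric] field_simps)
        have "0 \<le> 1 - exp (- y)" "1 - exp (- y) \<le> y" using y(1) exp_ge_add_one_self[of "- y"] by auto
        moreover have "exp (- s / lam) \<le> 1" "0 < exp (- s / lam)" using st lam by auto
        ultimately have "0 \<le> exp (- s / lam) * (1 - exp (- y)) \<and> exp (- s / lam) * (1 - exp (- y)) \<le> 1 * y"
          by (intro conjI mult_mono mult_nonneg_nonneg) auto
        then show ?thesis unfolding y(2) y_def[symmetric] by (simp add: algebra_simps)
      qed
      have "?w s - ?w t = exp (- s / lam) * (f (\<gamma> s) - f (\<gamma> t)) + (exp (- s / lam) - exp (- t / lam)) * f (\<gamma> t)"
        by (simp add: algebra_simps)
      then have "\<bar>?w s - ?w t\<bar> \<le> exp (- s / lam) * \<bar>f (\<gamma> s) - f (\<gamma> t)\<bar> + \<bar>exp (- s / lam) - exp (- t / lam)\<bar> * \<bar>f (\<gamma> t)\<bar>"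
        by (metis abs_mult abs_triangle_ineq abs_of_pos exp_gt_zero)
      also have "\<dots> \<le> 1 * (G * dist (\<gamma> s) (\<gamma> t)) + ((t - s) / lam) * B"
        using st lam G(2)[of "\<gamma> s" "\<gamma> t"] B[of "\<gamma> t"] 1 by (intro add_mono mult_mono) (auto simp: dist_norm)
      also have "\<dots> \<le> (G + B / lam) * dist (\<gamma> s) (\<gamma> t) + (G + B / lam) * (t - s)"
      proof (intro add_mono)
        show "1 * (G * dist (\<gamma> s) (\<gamma> t)) \<le> (G + B / lam) * dist (\<gamma> s) (\<gamma> t)"
          using B0 lam by (simp add: mult_right_mono)
        have "B / lam * (t - s) \<le> (G + B / lam) * (t - s)" using st G(1) by (intro mult_right_mono) auto
        then show "((t - s) / lam) * B \<le> (G + B / lam) * (t - s)" by (simp add: mult.commute)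
      qed
      finally show ?thesis by (simp add: dist_real_def distrib_left)
    qed
    moreover have "G + B / lam > 0" using G(1) B0 lam by (simp add: add_pos_nonneg)
    ultimately show "\<exists>C>0. \<forall>s t. 0 \<le> s \<longrightarrow> s \<le> t \<longrightarrow> t \<le> T \<longrightarrow> dist (?w s) (?w t) \<le> C * (dist (\<gamma> s) (\<gamma> t) + (t - s))"
      by blast
  qed
  let ?N = "{s. s \<ge> 0 \<and> \<not> \<gamma> differentiable (at s)}"
  have der: "vector_derivative ?w (at s) = exp (- s / lam) * (vector_derivative \<gamma> (at s) \<bullet> grad f (\<gamma> s) - f (\<gamma> s) / lam)"
    if s: "s \<in> {0..\<tau>} - ?N" for s
  proof -
    have "(\<gamma> has_vector_derivative vector_derivative \<gamma> (at s)) (at s)"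
      using s by (simp add: vector_derivative_works)
    then have "((\<lambda>s. f (\<gamma> s)) has_derivative (\<lambda>t. (t *\<^sub>R vector_derivative \<gamma> (at s)) \<bullet> grad f (\<gamma> s))) (at s)"
      unfolding has_vector_derivative_def by (rule has_derivative_compose[OF _ Ccc_smooth_has_derivative[OF f]])
    then have "((\<lambda>s. f (\<gamma> s)) has_real_derivative (vector_derivative \<gamma> (at s) \<bullet> grad f (\<gamma> s))) (at s)"
      unfolding has_field_derivative_def by (simp add: mult.commute[of _ "vector_derivative \<gamma> (at s) \<bullet> grad f (\<gamma> s)"])
    then have "(?w has_real_derivative exp (- s / lam) * (vector_derivative \<gamma> (at s) \<bullet> grad f (\<gamma> s) - f (\<gamma> s) / lam)) (at s)"
      using lam by (auto intro!: derivative_eq_intros simp: field_simps)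
    then show ?thesis by (simp add: has_real_derivative_iff_has_vector_derivative vector_derivative_at)
  qed
  have "((\<lambda>s. vector_derivative ?w (at s)) has_integral (?w \<tau> - ?w 0)) {0..\<tau>}"
    by (rule AC_path_FTC(3)[OF w \<tau>])
  from has_integral_spike[OF AC_path_FTC(2)[OF \<gamma>] _ this] der show ?thesis by simp
qed

text \<open>The averaging behind both viscosity inequalities. Read at every \<open>\<tau>\<close>,
  the hypothesis keeps the whole piece of path almost maximal for \<open>U\<close>; read at
  \<open>\<delta>\<close>, it forces a time at which \<open>lam * G\<close> is almost
  \<open>S\<close> or more. The slack is quadratic in the window \<open>\<delta>\<close>, so both
  errors are of order \<open>\<delta>\<close>.\<close>

lemma discounted_averaging:
  fixes z :: "real \<Rightarrow> 'a::topological_space"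
  assumes U: "\<And>x. U x \<le> S" "\<And>x. \<bar>U x\<bar> \<le> B" and G: "\<And>x. \<bar>G x\<bar> \<le> C"
    and cont: "continuous_on {0..\<delta>} (\<lambda>t. G (z t))" and lam: "lam > 0" and \<delta>: "0 < \<delta>" "\<delta> \<le> 1"
    and ineq: "\<And>\<tau>. 0 \<le> \<tau> \<Longrightarrow> \<tau> \<le> \<delta> \<Longrightarrow>
      S - 2 * \<delta>\<^sup>2 \<le> exp (- \<tau> / lam) * U (z \<tau>) + integral {0..\<tau>} (\<lambda>t. exp (- t / lam) * G (z t))"
  obtains t where "S - (2 + C + B / lam) * \<delta> \<le> U (z t)" "S - 3 * lam * exp (1 / lam) * \<delta> \<le> lam * G (z t)"
proof -
  have B0: "B \<ge> 0" using U(2)[of undefined] by linarith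
  have C0: "C \<ge> 0" using G[of undefined] by linarith
  have int: "(\<lambda>t. exp (- t / lam) * G (z t)) integrable_on {0..\<tau>}" if "\<tau> \<le> \<delta>" for \<tau>
    by (intro integrable_continuous_real continuous_intros continuous_on_subset[OF cont]) (use that lam in auto)
  have e1: "exp (- t / lam) \<le> 1" "1 - exp (- t / lam) \<le> t / lam" if "t \<ge> 0" for t
    using that lam exp_ge_add_one_self[of "- t / lam"] by auto
  \<comment> \<open>The three terms of the constant come from the slack, from the integral of
    \<open>G\<close>, and from removing the discount in front of \<open>U\<close>.\<close>
  have near: "S - (2 + C + B / lam) * \<delta> \<le> U (z \<tau>)" if t: "0 \<le> \<tau>" "\<tau> \<le> \<delta>" for \<tau>
  proof -
    have "integral {0..\<tau>} (\<lambda>t. exp (- t / lam) * G (z t)) \<le> integral {0..\<tau>} (\<lambda>t. C)"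
    proof (rule integral_le[OF int[OF t(2)] integrable_const_ivl])
      fix s assume "s \<in> {0..\<tau>}"
      then have "exp (- s / lam) * \<bar>G (z s)\<bar> \<le> 1 * C" using e1(1)[of s] G by (intro mult_mono) auto
      moreover have "exp (- s / lam) * G (z s) \<le> exp (- s / lam) * \<bar>G (z s)\<bar>" by (intro mult_left_mono) auto
      ultimately show "exp (- s / lam) * G (z s) \<le> C" by linarith
    qed
    also have "\<dots> = C * \<tau>" using t by simp
    also have "\<dots> \<le> C * \<delta>" using t C0 by (intro mult_left_mono) auto
    finally have "integral {0..\<tau>} (\<lambda>t. exp (- t / lam) * G (z t)) \<le> C * \<delta>" .
    moreover have "exp (- \<tau> / lam) * U (z \<tau>) \<le> U (z \<tau>) + (B / lam) * \<delta>"
    proof -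
      have "(1 - exp (- \<tau> / lam)) * (- U (z \<tau>)) \<le> (1 - exp (- \<tau> / lam)) * B"
        using e1(1)[OF t(1)] U(2)[of "z \<tau>"] by (intro mult_left_mono) auto
      also have "\<dots> \<le> (\<tau> / lam) * B" using e1(2)[OF t(1)] B0 by (intro mult_right_mono) auto
      also have "\<dots> \<le> (\<delta> / lam) * B" using t lam B0 by (intro mult_right_mono divide_right_mono) auto
      finally show ?thesis by (simp add: algebra_simps)
    qed
    moreover have "2 * \<delta>\<^sup>2 \<le> 2 * \<delta>" using \<delta> by (simp add: power2_eq_square mult_left_le)
    ultimately show ?thesis using ineq[OF t] by (simp add: algebra_simps)
  qed
  \<comment> \<open>If this failed at all times, the discounted deficit would be at least
    \<open>3 * \<delta>\<close> per unit time, since \<open>exp (1 / lam)\<close> undoes the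
    discount up to time 1. Integrated, it gives \<open>3 * \<delta>^2\<close>, more than the slack
    \<open>2 * \<delta>^2\<close> allows.\<close>
  have "\<exists>t\<in>{0..\<delta>}. S - 3 * lam * exp (1 / lam) * \<delta> \<le> lam * G (z t)"
  proof (rule ccontr)
    assume "\<not> ?thesis"
    then have lt: "lam * G (z t) < S - 3 * lam * exp (1 / lam) * \<delta>" if "t \<in> {0..\<delta>}" for t using that by force
    have der: "((\<lambda>t. - exp (- t / lam) * S) has_vector_derivative (exp (- t / lam) * (S / lam))) (at t within {0..\<delta>})" for t
      unfolding has_real_derivative_iff_has_vector_derivative[symmetric]
      using lam by (auto intro!: derivative_eq_intros simp: field_simps)
    have I: "((\<lambda>t. exp (- t / lam) * (S / lam)) has_integral (- exp (- \<delta> / lam) * S - (- exp (- 0 / lam) * S))) {0..\<delta>}"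
      by (rule fundamental_theorem_of_calculus[OF _ der]) (use \<delta> in auto)
    have I2: "((\<lambda>t. exp (- t / lam) * (S / lam) - 3 * \<delta>) has_integral (- exp (- \<delta> / lam) * S - (- exp (- 0 / lam) * S) - 3 * \<delta> * \<delta>)) {0..\<delta>}"
      using has_integral_diff[OF I has_integral_const_real[of "3 * \<delta>" 0 \<delta>]] \<delta> by (simp add: mult.commute)
    have "integral {0..\<delta>} (\<lambda>t. exp (- t / lam) * G (z t)) \<le> - exp (- \<delta> / lam) * S - (- exp (- 0 / lam) * S) - 3 * \<delta> * \<delta>"
    proof (rule has_integral_le[OF integrable_integral[OF int[OF order_refl]] I2])
      fix t assume t: "t \<in> {0..\<delta>}"
      have "G (z t) \<le> S / lam - 3 * exp (1 / lam) * \<delta>" using lt[OF t] lam by (simp add: field_simps)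
      then have "exp (- t / lam) * G (z t) \<le> exp (- t / lam) * (S / lam - 3 * exp (1 / lam) * \<delta>)"
        by (intro mult_left_mono) auto
      moreover have "3 * \<delta> \<le> 3 * \<delta> * (exp (- t / lam) * exp (1 / lam))"
      proof -
        have "1 \<le> exp (- t / lam) * exp (1 / lam)" using t \<delta> lam by (simp add: exp_add[symmetric] field_simps)
        then show ?thesis using \<delta> by simp
      qed
      ultimately show "exp (- t / lam) * G (z t) \<le> exp (- t / lam) * (S / lam) - 3 * \<delta>"
        by (simp add: algebra_simps)
    qed
    then have "integral {0..\<delta>} (\<lambda>t. exp (- t / lam) * G (z t)) \<le> S - exp (- \<delta> / lam) * S - 3 * \<delta>\<^sup>2"
      by (simp add: power2_eq_square)
    moreover have "exp (- \<delta> / lam) * U (z \<delta>) \<le> exp (- \<delta> / lam) * S" using U(1) by (intro mult_left_mono) auto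
    moreover have "S - 2 * \<delta>\<^sup>2 \<le> exp (- \<delta> / lam) * U (z \<delta>) + integral {0..\<delta>} (\<lambda>t. exp (- t / lam) * G (z t))"
      using \<delta> by (intro ineq) auto
    ultimately have "S - 2 * \<delta>\<^sup>2 \<le> S - 3 * \<delta>\<^sup>2" by linarith
    then show False using \<delta> by simp
  qed
  then obtain t where "t \<in> {0..\<delta>}" "S - 3 * lam * exp (1 / lam) * \<delta> \<le> lam * G (z t)" by blast
  then show thesis using that near[of t] by auto
qed

section \<open>Lagrangian and discounted cost\<close>

lemma nn_integral_halfline_tendsto:
  fixes g :: "real \<Rightarrow> real"
  assumes nn: "\<And>s. s \<ge> 0 \<Longrightarrow> g s \<ge> 0" and meas: "(\<lambda>s. g s * indicator {0..} s) \<in> borel_measurable lebesgue"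
    and q: "(\<integral>\<^sup>+s. ennreal (g s * indicator {0..} s) \<partial>lebesgue) = ennreal q" "q \<ge> 0"
  shows "g integrable_on {0..T}" and "((\<lambda>T. integral {0..T} g) \<longlongrightarrow> q) at_top"
proof -
  have "((\<lambda>s. g s * indicator {0..} s) has_integral q) UNIV"
    by (subst has_integral_iff_nn_integral_lebesgue) (use nn meas q in \<open>auto simp: indicator_def\<close>)
  moreover have "(\<lambda>s. g s * indicator {0..} s) = (\<lambda>s. if s \<in> {0..} then g s else 0)" by (auto simp: indicator_def)
  ultimately have hi: "(g has_integral q) {0..}" by (simp only: has_integral_restrict_UNIV)
  then have abs: "g absolutely_integrable_on {0..}"
    using nn by (intro nonnegative_absolutely_integrable_1) (auto simp: integrable_on_def)
  have sub: "g absolutely_integrable_on {0..T}" for T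
    by (rule set_integrable_subset[OF abs]) auto
  then show "g integrable_on {0..T}" by (rule set_lebesgue_integral_eq_integral(1))
  have "((\<lambda>T. set_lebesgue_integral lebesgue {0..T} g) \<longlongrightarrow> set_lebesgue_integral lebesgue {0..} g) at_top"
    by (rule tendsto_set_lebesgue_integral_at_top[OF _ abs]) auto
  moreover have "set_lebesgue_integral lebesgue {0..} g = q"
    using set_lebesgue_integral_eq_integral(2)[OF abs] hi by (simp add: integral_unique)
  ultimately show "((\<lambda>T. integral {0..T} g) \<longlongrightarrow> q) at_top"
    using set_lebesgue_integral_eq_integral(2)[OF sub] by simp
qed

lemma nn_integral_halfline_le:
  fixes g :: "real \<Rightarrow> real"
  assumes nn: "\<And>s. s \<ge> 0 \<Longrightarrow> g s \<ge> 0" and int: "\<And>T. T \<ge> 0 \<Longrightarrow> g integrable_on {0..T}"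
    and b: "\<And>T. T \<ge> 0 \<Longrightarrow> integral {0..T} g \<le> b"
  shows "(\<integral>\<^sup>+s. ennreal (g s * indicator {0..} s) \<partial>lebesgue) \<le> ennreal b"
proof -
  define G where "G n s = g s * indicator {0..real n} s" for n :: nat and s
  have G: "G n \<in> borel_measurable lebesgue \<and> (\<integral>\<^sup>+s. ennreal (G n s) \<partial>lebesgue) = ennreal (integral {0..real n} g)" for n
  proof -
    have "(g has_integral (integral {0..real n} g)) {0..real n}" using int[of "real n"] by (simp add: integrable_integral)
    moreover have "G n = (\<lambda>s. if s \<in> {0..real n} then g s else 0)" by (auto simp: G_def indicator_def)
    ultimately have "(G n has_integral (integral {0..real n} g)) UNIV" by (simp only: has_integral_restrict_UNIV)
    then show ?thesis
      by (subst (asm) has_integral_iff_nn_integral_lebesgue) (use nn in \<open>auto simp: G_def indicator_def\<close>)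
  qed
  have sup: "(SUP n. ennreal (G n s)) = ennreal (g s * indicator {0..} s)" for s
  proof (rule antisym)
    show "(SUP n. ennreal (G n s)) \<le> ennreal (g s * indicator {0..} s)"
      using nn by (intro SUP_least ennreal_leI) (auto simp: G_def indicator_def)
    obtain n :: nat where "s \<le> real n" using real_arch_simple by blast
    then have "ennreal (g s * indicator {0..} s) = ennreal (G n s)" by (auto simp: G_def indicator_def)
    then show "ennreal (g s * indicator {0..} s) \<le> (SUP n. ennreal (G n s))" by (metis SUP_upper UNIV_I)
  qed
  have "incseq (\<lambda>n s. ennreal (G n s))"
    unfolding incseq_def le_fun_def using nn by (intro allI impI ennreal_leI) (auto simp: G_def indicator_def)
  then have "(\<integral>\<^sup>+s. (SUP n. ennreal (G n s)) \<partial>lebesgue) = (SUP n. \<integral>\<^sup>+s. ennreal (G n s) \<partial>lebesgue)"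
    using G by (intro nn_integral_monotone_convergence_SUP) (auto intro: measurable_compose[OF _ measurable_ennreal])
  also have "\<dots> \<le> ennreal b" using G b by (intro SUP_least) (auto intro: ennreal_leI)
  finally show ?thesis unfolding sup .
qed

lemma AC_path_derivative_measurable:
  fixes \<gamma> :: "real \<Rightarrow> 'a::euclidean_space"
  assumes "\<gamma> \<in> AC_paths" "T \<ge> 0"
  shows "(\<lambda>s. vector_derivative \<gamma> (at s)) \<in> borel_measurable (lebesgue_on {0..T})"
  using AC_path_FTC(3)[OF assms] by (intro integrable_imp_measurable) (auto simp: integrable_on_def)

context coercive_hamiltonian
begin

text \<open>Coercivity makes the Legendre transform finite, so a real-valued version is available;
  \<open>Lagrangian_SUP\<close> identifies it with the extended real one.\<close>

definition Lag :: "'a \<Rightarrow> 'a \<Rightarrow> real" where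
  "Lag x v = (SUP p. p \<bullet> v - H x p)"

lemma Lag_bdd: "bdd_above (range (\<lambda>p. p \<bullet> v - H x p))"
proof -
  obtain c C where c: "c > 0" "\<And>p. c * (norm p)\<^sup>2 - C \<le> H x p"
    using H_coercive[of "{x}"] by auto
  have "p \<bullet> v - H x p \<le> (norm v)\<^sup>2 / (4 * c) + C" for p
  proof -
    have "0 \<le> (2 * c * norm p - norm v)\<^sup>2 / (4 * c)" using c(1) by simp
    also have "\<dots> = c * (norm p)\<^sup>2 - norm p * norm v + (norm v)\<^sup>2 / (4 * c)"
      using c(1) by (simp add: power2_eq_square field_simps)
    finally show ?thesis using c(2)[of p] norm_cauchy_schwarz[of p v] by linarith
  qed
  then show ?thesis by (rule bdd_aboveI2)
qed

lemma Young: "p \<bullet> v \<le> H x p + Lag x v"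
  unfolding Lag_def using cSUP_upper[OF UNIV_I Lag_bdd, of p v x] by linarith

lemma Lag_nonneg: "Lag x v \<ge> 0"
  using Young[of 0 v x] by (simp add: H_zero)

lemma Lag_least: "(\<And>p. p \<bullet> v - H x p \<le> C) \<Longrightarrow> Lag x v \<le> C"
  unfolding Lag_def by (rule cSUP_least) auto

lemma Lagrangian_SUP: "(SUP p. ereal (p \<bullet> v - H x p)) = ereal (Lag x v)"
proof (rule SUP_eqI)
  show "ereal (p \<bullet> v - H x p) \<le> ereal (Lag x v)" for p using Young[of p v x] by simp
  show "ereal (Lag x v) \<le> y" if "\<And>p. p \<in> UNIV \<Longrightarrow> ereal (p \<bullet> v - H x p) \<le> y" for y
  proof (cases y)
    case (real z)
    then show ?thesis using that by (auto intro!: Lag_least)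
  qed (use that in auto)
qed

text \<open>Momenta beyond \<open>P\<close> contribute nonpositive values, as \<open>H\<close> grows
  quadratically, while \<open>Lag\<close> is nonnegative. Only a compact set of momenta matters, and
  there \<open>H\<close> is uniformly continuous.\<close>

lemma Lag_uniform:
  assumes e: "e > 0"
  shows "\<exists>d>0. \<forall>x\<in>cball 0 R. \<forall>y\<in>cball 0 R. \<forall>v\<in>cball 0 R. \<forall>w\<in>cball 0 R.
     dist x y < d \<longrightarrow> dist v w < d \<longrightarrow> Lag x v \<le> Lag y w + e"
proof -
  obtain c C0 where c: "c > 0" "\<And>x p. x \<in> cball 0 R \<Longrightarrow> c * (norm p)\<^sup>2 - C0 \<le> H x p"
    using H_coercive[OF compact_cball[of 0 R]] by blast
  define C where "C = max C0 0"
  define R' where "R' = max R 0"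
  \<comment> \<open>Chosen so that \<open>c * P \<ge> R' + C\<close>; the \<open>+ 1\<close> ensures
    \<open>P \<ge> 1\<close>, which absorbs the additive constant of coercivity.\<close>
  define P where "P = (R' + C) / c + 1"
  have nn: "C \<ge> 0" "R' \<ge> 0" by (auto simp: C_def R'_def)
  have P1: "P \<ge> 1" using nn c(1) by (simp add: P_def)
  have far: "p \<bullet> v - H x p \<le> 0" if x: "x \<in> cball 0 R" "v \<in> cball 0 R" and p: "norm p > P" for x v p
  proof -
    have "norm p * (R' + C) \<le> norm p * (c * norm p)"
    proof (intro mult_left_mono)
      have "R' + C \<le> c * P" using c(1) by (simp add: P_def field_simps)
      also have "\<dots> \<le> c * norm p" using p c(1) by simp
      finally show "R' + C \<le> c * norm p" .
    qed simp
    moreover have "1 * C \<le> norm p * C" using p P1 nn by (intro mult_right_mono) auto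
    ultimately have "norm p * R' + C \<le> c * (norm p)\<^sup>2" by (simp add: power2_eq_square algebra_simps)
    moreover have "p \<bullet> v \<le> norm p * norm v" by (rule norm_cauchy_schwarz)
    moreover have "norm p * norm v \<le> norm p * R'" using x by (intro mult_left_mono) (auto simp: R'_def)
    moreover have "C0 \<le> C" by (simp add: C_def)
    ultimately show ?thesis using c(2)[OF x(1), of p] by linarith
  qed
  have "uniformly_continuous_on (cball 0 R \<times> cball 0 P) (\<lambda>(x, p). H x p)"
    by (intro compact_uniformly_continuous compact_Times compact_cball continuous_on_subset[OF H_continuous]) auto
  then obtain d1 where d1: "d1 > 0" "\<And>z z'. z \<in> cball 0 R \<times> cball 0 P \<Longrightarrow> z' \<in> cball 0 R \<times> cball 0 P \<Longrightarrow>
      dist z' z < d1 \<Longrightarrow> dist (case z' of (x, p) \<Rightarrow> H x p) (case z of (x, p) \<Rightarrow> H x p) < e / 2"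
    unfolding uniformly_continuous_on_def using e by (meson half_gt_zero)
  define d where "d = min d1 (e / (2 * P))"
  have d: "d > 0" "P * d \<le> e / 2" using d1(1) e P1 by (auto simp: d_def min_def field_simps)
  have "Lag x v \<le> Lag y w + e"
    if xy: "x \<in> cball 0 R" "y \<in> cball 0 R" "v \<in> cball 0 R" "w \<in> cball 0 R" "dist x y < d" "dist v w < d" for x y v w
  proof (rule Lag_least)
    fix p
    show "p \<bullet> v - H x p \<le> Lag y w + e"
    proof (cases "norm p \<le> P")
      case True
      have "dist (H x p) (H y p) < e / 2"
        using d1(2)[of "(y, p)" "(x, p)"] xy True by (simp add: dist_Pair_Pair d_def)
      then have "H y p - H x p < e / 2" unfolding dist_real_def by linarith
      moreover have "p \<bullet> (v - w) \<le> P * d"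
      proof -
        have "p \<bullet> (v - w) \<le> norm p * norm (v - w)" by (rule norm_cauchy_schwarz)
        also have "\<dots> \<le> P * d" using True xy(6) P1 by (intro mult_mono) (auto simp: dist_norm)
        finally show ?thesis .
      qed
      ultimately show ?thesis using Young[of p w y] d(2) unfolding inner_diff_right by linarith
    next
      case False
      then show ?thesis using far[OF xy(1,3), of p] Lag_nonneg[of y w] e by simp
    qed
  qed
  then show ?thesis using d(1) by blast
qed

lemma Lag_continuous: "continuous_on UNIV (\<lambda>(x, v). Lag x v)"
  unfolding continuous_on_iff
proof (intro ballI allI impI)
  fix z :: "'a \<times> 'a" and e :: real assume e: "e > 0"
  obtain x v where z: "z = (x, v)" by (cases z) blast
  define R where "R = norm x + norm v + 1"
  obtain d where d: "d > 0" "\<And>x y v w. x \<in> cball 0 R \<Longrightarrow> y \<in> cball 0 R \<Longrightarrow> v \<in> cball 0 R \<Longrightarrow> w \<in> cball 0 R \<Longrightarrow>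
     dist x y < d \<Longrightarrow> dist v w < d \<Longrightarrow> Lag x v \<le> Lag y w + e / 2"
    using Lag_uniform[of "e / 2" R] e by auto
  have "dist (Lag y w) (Lag x v) < e" if yw: "dist (y, w) z < min d 1" for y w
  proof -
    have dd: "dist y x < d" "dist w v < d" "dist y x < 1" "dist w v < 1"
      using yw dist_fst_le[of "(y, w)" z] dist_snd_le[of "(y, w)" z] by (auto simp: z)
    have "norm y \<le> norm x + dist y x" "norm w \<le> norm v + dist w v" by (simp_all add: dist_norm norm_triangle_sub)
    then have "norm x \<le> R \<and> norm v \<le> R \<and> norm y \<le> R \<and> norm w \<le> R"
      using dd norm_ge_zero[of x] norm_ge_zero[of v] unfolding R_def by linarith
    then have "x \<in> cball 0 R" "v \<in> cball 0 R" "y \<in> cball 0 R" "w \<in> cball 0 R" by auto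
    then have "Lag x v \<le> Lag y w + e / 2" "Lag y w \<le> Lag x v + e / 2"
      using dd by (auto intro!: d(2) simp: dist_commute)
    then show ?thesis using e by (simp add: dist_real_def abs_if)
  qed
  then show "\<exists>d>0. \<forall>x'\<in>UNIV. dist x' z < d \<longrightarrow> dist (case x' of (x, v) \<Rightarrow> Lag x v) (case z of (x, v) \<Rightarrow> Lag x v) < e"
    using d(1) by (intro exI[of _ "min d 1"]) (auto simp: z)
qed

definition cost :: "(real \<Rightarrow> 'a) \<Rightarrow> real \<Rightarrow> real" where
  "cost \<gamma> s = Lag (\<gamma> s) (vector_derivative \<gamma> (at s))"

text \<open>What the iterated integral becomes after the order of integration is exchanged: the cost
  is weighted by the tail mass \<open>exp (- s / lam)\<close> of the exponential law, whereas
  \<open>h\<close> keeps its density and hence the factor \<open>1 / lam\<close>.\<close>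

definition running :: "real \<Rightarrow> ('a \<Rightarrow> real) \<Rightarrow> (real \<Rightarrow> 'a) \<Rightarrow> real \<Rightarrow> real" where
  "running lam h \<gamma> s = exp (- s / lam) * (h (\<gamma> s) / lam - cost \<gamma> s)"

text \<open>A payoff of minus infinity is represented by the absence of a value, so that all later
  estimates concern real numbers.\<close>

definition has_value :: "real \<Rightarrow> ('a \<Rightarrow> real) \<Rightarrow> (real \<Rightarrow> 'a) \<Rightarrow> real \<Rightarrow> bool" where
  "has_value lam h \<gamma> j \<longleftrightarrow> (\<forall>T\<ge>0. running lam h \<gamma> integrable_on {0..T}) \<and>
     ((\<lambda>T. integral {0..T} (running lam h \<gamma>)) \<longlongrightarrow> j) at_top"

lemma cost_nonneg: "cost \<gamma> s \<ge> 0"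
  by (simp add: cost_def Lag_nonneg)

lemma cost_measurable:
  assumes \<gamma>: "\<gamma> \<in> AC_paths" and T: "T \<ge> 0"
  shows "cost \<gamma> \<in> borel_measurable (lebesgue_on {0..T})"
proof -
  have "\<gamma> \<in> borel_measurable (lebesgue_on {0..T})"
    by (intro continuous_imp_measurable_on_sets_lebesgue continuous_on_subset[OF AC_path_FTC(1)[OF \<gamma>]]) auto
  then have "(\<lambda>s. (\<gamma> s, vector_derivative \<gamma> (at s))) \<in> borel_measurable (lebesgue_on {0..T})"
    by (intro borel_measurable_Pair AC_path_derivative_measurable assms)
  moreover have "(\<lambda>(x, v). Lag x v) \<in> borel_measurable borel"
    by (rule borel_measurable_continuous_onI[OF Lag_continuous])
  ultimately have "(\<lambda>s. (\<lambda>(x, v). Lag x v) (\<gamma> s, vector_derivative \<gamma> (at s))) \<in> borel_measurable (lebesgue_on {0..T})"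
    by (rule measurable_compose)
  then show ?thesis by (simp add: cost_def[abs_def])
qed

lemma cost_measurable_halfline:
  assumes \<gamma>: "\<gamma> \<in> AC_paths"
  shows "(\<lambda>s. cost \<gamma> s * indicator {0..} s) \<in> borel_measurable lebesgue"
proof (rule borel_measurable_LIMSEQ_real)
  fix n :: nat
  have "(\<lambda>s. if s \<in> {0..real n} then cost \<gamma> s else 0) \<in> borel_measurable lebesgue"
    by (intro borel_measurable_if_I cost_measurable \<gamma>) auto
  moreover have "(\<lambda>s. cost \<gamma> s * indicator {0..real n} s) = (\<lambda>s. if s \<in> {0..real n} then cost \<gamma> s else 0)"
    by (auto simp: indicator_def)
  ultimately show "(\<lambda>s. cost \<gamma> s * indicator {0..real n} s) \<in> borel_measurable lebesgue" by simp
next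
  fix s :: real
  obtain m :: nat where m: "s \<le> real m" using real_arch_simple by blast
  have "\<forall>\<^sub>F n in sequentially. cost \<gamma> s * indicator {0..} s = cost \<gamma> s * indicator {0..real n} s"
    using eventually_ge_at_top[of m] by eventually_elim (use m in \<open>auto simp: indicator_def\<close>)
  then show "(\<lambda>n. cost \<gamma> s * indicator {0..real n} s) \<longlonglongrightarrow> cost \<gamma> s * indicator {0..} s"
    by (rule Lim_transform_eventually[OF tendsto_const])
qed

lemma has_value_unique: "has_value lam h \<gamma> j \<Longrightarrow> has_value lam h \<gamma> j' \<Longrightarrow> j = j'"
  unfolding has_value_def by (metis tendsto_unique trivial_limit_at_top_linorder)

end

section \<open>Exchanging the integrations in the payoff\<close>

lemma nn_integral_exponential_tail:
  assumes lam: "lam > 0" and s: "s \<ge> 0"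
  shows "(\<integral>\<^sup>+t. ennreal (inverse lam * exp (- inverse lam * t)) * indicator {s..} t \<partial>lborel) = ennreal (exp (- inverse lam * s))"
proof -
  have lim: "((\<lambda>t. - exp (- inverse lam * t)) \<longlongrightarrow> - 0) at_top"
  proof (intro tendsto_minus filterlim_compose[OF exp_at_bot])
    show "filterlim (\<lambda>t. - inverse lam * t) at_bot at_top"
      using lam by (intro filterlim_tendsto_neg_mult_at_bot[OF tendsto_const _ filterlim_ident]) auto
  qed
  have "(\<integral>\<^sup>+t. ennreal (inverse lam * exp (- inverse lam * t)) * indicator {s..} t \<partial>lborel) = ennreal (0 - - exp (- inverse lam * s))"
    by (rule nn_integral_FTC_atLeast[where F="\<lambda>t. - exp (- inverse lam * t)"])
       (use lam lim in \<open>auto intro!: derivative_eq_intros\<close>)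
  then show ?thesis by simp
qed

text \<open>Tonelli on the triangle \<open>0 \<le> s \<le> t\<close>; integrating out
  \<open>t\<close> leaves the exponential tail from \<open>s\<close> on.\<close>

lemma nn_integral_discounted_swap:
  fixes k :: "real \<Rightarrow> real"
  assumes lam: "lam > 0" and k[measurable]: "k \<in> borel_measurable borel"
  shows "(\<integral>\<^sup>+t. (ennreal (inverse lam * exp (- inverse lam * t)) * (\<integral>\<^sup>+s. ennreal (k s) * indicator {0..t} s \<partial>lborel)) * indicator {0..} t \<partial>lborel)
     = (\<integral>\<^sup>+s. ennreal (exp (- inverse lam * s)) * ennreal (k s) * indicator {0..} s \<partial>lborel)"
proof -
  let ?c = "\<lambda>t. ennreal (inverse lam * exp (- inverse lam * t))"
  define F where "F t s = (if 0 \<le> s \<and> s \<le> t then ?c t * ennreal (k s) else 0)" for t s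
  have [measurable]: "(\<lambda>(t, s). F t s) \<in> borel_measurable (lborel \<Otimes>\<^sub>M lborel)"
    unfolding F_def by measurable
  have 1: "(?c t * (\<integral>\<^sup>+s. ennreal (k s) * indicator {0..t} s \<partial>lborel)) * indicator {0..} t = (\<integral>\<^sup>+s. F t s \<partial>lborel)" for t
  proof (cases "t \<ge> 0")
    case True
    have "(?c t * (\<integral>\<^sup>+s. ennreal (k s) * indicator {0..t} s \<partial>lborel)) = (\<integral>\<^sup>+s. ?c t * (ennreal (k s) * indicator {0..t} s) \<partial>lborel)"
      by (rule nn_integral_cmult[symmetric]) measurable
    also have "\<dots> = (\<integral>\<^sup>+s. F t s \<partial>lborel)" by (rule nn_integral_cong) (auto simp: F_def indicator_def)
    finally show ?thesis using True by simp
  next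
    case False
    then have "F t s = 0" for s by (auto simp: F_def)
    then show ?thesis using False by simp
  qed
  have 2: "(\<integral>\<^sup>+t. F t s \<partial>lborel) = ennreal (exp (- inverse lam * s)) * ennreal (k s) * indicator {0..} s" for s
  proof (cases "s \<ge> 0")
    case True
    have "(\<integral>\<^sup>+t. F t s \<partial>lborel) = (\<integral>\<^sup>+t. ?c t * indicator {s..} t * ennreal (k s) \<partial>lborel)"
      by (rule nn_integral_cong) (use True in \<open>auto simp: F_def indicator_def\<close>)
    also have "\<dots> = (\<integral>\<^sup>+t. ?c t * indicator {s..} t \<partial>lborel) * ennreal (k s)"
      by (rule nn_integral_multc) measurable
    finally show ?thesis using nn_integral_exponential_tail[OF lam True] True by simp
  next
    case False
    then have "F t s = 0" for t by (auto simp: F_def)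
    then show ?thesis using False by simp
  qed
  have "(\<integral>\<^sup>+t. \<integral>\<^sup>+s. F t s \<partial>lborel \<partial>lborel) = (\<integral>\<^sup>+s. \<integral>\<^sup>+t. F t s \<partial>lborel \<partial>lborel)"
    by (rule lborel_pair.Fubini') measurable
  then show ?thesis by (simp only: 1 2)
qed

text \<open>The cost along a path is only Lebesgue measurable, since derivatives are controlled up
  to null sets. The exchange of integrations is carried out for a Borel version.\<close>

lemma AE_lborel_borel_modification:
  fixes g :: "real \<Rightarrow> real"
  assumes g: "g \<in> borel_measurable lebesgue" "\<And>s. g s \<ge> 0"
  obtains k where "k \<in> borel_measurable borel" "\<And>s. k s \<ge> 0" "AE s in lborel. g s = k s"
proof -
  obtain k where k: "k \<in> borel_measurable lborel" "AE s in lborel. g s = k s"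
    using completion_ex_borel_measurable_real[OF g(1)] by blast
  have "AE s in lborel. g s = max 0 (k s)" using k(2)
  proof eventually_elim
    case (elim s)
    then show ?case using g(2)[of s] by simp
  qed
  then show thesis using k(1) that[of "\<lambda>s. max 0 (k s)"] by simp
qed

text \<open>The decomposition of \<open>c * (\<eta> - x)\<close> into positive and negative part,
  rearranged so that only nonnegative terms are added. In this form it remains true, and integrable
  term by term, when \<open>x\<close> is infinite.\<close>

lemma positive_negative_part_balance:
  assumes c: "c > 0" and \<eta>: "\<bar>\<eta>\<bar> \<le> B"
  shows "e2ennreal (ereal c * (ereal \<eta> - enn2ereal x)) + (ennreal c * x + ennreal (c * (B - \<eta>)))
    = e2ennreal (- (ereal c * (ereal \<eta> - enn2ereal x))) + ennreal (c * B)"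
proof (cases x rule: ennreal_cases)
  case (real y)
  have e: "ereal c * (ereal \<eta> - enn2ereal x) = ereal (c * (\<eta> - y))" using real by simp
  have cy: "ennreal c * x = ennreal (c * y)" using real c by (simp add: ennreal_mult)
  have nn: "0 \<le> c * y" "0 \<le> c * (B - \<eta>)" using real c \<eta> by auto
  show ?thesis
  proof (cases "\<eta> \<ge> y")
    case True
    then have "e2ennreal (- ereal (c * (\<eta> - y))) = 0" using c by (intro e2ennreal_neg) auto
    moreover have "0 \<le> c * (\<eta> - y)" using True c by simp
    moreover have "c * (\<eta> - y) + (c * y + c * (B - \<eta>)) = c * B" by (simp add: algebra_simps)
    ultimately show ?thesis unfolding e cy e2ennreal_ereal using nn by (simp flip: ennreal_plus)
  next
    case False
    then have "e2ennreal (ereal (c * (\<eta> - y))) = 0" using c by (intro e2ennreal_neg) (simp add: mult_le_0_iff)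
    moreover have "0 \<le> c * (y - \<eta>)" "0 \<le> c * B" using False c \<eta> by auto
    moreover have "- ereal (c * (\<eta> - y)) = ereal (c * (y - \<eta>))" by (simp add: algebra_simps)
    moreover have "c * y + c * (B - \<eta>) = c * (y - \<eta>) + c * B" by (simp add: algebra_simps)
    ultimately show ?thesis unfolding e cy using nn by (simp flip: ennreal_plus)
  qed
next
  case top
  then show ?thesis using c by (simp add: ennreal_mult_top e2ennreal_infty)
qed

context coercive_hamiltonian
begin

text \<open>The alternative is decided by the total discounted cost \<open>K\<close>. The positive
  part of the integrand has integral at most \<open>B\<close>, so the extended integral is never a
  difference of infinities.\<close>

theorem discounted_functional_cases:
  assumes \<gamma>: "\<gamma> \<in> AC_paths" and h: "continuous_on UNIV h" "\<And>x. \<bar>h x\<bar> \<le> B" and lam: "lam > 0"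
  defines "E \<equiv> ereal_integral {0..} (\<lambda>t. ereal (inverse lam * exp (- inverse lam * t)) *
          (ereal (h (\<gamma> t)) - ereal_integral {0..t} (\<lambda>s. ereal (cost \<gamma> s))))"
  shows "(\<exists>j. has_value lam h \<gamma> j \<and> E = ereal j) \<or> ((\<nexists>j. has_value lam h \<gamma> j) \<and> E = - \<infinity>)"
proof -
  let ?c = "\<lambda>t. inverse lam * exp (- inverse lam * t)"
  let ?e = "\<lambda>t. exp (- inverse lam * t)"
  have c: "?c t > 0" for t using lam by simp
  have B0: "B \<ge> 0" using h(2)[of undefined] by linarith
  define g where "g s = cost \<gamma> s * indicator {0..} s" for s
  have g: "g \<in> borel_measurable lebesgue" "g s \<ge> 0" for s
    using cost_measurable_halfline[OF \<gamma>] cost_nonneg by (auto simp: g_def[abs_def])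
  obtain k where k[measurable]: "k \<in> borel_measurable borel" and k0: "\<And>s. k s \<ge> 0" and gk: "AE s in lborel. g s = k s"
    using AE_lborel_borel_modification[OF g] by blast
  define n where "n t = (\<integral>\<^sup>+s. ennreal (k s) * indicator {0..t} s \<partial>lborel)" for t
  have inner: "ereal_integral {0..t} (\<lambda>s. ereal (cost \<gamma> s)) = enn2ereal (n t)" for t
  proof -
    have "(\<integral>\<^sup>+s. e2ennreal (ereal (cost \<gamma> s)) * indicator {0..t} s \<partial>lborel) = n t"
      unfolding n_def
    proof (rule nn_integral_cong_AE, use gk in eventually_elim)
      case (elim s)
      then show ?case by (auto simp: g_def indicator_def)
    qed
    moreover have "e2ennreal (- ereal (cost \<gamma> s)) = 0" for s
      using cost_nonneg[of \<gamma> s] by (intro e2ennreal_neg) simp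
    ultimately show ?thesis by (simp add: ereal_integral_def zero_ennreal.rep_eq)
  qed
  \<comment> \<open>Extended constantly to negative times, so that it is continuous, hence Borel, on
    the whole line.\<close>
  define \<eta> where "\<eta> t = h (\<gamma> (max 0 t))" for t :: real
  have "continuous_on UNIV \<eta>" unfolding \<eta>_def
    by (rule continuous_on_compose2[OF h(1)], rule continuous_on_compose2[OF AC_path_FTC(1)[OF \<gamma>]]) (auto intro!: continuous_intros)
  then have \<eta>[measurable]: "\<eta> \<in> borel_measurable borel" by (rule borel_measurable_continuous_onI)
  have \<eta>B: "\<bar>\<eta> t\<bar> \<le> B" for t by (simp add: \<eta>_def h(2))
  have n[measurable]: "n \<in> borel_measurable borel"
  proof -
    have "(\<lambda>t. \<integral>\<^sup>+s. (if 0 \<le> s \<and> s \<le> t then ennreal (k s) else 0) \<partial>lborel) \<in> borel_measurable borel"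
      by measurable
    moreover have "n = (\<lambda>t. \<integral>\<^sup>+s. (if 0 \<le> s \<and> s \<le> t then ennreal (k s) else 0) \<partial>lborel)"
      unfolding n_def by (intro ext nn_integral_cong) (auto simp: indicator_def)
    ultimately show ?thesis by simp
  qed
  define f where "f t = ereal (?c t) * (ereal (\<eta> t) - enn2ereal (n t))" for t
  have f[measurable]: "f \<in> borel_measurable borel" unfolding f_def by measurable
  define P where "P = (\<integral>\<^sup>+t. e2ennreal (f t) * indicator {0..} t \<partial>lborel)"
  define Q where "Q = (\<integral>\<^sup>+t. e2ennreal (- f t) * indicator {0..} t \<partial>lborel)"
  define K where "K = (\<integral>\<^sup>+t. (ennreal (?c t) * n t) * indicator {0..} t \<partial>lborel)"
  define \<Theta> where "\<Theta> = (\<integral>\<^sup>+t. ennreal (?c t * (B - \<eta> t)) * indicator {0..} t \<partial>lborel)"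
  have cB: "(\<integral>\<^sup>+t. ennreal (?c t * b) * indicator {0..} t \<partial>lborel) = ennreal b" if "b \<ge> 0" for b
  proof -
    have "(\<integral>\<^sup>+t. ennreal (?c t * b) * indicator {0..} t \<partial>lborel) = (\<integral>\<^sup>+t. (ennreal (?c t) * indicator {0..} t) * ennreal b \<partial>lborel)"
      using c that by (intro nn_integral_cong) (auto simp: ennreal_mult less_imp_le indicator_def)
    also have "\<dots> = (\<integral>\<^sup>+t. ennreal (?c t) * indicator {0..} t \<partial>lborel) * ennreal b"
      by (rule nn_integral_multc) measurable
    finally show ?thesis using nn_integral_exponential_tail[OF lam order_refl] by simp
  qed
  have E: "E = enn2ereal P - enn2ereal Q"
  proof -
    have "(\<integral>\<^sup>+t. e2ennreal (ereal (?c t) * (ereal (h (\<gamma> t)) - enn2ereal (n t))) * indicator {0..} t \<partial>lborel) = P"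
      "(\<integral>\<^sup>+t. e2ennreal (- (ereal (?c t) * (ereal (h (\<gamma> t)) - enn2ereal (n t)))) * indicator {0..} t \<partial>lborel) = Q"
      unfolding P_def Q_def f_def \<eta>_def by (auto intro!: nn_integral_cong simp: indicator_def max_def)
    moreover have "E = ereal_integral {0..} (\<lambda>t. ereal (?c t) * (ereal (h (\<gamma> t)) - enn2ereal (n t)))"
      unfolding E_def inner ..
    ultimately show ?thesis by (simp only: ereal_integral_def)
  qed
  \<comment> \<open>As \<open>P\<close> and \<open>\<Theta>\<close> are finite, this identity makes
    \<open>Q\<close> infinite exactly when \<open>K\<close> is.\<close>
  have bal: "P + (K + \<Theta>) = Q + ennreal B"
  proof -
    have "P + (K + \<Theta>) = (\<integral>\<^sup>+t. e2ennreal (f t) * indicator {0..} t + ((ennreal (?c t) * n t) * indicator {0..} t + ennreal (?c t * (B - \<eta> t)) * indicator {0..} t) \<partial>lborel)"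
    proof -
      have m: "(\<lambda>t. u t * indicator {0..} t) \<in> borel_measurable lborel" if "u \<in> borel_measurable borel" for u :: "real \<Rightarrow> ennreal"
        using that by (intro borel_measurable_times_ennreal borel_measurable_indicator) auto
      have m1: "(\<lambda>t. e2ennreal (f t) * indicator {0..} t) \<in> borel_measurable lborel" by (rule m) measurable
      have m2: "(\<lambda>t. (ennreal (?c t) * n t) * indicator {0..} t) \<in> borel_measurable lborel" by (rule m) measurable
      have m3: "(\<lambda>t. ennreal (?c t * (B - \<eta> t)) * indicator {0..} t) \<in> borel_measurable lborel" by (rule m) measurable
      show ?thesis
        unfolding P_def K_def \<Theta>_def nn_integral_add[OF m1 borel_measurable_add[OF m2 m3]] nn_integral_add[OF m2 m3] ..
    qed
    also have "\<dots> = (\<integral>\<^sup>+t. e2ennreal (- f t) * indicator {0..} t + ennreal (?c t * B) * indicator {0..} t \<partial>lborel)"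
    proof (rule nn_integral_cong)
      fix t :: real
      show "e2ennreal (f t) * indicator {0..} t + ((ennreal (?c t) * n t) * indicator {0..} t + ennreal (?c t * (B - \<eta> t)) * indicator {0..} t)
        = e2ennreal (- f t) * indicator {0..} t + ennreal (?c t * B) * indicator {0..} t"
        using positive_negative_part_balance[OF c[of t] \<eta>B[of t], of "n t"] by (cases "t \<ge> 0") (auto simp: f_def)
    qed
    also have "\<dots> = Q + ennreal B"
      unfolding Q_def cB[OF B0, symmetric] by (rule nn_integral_add) measurable
    finally show ?thesis .
  qed
  have P: "P \<le> ennreal B"
  proof -
    have "e2ennreal (f t) \<le> ennreal (?c t * B)" for t
    proof -
      have "ereal (\<eta> t) - enn2ereal (n t) \<le> ereal B"
        using \<eta>B[of t] by (cases "n t" rule: ennreal_cases) (auto simp: abs_le_iff)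
      then have "f t \<le> ereal (?c t) * ereal B"
        unfolding f_def using c[of t] by (intro ereal_mult_left_mono) auto
      then have "e2ennreal (f t) \<le> e2ennreal (ereal (?c t * B))" by (intro e2ennreal_mono) simp
      then show ?thesis by simp
    qed
    then have "P \<le> (\<integral>\<^sup>+t. ennreal (?c t * B) * indicator {0..} t \<partial>lborel)"
      unfolding P_def by (intro nn_integral_mono mult_right_mono) auto
    then show ?thesis using cB[OF B0] by simp
  qed
  have \<Theta>: "\<Theta> \<le> ennreal (2 * B)"
  proof -
    have "\<Theta> \<le> (\<integral>\<^sup>+t. ennreal (?c t * (2 * B)) * indicator {0..} t \<partial>lborel)"
      unfolding \<Theta>_def
    proof (intro nn_integral_mono mult_right_mono ennreal_leI mult_left_mono)
      show "B - \<eta> t \<le> 2 * B" for t using \<eta>B[of t] by (simp add: abs_le_iff)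
    qed (use c in \<open>auto intro: less_imp_le\<close>)
    then show ?thesis using cB[of "2 * B"] B0 by simp
  qed
  obtain p where p: "P = ennreal p" "p \<ge> 0" using P by (cases P rule: ennreal_cases) (auto simp: top_unique)
  obtain \<theta> where \<theta>: "\<Theta> = ennreal \<theta>" "\<theta> \<ge> 0" using \<Theta> by (cases \<Theta> rule: ennreal_cases) (auto simp: top_unique)
  have K: "K = (\<integral>\<^sup>+s. ennreal ((?e s * cost \<gamma> s) * indicator {0..} s) \<partial>lebesgue)"
  proof -
    have "K = (\<integral>\<^sup>+s. ennreal (?e s) * ennreal (k s) * indicator {0..} s \<partial>lborel)"
      unfolding K_def n_def by (rule nn_integral_discounted_swap[OF lam k])
    also have "\<dots> = (\<integral>\<^sup>+s. ennreal ((?e s * cost \<gamma> s) * indicator {0..} s) \<partial>lborel)"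
    proof (rule nn_integral_cong_AE, use gk in eventually_elim)
      case (elim s)
      then show ?case using cost_nonneg[of \<gamma> s] by (auto simp: g_def indicator_def ennreal_mult)
    qed
    finally show ?thesis by (simp add: nn_integral_completion)
  qed
  have e_eq: "?e s = exp (- s / lam)" for s by (simp add: field_simps)
  have run: "running lam h \<gamma> s = ?c s * B - ?c s * (B - \<eta> s) - ?e s * cost \<gamma> s" if "s \<ge> 0" for s
    using that by (simp add: running_def e_eq[symmetric] \<eta>_def divide_inverse algebra_simps)
  have cint: "(\<lambda>s. ?c s * B) integrable_on {0..T}" "(\<lambda>s. ?c s * (B - \<eta> s)) integrable_on {0..T}" for T
    by (intro integrable_continuous_real continuous_intros continuous_on_subset[OF \<open>continuous_on UNIV \<eta>\<close>]; simp)+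
  have tB: "((\<lambda>T. integral {0..T} (\<lambda>s. ?c s * B)) \<longlongrightarrow> B) at_top"
  proof (rule nn_integral_halfline_tendsto)
    have "(\<lambda>s. ?c s * B * indicator {0..} s) \<in> borel_measurable lborel" by measurable
    then show "(\<lambda>s. ?c s * B * indicator {0..} s) \<in> borel_measurable lebesgue" by (rule measurable_completion)
    show "?c s * B \<ge> 0" for s using c[of s] B0 by simp
    show "(\<integral>\<^sup>+s. ennreal (?c s * B * indicator {0..} s) \<partial>lebesgue) = ennreal B"
      unfolding cB[OF B0, symmetric] nn_integral_completion by (intro nn_integral_cong) (auto simp: indicator_def)
  qed (rule B0)
  have t\<Theta>: "((\<lambda>T. integral {0..T} (\<lambda>s. ?c s * (B - \<eta> s))) \<longlongrightarrow> \<theta>) at_top"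
  proof (rule nn_integral_halfline_tendsto)
    have "(\<lambda>s. ?c s * (B - \<eta> s) * indicator {0..} s) \<in> borel_measurable lborel" by measurable
    then show "(\<lambda>s. ?c s * (B - \<eta> s) * indicator {0..} s) \<in> borel_measurable lebesgue" by (rule measurable_completion)
    show "?c s * (B - \<eta> s) \<ge> 0" for s using c[of s] \<eta>B[of s] by (simp add: abs_le_iff)
    show "(\<integral>\<^sup>+s. ennreal (?c s * (B - \<eta> s) * indicator {0..} s) \<partial>lebesgue) = ennreal \<theta>"
      unfolding \<theta>(1)[symmetric] \<Theta>_def nn_integral_completion by (intro nn_integral_cong) (auto simp: indicator_def)
  qed fact
  show ?thesis
  proof (cases K rule: ennreal_cases)
    case (real q)
    have meas: "(\<lambda>s. (?e s * cost \<gamma> s) * indicator {0..} s) \<in> borel_measurable lebesgue"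
    proof -
      have "(\<lambda>s. ?e s) \<in> borel_measurable lborel" by measurable
      then have "(\<lambda>s. ?e s) \<in> borel_measurable lebesgue" by (rule measurable_completion)
      from borel_measurable_times[OF this cost_measurable_halfline[OF \<gamma>]] show ?thesis by (simp add: mult.assoc)
    qed
    have en: "0 \<le> ?e s * cost \<gamma> s" for s using cost_nonneg by simp
    note eK = nn_integral_halfline_tendsto[OF en meas K[symmetric, unfolded real(2)] real(1)]
    have int: "running lam h \<gamma> integrable_on {0..T}" and
      eq: "integral {0..T} (running lam h \<gamma>) = integral {0..T} (\<lambda>s. ?c s * B) - integral {0..T} (\<lambda>s. ?c s * (B - \<eta> s)) - integral {0..T} (\<lambda>s. ?e s * cost \<gamma> s)" for T
    proof -
      have "((\<lambda>s. ?c s * B - ?c s * (B - \<eta> s) - ?e s * cost \<gamma> s) has_integral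
        (integral {0..T} (\<lambda>s. ?c s * B) - integral {0..T} (\<lambda>s. ?c s * (B - \<eta> s)) - integral {0..T} (\<lambda>s. ?e s * cost \<gamma> s))) {0..T}"
        by (intro has_integral_diff integrable_integral cint eK(1))
      then have "(running lam h \<gamma> has_integral
        (integral {0..T} (\<lambda>s. ?c s * B) - integral {0..T} (\<lambda>s. ?c s * (B - \<eta> s)) - integral {0..T} (\<lambda>s. ?e s * cost \<gamma> s))) {0..T}"
        by (rule has_integral_eq[rotated]) (simp add: run)
      then show "running lam h \<gamma> integrable_on {0..T}" and
        "integral {0..T} (running lam h \<gamma>) = integral {0..T} (\<lambda>s. ?c s * B) - integral {0..T} (\<lambda>s. ?c s * (B - \<eta> s)) - integral {0..T} (\<lambda>s. ?e s * cost \<gamma> s)"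
        by (auto simp: integrable_on_def integral_unique)
    qed
    have "((\<lambda>T. integral {0..T} (running lam h \<gamma>)) \<longlongrightarrow> B - \<theta> - q) at_top"
      unfolding eq by (intro tendsto_diff tB t\<Theta> eK(2))
    then have "has_value lam h \<gamma> (B - \<theta> - q)" unfolding has_value_def using int by blast
    moreover have "E = ereal (B - \<theta> - q)"
    proof -
      have fin: "ennreal (p + (q + \<theta>)) = Q + ennreal B" using bal p \<theta> real by simp
      have "Q \<noteq> top"
      proof
        assume "Q = top"
        then have "ennreal (p + (q + \<theta>)) = top" using fin by simp
        then show False by simp
      qed
      then obtain z where z: "Q = ennreal z" "z \<ge> 0" by (cases Q rule: ennreal_cases) auto
      have "ennreal (p + (q + \<theta>)) = ennreal (z + B)" using fin z B0 by simp
      then have "p + (q + \<theta>) = z + B" using p \<theta> real z B0 by (subst (asm) ennreal_inj) auto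
      then show ?thesis unfolding E p z using p(2) z(2) by (simp add: algebra_simps)
    qed
    ultimately show ?thesis by blast
  next
    case top
    have "Q = top"
    proof -
      have "Q + ennreal B = top" using bal top by simp
      then show ?thesis by (simp add: ennreal_add_eq_top)
    qed
    then have "E = - \<infinity>" unfolding E p using p(2) by simp
    \<comment> \<open>A limit for the integrals of \<open>running\<close> would bound the discounted
      cost on all intervals \<open>{0..T}\<close> and so make \<open>K\<close> finite.\<close>
    moreover have "\<not> has_value lam h \<gamma> j" for j
    proof
      assume hv: "has_value lam h \<gamma> j"
      have int: "(\<lambda>s. ?e s * cost \<gamma> s) integrable_on {0..T}" and
        eq: "integral {0..T} (\<lambda>s. ?e s * cost \<gamma> s) = integral {0..T} (\<lambda>s. ?c s * B) - integral {0..T} (\<lambda>s. ?c s * (B - \<eta> s)) - integral {0..T} (running lam h \<gamma>)"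
        if "T \<ge> 0" for T
      proof -
        have "running lam h \<gamma> integrable_on {0..T}" using hv that by (simp add: has_value_def)
        then have "((\<lambda>s. ?c s * B - ?c s * (B - \<eta> s) - running lam h \<gamma> s) has_integral
          (integral {0..T} (\<lambda>s. ?c s * B) - integral {0..T} (\<lambda>s. ?c s * (B - \<eta> s)) - integral {0..T} (running lam h \<gamma>))) {0..T}"
          by (intro has_integral_diff integrable_integral cint)
        then have "((\<lambda>s. ?e s * cost \<gamma> s) has_integral
          (integral {0..T} (\<lambda>s. ?c s * B) - integral {0..T} (\<lambda>s. ?c s * (B - \<eta> s)) - integral {0..T} (running lam h \<gamma>))) {0..T}"
          by (rule has_integral_eq[rotated]) (simp add: run)
        then show "(\<lambda>s. ?e s * cost \<gamma> s) integrable_on {0..T}" and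
          "integral {0..T} (\<lambda>s. ?e s * cost \<gamma> s) = integral {0..T} (\<lambda>s. ?c s * B) - integral {0..T} (\<lambda>s. ?c s * (B - \<eta> s)) - integral {0..T} (running lam h \<gamma>)"
          by (auto simp: integrable_on_def integral_unique)
      qed
      have "((\<lambda>T. integral {0..T} (\<lambda>s. ?c s * B) - integral {0..T} (\<lambda>s. ?c s * (B - \<eta> s)) - integral {0..T} (running lam h \<gamma>)) \<longlongrightarrow> B - \<theta> - j) at_top"
        using hv unfolding has_value_def by (intro tendsto_diff tB t\<Theta>) blast
      then have "\<forall>\<^sub>F T in at_top. integral {0..T} (\<lambda>s. ?c s * B) - integral {0..T} (\<lambda>s. ?c s * (B - \<eta> s)) - integral {0..T} (running lam h \<gamma>) < B - \<theta> - j + 1"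
        by (rule order_tendstoD) simp
      then obtain T0 where T0: "\<And>T. T \<ge> T0 \<Longrightarrow> integral {0..T} (\<lambda>s. ?c s * B) - integral {0..T} (\<lambda>s. ?c s * (B - \<eta> s)) - integral {0..T} (running lam h \<gamma>) < B - \<theta> - j + 1"
        unfolding eventually_at_top_linorder by blast
      have bound: "integral {0..T} (\<lambda>s. ?e s * cost \<gamma> s) \<le> B - \<theta> - j + 1" if T: "T \<ge> 0" for T
      proof -
        have T': "max T T0 \<ge> 0" using T by simp
        have "integral {0..T} (\<lambda>s. ?e s * cost \<gamma> s) \<le> integral {0..max T T0} (\<lambda>s. ?e s * cost \<gamma> s)"
          using int[OF T] int[OF T'] cost_nonneg by (intro integral_subset_le) auto
        also have "\<dots> \<le> B - \<theta> - j + 1" unfolding eq[OF T'] using T0[of "max T T0"] by simp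
        finally show ?thesis .
      qed
      have "K \<le> ennreal (B - \<theta> - j + 1)"
        unfolding K by (rule nn_integral_halfline_le) (use int bound cost_nonneg in auto)
      then show False using top by (simp add: top_unique)
    qed
    ultimately show ?thesis by blast
  qed
qed

end

section \<open>Polygonal paths\<close>

lemma has_real_derivative_along_line:
  assumes "(F has_derivative (\<lambda>h. h \<bullet> D)) (at (y + s *\<^sub>R q))"
  shows "((\<lambda>s. F (y + s *\<^sub>R q)) has_real_derivative (q \<bullet> D)) (at s)"
proof -
  have "((\<lambda>s. y + s *\<^sub>R q) has_derivative (\<lambda>h. h *\<^sub>R q)) (at s)" by (auto intro!: derivative_eq_intros)
  from has_derivative_compose[OF this assms]
  have "((\<lambda>s. F (y + s *\<^sub>R q)) has_derivative (\<lambda>h. (h *\<^sub>R q) \<bullet> D)) (at s)" .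
  moreover have "(\<lambda>h. (h *\<^sub>R q) \<bullet> D) = (*) (q \<bullet> D)" by auto
  ultimately show ?thesis unfolding has_field_derivative_def by simp
qed

context coercive_hamiltonian
begin

lemma H_grad_continuous:
  assumes "f \<in> Ccc_smooth" shows "continuous_on UNIV (\<lambda>x. H x (grad f x))"
proof -
  have "continuous_on UNIV (\<lambda>x. (\<lambda>(x, p). H x p) (x, grad f x))"
    by (rule continuous_on_compose2[OF H_continuous])
       (auto intro!: continuous_intros Ccc_smooth_continuous_grad[OF assms])
  then show ?thesis by simp
qed

lemma H_grad_bounded:
  assumes f: "f \<in> Ccc_smooth"
  obtains C where "\<And>x. \<bar>H x (grad f x)\<bar> \<le> C"
proof -
  obtain K where K: "compact K" "\<And>x. x \<notin> K \<Longrightarrow> grad f x = 0" using Ccc_smooth_grad_zero[OF f] by blast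
  have "compact ((\<lambda>x. H x (grad f x)) ` K)"
    using K(1) H_grad_continuous[OF f] by (meson compact_continuous_image continuous_on_subset subset_UNIV)
  then obtain C where C: "\<forall>y\<in>(\<lambda>x. H x (grad f x)) ` K. norm y \<le> C" using compact_imp_bounded bounded_iff by blast
  have "\<bar>H x (grad f x)\<bar> \<le> max C 0" for x
    using C K(2)[of x] H_zero[of x] by (cases "x \<in> K") (auto simp: le_max_iff_disj)
  then show thesis using that by blast
qed

text \<open>The velocity \<open>q\<close> is an almost exact subgradient of \<open>H x\<close> at
  \<open>grad f x\<close>, kept frozen during the step. Four errors of \<open>e / 4\<close> arise:
  from the subgradient and from the changes of \<open>Lag\<close>, \<open>H\<close> and
  \<open>grad f\<close>. As \<open>q\<close> is bounded on the ball, one step length serves all its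
  points.\<close>

lemma euler_step:
  assumes f: "f \<in> Ccc_smooth" and e: "e > 0"
  shows "\<exists>\<tau>>0. \<tau> \<le> 1 \<and> (\<forall>x\<in>cball 0 r. \<exists>q. \<forall>s\<in>{0..\<tau>}.
    H (x + s *\<^sub>R q) (grad f (x + s *\<^sub>R q)) + Lag (x + s *\<^sub>R q) q - e \<le> q \<bullet> grad f (x + s *\<^sub>R q))"
proof -
  obtain G where G: "\<And>x. norm (grad f x) \<le> G" by (rule Ccc_smooth_Lipschitz[OF f]) (rule that)
  obtain Q0 where Q0: "\<And>x p e. x \<in> cball 0 (max r G) \<Longrightarrow> p \<in> cball 0 (max r G) \<Longrightarrow> e > 0 \<Longrightarrow>
     \<exists>q. norm q \<le> Q0 \<and> (\<forall>p'. H x p + q \<bullet> (p' - p) - e \<le> H x p')"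
    using H_subgradient[OF compact_cball[of 0 "max r G"]] by metis
  define Q where "Q = max Q0 0"
  have Q: "Q \<ge> 0" "Q0 \<le> Q" by (auto simp: Q_def)
  \<comment> \<open>Steps last at most time 1 at speed at most \<open>Q\<close>, so they stay in
    this larger ball, which also contains the velocities.\<close>
  define R where "R = \<bar>r\<bar> + Q"
  obtain d1 where d1: "d1 > 0" "\<And>x y v w. x \<in> cball 0 R \<Longrightarrow> y \<in> cball 0 R \<Longrightarrow> v \<in> cball 0 R \<Longrightarrow> w \<in> cball 0 R \<Longrightarrow>
     dist x y < d1 \<Longrightarrow> dist v w < d1 \<Longrightarrow> Lag x v \<le> Lag y w + e / 4"
    using Lag_uniform[of "e / 4" R] e by auto
  have uc: "\<exists>d>0. \<forall>x\<in>cball 0 R. \<forall>y\<in>cball 0 R. dist y x < d \<longrightarrow> dist (g y) (g x) < e'" if "continuous_on UNIV g" "e' > 0"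
    for g :: "'a \<Rightarrow> 'b::metric_space" and e'
    using compact_uniformly_continuous[OF continuous_on_subset[OF that(1) subset_UNIV] compact_cball[of 0 R]] that(2)
    unfolding uniformly_continuous_on_def by blast
  obtain d2 where d2: "d2 > 0" "\<And>x y. x \<in> cball 0 R \<Longrightarrow> y \<in> cball 0 R \<Longrightarrow> dist y x < d2 \<Longrightarrow> dist (H y (grad f y)) (H x (grad f x)) < e / 4"
    using uc[OF H_grad_continuous[OF f], of "e / 4"] e by auto
  \<comment> \<open>Tolerance for the gradient that, multiplied by the speed, costs at most
    \<open>e / 4\<close>.\<close>
  define \<kappa> where "\<kappa> = (e / 4) / (Q + 1)"
  have "Q + 1 > 0" using Q by simp
  then have Q1: "Q + 1 \<noteq> 0" and \<kappa>0: "\<kappa> > 0" using e by (auto simp: \<kappa>_def)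
  have "\<kappa> * (Q + 1) = e / 4" using nonzero_eq_divide_eq[OF Q1, of \<kappa> "e / 4"] \<kappa>_def by blast
  then have \<kappa>: "\<kappa> > 0" "(Q + 1) * \<kappa> = e / 4" using \<kappa>0 by (simp_all only: mult.commute)
  obtain d3 where d3: "d3 > 0" "\<And>x y. x \<in> cball 0 R \<Longrightarrow> y \<in> cball 0 R \<Longrightarrow> dist y x < d3 \<Longrightarrow> dist (grad f y) (grad f x) < \<kappa>"
    using uc[OF Ccc_smooth_continuous_grad[OF f] \<kappa>(1)] by auto
  define m where "m = min d1 (min d2 d3)"
  have m: "m > 0" using d1 d2 d3 by (simp add: m_def)
  define \<tau> where "\<tau> = min 1 (m / (Q + 1))"
  have \<tau>: "\<tau> > 0" "\<tau> \<le> 1" "\<tau> * Q < m"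
  proof -
    show "\<tau> > 0" "\<tau> \<le> 1" using m Q by (auto simp: \<tau>_def)
    then have "\<tau> * Q < \<tau> * (Q + 1)" by simp
    also have "\<dots> \<le> m / (Q + 1) * (Q + 1)" using Q by (intro mult_right_mono) (auto simp: \<tau>_def)
    finally show "\<tau> * Q < m" using Q by simp
  qed
  have "\<exists>q. \<forall>s\<in>{0..\<tau>}. H (x + s *\<^sub>R q) (grad f (x + s *\<^sub>R q)) + Lag (x + s *\<^sub>R q) q - e \<le> q \<bullet> grad f (x + s *\<^sub>R q)"
    if x: "x \<in> cball 0 r" for x
  proof -
    have xr: "norm x \<le> \<bar>r\<bar>" "x \<in> cball 0 (max r G)" "grad f x \<in> cball 0 (max r G)" using x G[of x] by auto
    obtain q where q: "norm q \<le> Q0" "\<And>p'. H x (grad f x) + q \<bullet> (p' - grad f x) - e / 4 \<le> H x p'"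
      using Q0[OF xr(2,3), of "e / 4"] e by auto
    have qQ: "norm q \<le> Q" using q(1) Q by linarith
    \<comment> \<open>Fenchel's equality up to \<open>e / 4\<close>, the subgradient inequality read
      as a bound on the Legendre transform.\<close>
    have fen: "H x (grad f x) + Lag x q \<le> q \<bullet> grad f x + e / 4"
    proof -
      have "Lag x q \<le> q \<bullet> grad f x - H x (grad f x) + e / 4"
      proof (rule Lag_least)
        fix p show "p \<bullet> q - H x p \<le> q \<bullet> grad f x - H x (grad f x) + e / 4"
          using q(2)[of p] by (simp add: inner_diff_right inner_commute)
      qed
      then show ?thesis by simp
    qed
    have "H (x + s *\<^sub>R q) (grad f (x + s *\<^sub>R q)) + Lag (x + s *\<^sub>R q) q - e \<le> q \<bullet> grad f (x + s *\<^sub>R q)" if s: "s \<in> {0..\<tau>}" for s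
    proof -
      let ?y = "x + s *\<^sub>R q"
      have "norm (s *\<^sub>R q) \<le> \<tau> * Q" using s qQ \<tau>(1) by (auto intro!: mult_mono)
      moreover have "\<tau> * Q \<le> 1 * Q" using \<tau> Q by (intro mult_right_mono) auto
      ultimately have "norm (s *\<^sub>R q) < m \<and> norm (s *\<^sub>R q) \<le> Q" using \<tau>(3) by linarith
      then have dy: "dist ?y x < m" and "norm ?y \<le> R" using norm_triangle_ineq[of x "s *\<^sub>R q"] xr(1) by (auto simp: R_def dist_norm)
      then have B: "?y \<in> cball 0 R" "x \<in> cball 0 R" "q \<in> cball 0 R" using xr(1) qQ Q(1) by (auto simp: R_def)
      have "Lag ?y q \<le> Lag x q + e / 4" using d1 dy B by (intro d1(2)) (auto simp: m_def)
      moreover have "H ?y (grad f ?y) \<le> H x (grad f x) + e / 4"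
      proof -
        have "dist (H ?y (grad f ?y)) (H x (grad f x)) < e / 4" using d2(2)[OF B(2,1)] dy by (simp add: m_def)
        then show ?thesis unfolding dist_real_def by linarith
      qed
      moreover have "q \<bullet> grad f x \<le> q \<bullet> grad f ?y + e / 4"
      proof -
        have "q \<bullet> (grad f x - grad f ?y) \<le> norm q * norm (grad f x - grad f ?y)" by (rule norm_cauchy_schwarz)
        also have "\<dots> \<le> (Q + 1) * \<kappa>"
          using qQ Q d3(2)[OF B(2,1)] dy by (intro mult_mono) (auto simp: m_def dist_norm norm_minus_commute)
        also have "\<dots> = e / 4" by (rule \<kappa>(2))
        finally show ?thesis by (simp add: inner_diff_right)
      qed
      ultimately show ?thesis using fen by linarith
    qed
    then show ?thesis by blast
  qed
  then show ?thesis using \<tau> by blast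
qed

text \<open>
  An infinite polygon whose velocities are nearly optimal for the momentum \<open>grad f\<close>. The Lyapunov
  function keeps its vertices bounded on bounded time intervals, so the step lengths cannot shrink
  to zero there.
\<close>

lemma euler_path:
  assumes f: "f \<in> Ccc_smooth" and e: "e > 0"
  obtains \<gamma> N where "\<gamma> \<in> AC_paths" "\<gamma> 0 = x" "negligible N"
    "\<And>s. s \<ge> 0 \<Longrightarrow> s \<notin> N \<Longrightarrow> H (\<gamma> s) (grad f (\<gamma> s)) + cost \<gamma> s - e \<le> vector_derivative \<gamma> (at s) \<bullet> grad f (\<gamma> s)"
proof -
  have "\<forall>k::nat. \<exists>\<tau>>0. \<tau> \<le> 1 \<and> (\<forall>x\<in>cball 0 (real k). \<exists>q. \<forall>s\<in>{0..\<tau>}.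
    H (x + s *\<^sub>R q) (grad f (x + s *\<^sub>R q)) + Lag (x + s *\<^sub>R q) q - e \<le> q \<bullet> grad f (x + s *\<^sub>R q))"
    using euler_step[OF f e] by blast
  then obtain \<tau> where \<tau>: "\<And>k::nat. \<tau> k > 0" "\<And>k x. x \<in> cball 0 (real k) \<Longrightarrow> \<exists>q. \<forall>s\<in>{0..\<tau> k}.
    H (x + s *\<^sub>R q) (grad f (x + s *\<^sub>R q)) + Lag (x + s *\<^sub>R q) q - e \<le> q \<bullet> grad f (x + s *\<^sub>R q)"
    by metis
  \<comment> \<open>Rounding the norm up selects a ball containing \<open>y\<close> and with it a
    valid step length.\<close>
  define T where "T y = \<tau> (nat \<lceil>norm y\<rceil>)" for y :: 'a
  have Tpos: "T y > 0" for y by (simp add: T_def \<tau>)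
  have "\<exists>q. \<forall>s\<in>{0..T y}. H (y + s *\<^sub>R q) (grad f (y + s *\<^sub>R q)) + Lag (y + s *\<^sub>R q) q - e \<le> q \<bullet> grad f (y + s *\<^sub>R q)" for y
    unfolding T_def by (rule \<tau>(2)) (simp add: of_nat_nat)
  then obtain q where q: "\<And>y s. s \<in> {0..T y} \<Longrightarrow>
      H (y + s *\<^sub>R q y) (grad f (y + s *\<^sub>R q y)) + Lag (y + s *\<^sub>R q y) (q y) - e \<le> q y \<bullet> grad f (y + s *\<^sub>R q y)"
    by metis
  define X where "X = rec_nat x (\<lambda>_ y. y + T y *\<^sub>R q y)"
  have X: "X 0 = x" "X (Suc n) = X n + T (X n) *\<^sub>R q (X n)" for n by (simp_all add: X_def)
  define t where "t n = (\<Sum>k<n. T (X k))" for n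
  have t: "t 0 = 0" "t (Suc n) = t n + T (X n)" for n by (simp_all add: t_def)
  have "strict_mono t" by (rule strict_mono_Suc_iff[THEN iffD2]) (simp add: t Tpos)
  then have tmono: "t i \<le> t j \<longleftrightarrow> i \<le> j" "t i < t j \<longleftrightarrow> i < j" for i j
    by (simp_all add: strict_mono_less_eq strict_mono_less)
  have t0: "t n \<ge> 0" for n using tmono(1)[of 0 n] t(1) by simp
  obtain CH where CH: "\<And>x. \<bar>H x (grad f x)\<bar> \<le> CH" by (rule H_grad_bounded[OF f]) (rule that)
  obtain Cl where Cl: "\<And>x. H x (x /\<^sub>R (1 + (norm x)\<^sup>2)) \<le> Cl" using H_lyapunov by blast
  obtain Bf where Bf: "\<And>x. \<bar>f x\<bar> \<le> Bf" by (rule Ccc_smooth_bounded[OF f]) (rule that)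
  \<comment> \<open>Young's inequality with the gradient of \<open>lyapunov\<close> bounds its
    growth by \<open>Cl\<close> plus the Lagrangian, and the polygon inequality bounds the
    Lagrangian by the growth of \<open>f\<close> plus \<open>CH + e\<close>. Subtracting
    \<open>f\<close> cancels that growth, so \<open>\<Phi>\<close> increases at rate at most
    \<open>D\<close>.\<close>
  define D where "D = Cl + CH + e"
  define \<Phi> where "\<Phi> y = lyapunov y - f y" for y
  have step: "\<Phi> (y + T y *\<^sub>R q y) \<le> \<Phi> y + D * T y" for y
  proof -
    let ?w = "\<lambda>s. \<Phi> (y + s *\<^sub>R q y) - D * s"
    have "?w (T y) \<le> ?w 0"
    proof (rule DERIV_nonpos_imp_nonincreasing[where f="?w" and a=0 and b="T y"])
      show "0 \<le> T y" using Tpos[of y] by simp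
      fix s assume s: "0 \<le> s" "s \<le> T y"
      let ?y = "y + s *\<^sub>R q y"
      let ?l = "?y /\<^sub>R (1 + (norm ?y)\<^sup>2)"
      have "((\<lambda>s. lyapunov (y + s *\<^sub>R q y)) has_real_derivative (q y \<bullet> ?l)) (at s)"
        "((\<lambda>s. f (y + s *\<^sub>R q y)) has_real_derivative (q y \<bullet> grad f ?y)) (at s)"
        by (intro has_real_derivative_along_line has_derivative_lyapunov Ccc_smooth_has_derivative[OF f])+
      then have "(?w has_real_derivative (q y \<bullet> ?l - q y \<bullet> grad f ?y - D)) (at s)"
        unfolding \<Phi>_def by (auto intro!: derivative_eq_intros)
      moreover have "q y \<bullet> ?l - q y \<bullet> grad f ?y - D \<le> 0"
        using Young[of ?l "q y" ?y] Cl[of ?y] q[of s y] CH[of ?y] s unfolding D_def by (simp add: inner_commute abs_le_iff)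
      ultimately show "\<exists>d. (?w has_real_derivative d) (at s) \<and> d \<le> 0" by blast
    qed
    then show ?thesis by simp
  qed
  have \<Phi>X: "\<Phi> (X n) \<le> \<Phi> x + D * t n" for n
  proof (induction n)
    case (Suc n)
    then show ?case using step[of "X n"] by (simp add: X t distrib_left)
  qed (simp add: X t)
  have unbounded: "\<exists>n. S < t n" for S
  proof (rule ccontr)
    assume "\<not> ?thesis"
    then have tS: "t n \<le> S" for n by (simp add: not_less)
    define M where "M = \<Phi> x + \<bar>D\<bar> * S + Bf"
    have "norm (X n) \<le> sqrt (exp (2 * M))" for n
    proof (rule norm_le_of_lyapunov)
      have "D * t n \<le> \<bar>D\<bar> * S" using tS[of n] t0[of n] by (meson abs_ge_self abs_ge_zero mult_mono order_trans)
      then show "lyapunov (X n) \<le> M" using \<Phi>X[of n] Bf[of "X n"] by (simp add: \<Phi>_def M_def abs_le_iff)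
    qed
    then have le: "nat \<lceil>norm (X n)\<rceil> \<le> nat \<lceil>sqrt (exp (2 * M))\<rceil>" for n by (intro nat_mono ceiling_mono)
    define c where "c = Min (\<tau> ` {..nat \<lceil>sqrt (exp (2 * M))\<rceil>})"
    have c: "c > 0" unfolding c_def using \<tau>(1) by (subst Min_gr_iff) auto
    have "c \<le> T (X n)" for n unfolding T_def c_def using le by (intro Min_le) auto
    then have "(\<Sum>k<n. c) \<le> t n" for n unfolding t_def by (intro sum_mono)
    then have "real n * c \<le> S" for n using tS[of n] by (simp add: order_trans[rotated])
    moreover obtain n :: nat where "S / c < real n" using reals_Archimedean2 by blast
    then have "S < real n * c" using c by (simp add: field_simps)
    ultimately show False by (meson not_less)
  qed
  define idx where "idx s = (LEAST m. s < t (Suc m))" for s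
  define \<gamma> where "\<gamma> s = X (idx s) + (s - t (idx s)) *\<^sub>R q (X (idx s))" for s
  have idx: "idx s = n" if "t n \<le> s" "s < t (Suc n)" for s n
    unfolding idx_def
  proof (rule Least_equality)
    show "n \<le> m" if "s < t (Suc m)" for m
    proof -
      have "t n < t (Suc m)" using that \<open>t n \<le> s\<close> by linarith
      then show ?thesis unfolding tmono by simp
    qed
  qed (rule that(2))
  have \<gamma>: "\<gamma> s = X n + (s - t n) *\<^sub>R q (X n)" if "t n \<le> s" "s \<le> t (Suc n)" for s n
  proof (cases "s = t (Suc n)")
    case True
    then have "idx s = Suc n" by (intro idx) (simp_all add: tmono)
    then show ?thesis using True by (simp add: \<gamma>_def X t)
  next
    case False
    then have "idx s = n" using that by (intro idx) auto
    then show ?thesis by (simp add: \<gamma>_def)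
  qed
  have lip: "\<exists>C. \<forall>s s'. 0 \<le> s \<longrightarrow> s \<le> s' \<longrightarrow> s' \<le> t n \<longrightarrow> dist (\<gamma> s) (\<gamma> s') \<le> C * (s' - s)" for n
  proof (induction n)
    case 0
    have "s = s'" if "0 \<le> s" "s \<le> s'" "s' \<le> t 0" for s s' using that t(1) by simp
    then show ?case by (intro exI[of _ 0]) (metis dist_self mult_zero_left order_refl)
  next
    case (Suc n)
    then obtain C where C: "\<And>s s'. 0 \<le> s \<Longrightarrow> s \<le> s' \<Longrightarrow> s' \<le> t n \<Longrightarrow> dist (\<gamma> s) (\<gamma> s') \<le> C * (s' - s)" by blast
    define C' where "C' = max C (norm (q (X n)))"
    have 1: "dist (\<gamma> s) (\<gamma> s') \<le> C' * (s' - s)" if "0 \<le> s" "s \<le> s'" "s' \<le> t n" for s s'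
      using C[OF that] mult_right_mono[of C C' "s' - s"] that by (simp add: C'_def)
    have 2: "dist (\<gamma> s) (\<gamma> s') \<le> C' * (s' - s)" if "t n \<le> s" "s \<le> s'" "s' \<le> t (Suc n)" for s s'
    proof -
      have "\<gamma> s - \<gamma> s' = (X n + (s - t n) *\<^sub>R q (X n)) - (X n + (s' - t n) *\<^sub>R q (X n))"
        using \<gamma>[of n s] \<gamma>[of n s'] that by simp
      also have "\<dots> = (s - s') *\<^sub>R q (X n)" by (simp add: algebra_simps)
      finally have "\<gamma> s - \<gamma> s' = (s - s') *\<^sub>R q (X n)" .
      then have "dist (\<gamma> s) (\<gamma> s') = norm (q (X n)) * (s' - s)" using that by (simp add: dist_norm mult.commute)
      also have "\<dots> \<le> C' * (s' - s)" using that by (intro mult_right_mono) (auto simp: C'_def)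
      finally show ?thesis .
    qed
    have "dist (\<gamma> s) (\<gamma> s') \<le> C' * (s' - s)" if ss: "0 \<le> s" "s \<le> s'" "s' \<le> t (Suc n)" for s s'
    proof -
      consider "s' \<le> t n" | "t n \<le> s" | "s \<le> t n" "t n \<le> s'" by linarith
      then show ?thesis
      proof cases
        case 3
        have "dist (\<gamma> s) (\<gamma> s') \<le> dist (\<gamma> s) (\<gamma> (t n)) + dist (\<gamma> (t n)) (\<gamma> s')" by (rule dist_triangle)
        also have "\<dots> \<le> C' * (t n - s) + C' * (s' - t n)" using 3 ss by (intro add_mono 1 2) auto
        finally show ?thesis by (simp add: algebra_simps)
      qed (use 1 2 ss in auto)
    qed
    then show ?case by blast
  qed
  have "\<gamma> \<in> AC_paths"
  proof (rule AC_paths_locally_Lipschitz)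
    fix S :: real
    obtain n where "S < t n" using unbounded by blast
    then show "\<exists>C. \<forall>s s'. 0 \<le> s \<longrightarrow> s \<le> s' \<longrightarrow> s' \<le> S \<longrightarrow> dist (\<gamma> s) (\<gamma> s') \<le> C * (s' - s)"
      using lip[of n] by (meson less_imp_le order_trans)
  qed
  moreover have "\<gamma> 0 = x" using \<gamma>[of 0 0] t(1) tmono(1)[of 0 "Suc 0"] by (simp add: X)
  \<comment> \<open>Velocities are unknown only at the countably many vertex times.\<close>
  moreover have "negligible (range t)" by (simp add: negligible_iff_null_sets null_sets_completionI countable_imp_null_set_lborel)
  moreover have "H (\<gamma> s) (grad f (\<gamma> s)) + cost \<gamma> s - e \<le> vector_derivative \<gamma> (at s) \<bullet> grad f (\<gamma> s)"
    if s: "s \<ge> 0" "s \<notin> range t" for s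
  proof -
    obtain m where "s < t m" using unbounded by blast
    then have "s < t (Suc m)" using tmono(2)[of m "Suc m"] by simp
    then have ex: "s < t (Suc (idx s))" unfolding idx_def by (rule LeastI)
    define n where "n = idx s"
    have "t n \<le> s"
    proof (cases n)
      case (Suc k)
      then have "\<not> s < t (Suc k)" using not_less_Least[of k "\<lambda>m. s < t (Suc m)"] by (simp add: n_def idx_def)
      then show ?thesis using Suc by simp
    qed (use s t in simp)
    moreover have "t n \<noteq> s" using s(2) by (metis rangeI)
    ultimately have n: "t n < s" "s < t (Suc n)" using ex by (simp_all add: n_def)
    have "((\<lambda>s. X n + (s - t n) *\<^sub>R q (X n)) has_vector_derivative q (X n)) (at s)"
      by (auto intro!: derivative_eq_intros)
    then have "(\<gamma> has_vector_derivative q (X n)) (at s)"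
      by (rule has_vector_derivative_transform_within_open[of _ _ _ "{t n<..<t (Suc n)}"]) (use n in \<open>auto intro!: \<gamma>[symmetric]\<close>)
    then have vd: "vector_derivative \<gamma> (at s) = q (X n)" by (rule vector_derivative_at)
    have "\<gamma> s = X n + (s - t n) *\<^sub>R q (X n)" using n by (intro \<gamma>) auto
    moreover have "s - t n \<in> {0..T (X n)}" using n t(2)[of n] by simp
    ultimately show ?thesis using q[of "s - t n" "X n"] by (simp add: cost_def vd)
  qed
  ultimately show thesis using that by blast
qed

end

section \<open>The value function\<close>

lemma discount_has_integral:
  fixes lam b T :: real
  assumes "lam > 0" "T \<ge> 0"
  shows "((\<lambda>s. exp (- s / lam) * (b / lam)) has_integral (b * (1 - exp (- T / lam)))) {0..T}"
proof -
  have der: "((\<lambda>t. - exp (- t / lam) * b) has_vector_derivative (exp (- t / lam) * (b / lam))) (at t within {0..T})" for t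
    unfolding has_real_derivative_iff_has_vector_derivative[symmetric]
    using assms(1) by (auto intro!: derivative_eq_intros simp: field_simps)
  have "((\<lambda>t. exp (- t / lam) * (b / lam)) has_integral (- exp (- T / lam) * b - (- exp (- 0 / lam) * b))) {0..T}"
    by (rule fundamental_theorem_of_calculus[OF assms(2) der])
  then show ?thesis by (simp add: algebra_simps)
qed

lemma increasing_bounded_tendsto_at_top:
  fixes F :: "real \<Rightarrow> real"
  assumes mono: "\<And>s t. 0 \<le> s \<Longrightarrow> s \<le> t \<Longrightarrow> F s \<le> F t" and bd: "\<And>t. t \<ge> 0 \<Longrightarrow> F t \<le> M"
  obtains l where "(F \<longlongrightarrow> l) at_top"
proof -
  have bdd: "bdd_above (F ` {0..})" using bd by (auto simp: bdd_above_def)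
  have "(F \<longlongrightarrow> (SUP t\<in>{0..}. F t)) at_top"
  proof (rule order_tendstoI)
    fix y assume "y < (SUP t\<in>{0..}. F t)"
    then obtain t0 where "t0 \<ge> 0" "y < F t0" using less_cSUP_iff[of "{0..}" F y] bdd by auto
    then show "\<forall>\<^sub>F t in at_top. y < F t"
      using mono by (intro eventually_mono[OF eventually_ge_at_top[of t0]]) force
  next
    fix y assume y: "(SUP t\<in>{0..}. F t) < y"
    have "F t < y" if "t \<ge> 0" for t using cSUP_upper[OF _ bdd, of t] that y by simp
    then show "\<forall>\<^sub>F t in at_top. F t < y" by (intro eventually_mono[OF eventually_ge_at_top[of 0]])
  qed
  then show thesis using that by blast
qed

text \<open>The definition asks the second expression to converge along the sequence. Boundedness
  provides a convergent subsequence, so pointwise inequalities with vanishing errors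
  suffice.\<close>

lemma viscosity_subsolution_of_approximation:
  assumes u: "usc u" "\<And>x. \<bar>u x\<bar> \<le> Bu" and h: "\<And>x. \<bar>h x\<bar> \<le> Bh"
    and A: "\<And>f. f \<in> D \<Longrightarrow> \<exists>C. \<forall>x. \<bar>A f x\<bar> \<le> C"
    and approx: "\<And>f n. f \<in> D \<Longrightarrow> \<exists>C. \<forall>n::nat. \<exists>x. (SUP y. u y - f y) - C / real (Suc n) \<le> u x - f x \<and>
        u x - lam * A f x - h x \<le> C / real (Suc n)"
    and f: "\<And>f. f \<in> D \<Longrightarrow> bdd_above (range (\<lambda>y. u y - f y))"
  shows "viscosity_subsolution D A lam h u"
  unfolding viscosity_subsolution_def
proof (intro conjI ballI)
  show "bdd_above (range u)" using u(2) by (intro bdd_aboveI2[of _ _ Bu]) (simp add: abs_le_iff)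
  show "usc u" by (rule u(1))
  fix f assume fD: "f \<in> D"
  let ?S = "SUP y. u y - f y"
  obtain C where C: "\<forall>n::nat. \<exists>x. ?S - C / real (Suc n) \<le> u x - f x \<and> u x - lam * A f x - h x \<le> C / real (Suc n)"
    using approx[OF fD] by blast
  then obtain x where x: "\<And>n. ?S - C / real (Suc n) \<le> u (x n) - f (x n)"
     "\<And>n. u (x n) - lam * A f (x n) - h (x n) \<le> C / real (Suc n)" by metis
  obtain CA where CA: "\<And>x. \<bar>A f x\<bar> \<le> CA" using A[OF fD] by blast
  let ?w = "\<lambda>n. u (x n) - lam * A f (x n) - h (x n)"
  have "\<bar>?w n\<bar> \<le> Bu + \<bar>lam\<bar> * CA + Bh" for n
  proof -
    have "\<bar>lam * A f (x n)\<bar> \<le> \<bar>lam\<bar> * CA" unfolding abs_mult using CA by (intro mult_left_mono) auto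
    then show ?thesis using u(2)[of "x n"] h[of "x n"] by linarith
  qed
  then have "bounded (range ?w)" unfolding bounded_iff by auto
  then obtain l r where r: "strict_mono r" "(?w \<circ> r) \<longlonglongrightarrow> l" using bounded_imp_convergent_subsequence by blast
  have C0: "(\<lambda>n. C / real (Suc n)) \<longlonglongrightarrow> 0"
    using tendsto_mult_right_zero[OF LIMSEQ_inverse_real_of_nat, of C] by (simp add: divide_inverse)
  then have C0r: "(\<lambda>n. C / real (Suc (r n))) \<longlonglongrightarrow> 0"
    using LIMSEQ_subseq_LIMSEQ[OF C0 r(1)] by (simp add: o_def)
  have "(\<lambda>n. u (x (r n)) - f (x (r n))) \<longlonglongrightarrow> ?S"
  proof (rule tendsto_sandwich[of "\<lambda>n. ?S - C / real (Suc (r n))" _ _ "\<lambda>n. ?S"])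
    show "(\<lambda>n. ?S - C / real (Suc (r n))) \<longlonglongrightarrow> ?S" using tendsto_diff[OF tendsto_const[of ?S] C0r] by simp
    show "\<forall>\<^sub>F n in sequentially. u (x (r n)) - f (x (r n)) \<le> ?S"
      by (intro always_eventually allI cSUP_upper[OF UNIV_I f[OF fD]])
  qed (use x(1) in auto)
  moreover have "l \<le> 0"
    by (rule LIMSEQ_le[OF r(2) C0r]) (use x(2) in auto)
  ultimately show "\<exists>x l. (\<lambda>n. u (x n) - f (x n)) \<longlonglongrightarrow> ?S \<and> (\<lambda>n. u (x n) - lam * A f (x n) - h (x n)) \<longlonglongrightarrow> l \<and> l \<le> 0"
    using r(2) by (intro exI[of _ "\<lambda>n. x (r n)"] exI[of _ l]) (simp add: o_def)
qed

lemma integrable_on_AE_bounded: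
  fixes f g :: "real \<Rightarrow> real"
  assumes f: "f \<in> borel_measurable (lebesgue_on {a..b})" and g: "g integrable_on {a..b}" and N: "negligible N"
    and le: "\<And>x. x \<in> {a..b} - N \<Longrightarrow> \<bar>f x\<bar> \<le> g x"
  shows "f integrable_on {a..b}"
proof -
  have "N \<in> sets lebesgue" using N by (simp add: negligible_iff_null_sets null_setsD2)
  then have S: "{a..b} - N \<in> sets lebesgue" by auto
  have g': "g integrable_on ({a..b} - N)"
    by (rule integrable_spike_set[OF g]) (auto intro: negligible_subset[OF N])
  have "f \<in> borel_measurable (lebesgue_on ({a..b} - N))"
    by (rule measurable_restrict_mono[OF f]) auto
  then have "f integrable_on ({a..b} - N)"
    by (rule measurable_bounded_by_integrable_imp_integrable_real[OF _ g' le S])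
  then show ?thesis
    by (rule integrable_spike_set) (auto intro: negligible_subset[OF N])
qed

section \<open>Dynamic programming\<close>

context coercive_hamiltonian
begin

text \<open>Only paths of finite payoff enter, so this is a supremum of reals;
  \<open>exists_value\<close> shows that there are such paths from every point.\<close>

definition val :: "real \<Rightarrow> ('a \<Rightarrow> real) \<Rightarrow> 'a \<Rightarrow> real" where
  "val lam h x = Sup {j. \<exists>\<gamma>\<in>AC_paths. \<gamma> 0 = x \<and> has_value lam h \<gamma> j}"

context
  fixes lam B :: real and h :: "'a \<Rightarrow> real"
  assumes lam: "lam > 0" and h_cont: "continuous_on UNIV h" and h_bdd: "\<And>x. \<bar>h x\<bar> \<le> B"
begin

lemma B_nonneg: "B \<ge> 0"
  using h_bdd[of undefined] by linarith

lemma running_le: "running lam h \<gamma> s \<le> exp (- s / lam) * (B / lam)"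
proof -
  have "h (\<gamma> s) / lam \<le> B / lam" using h_bdd[of "\<gamma> s"] lam by (intro divide_right_mono) (auto simp: abs_le_iff)
  then show ?thesis unfolding running_def using cost_nonneg[of \<gamma> s] by (intro mult_left_mono) auto
qed

lemma integral_running_le:
  assumes "running lam h \<gamma> integrable_on {0..T}" "T \<ge> 0"
  shows "integral {0..T} (running lam h \<gamma>) \<le> B"
proof -
  have "integral {0..T} (running lam h \<gamma>) \<le> B * (1 - exp (- T / lam))"
    using running_le by (intro has_integral_le[OF integrable_integral[OF assms(1)] discount_has_integral[OF lam assms(2)]])
  also have "\<dots> \<le> B * 1" using B_nonneg by (intro mult_left_mono) auto
  finally show ?thesis by simp
qed

lemma has_value_le: "has_value lam h \<gamma> j \<Longrightarrow> j \<le> B"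
  unfolding has_value_def
  by (elim conjE, rule tendsto_upperbound[where F=at_top])
     (auto intro!: eventually_mono[OF eventually_ge_at_top[of 0]] integral_running_le)

lemma has_value_shift:
  assumes v: "has_value lam h \<gamma> j" and \<tau>: "\<tau> \<ge> 0"
  obtains j' where "has_value lam h (\<lambda>t. \<gamma> (t + \<tau>)) j'" "j = integral {0..\<tau>} (running lam h \<gamma>) + exp (- \<tau> / lam) * j'"
proof -
  let ?r = "running lam h \<gamma>" and ?s = "running lam h (\<lambda>t. \<gamma> (t + \<tau>))"
  have int: "?r integrable_on {0..T}" if "T \<ge> 0" for T using v that by (auto simp: has_value_def)
  have s: "?s t = exp (\<tau> / lam) * ?r (t + \<tau>)" for t
    by (simp add: running_def cost_def vector_derivative_shift mult.assoc[symmetric] exp_add[symmetric] add_divide_distrib[symmetric])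
  have sub: "?r integrable_on {\<tau>..\<tau> + T}" if "T \<ge> 0" for T
    by (rule integrable_on_subinterval[OF int[of "\<tau> + T"]]) (use that \<tau> in auto)
  have sint: "?s integrable_on {0..T}" if "T \<ge> 0" for T
  proof -
    have "(\<lambda>t. ?r (t + \<tau>)) integrable_on {\<tau> - \<tau>..\<tau> + T - \<tau>}" by (rule integrable_shift_real_ivl[OF sub[OF that]])
    then have "(\<lambda>t. ?r (t + \<tau>)) integrable_on {0..T}" by simp
    from integrable_on_cmult_left[OF this, of "exp (\<tau> / lam)"] show ?thesis by (simp add: s[abs_def])
  qed
  have seq: "integral {0..T} ?s = exp (\<tau> / lam) * (integral {0..\<tau> + T} ?r - integral {0..\<tau>} ?r)" if T: "T \<ge> 0" for T
  proof -
    have "integral {0..T} ?s = exp (\<tau> / lam) * integral {0..T} (\<lambda>t. ?r (t + \<tau>))" unfolding s[abs_def] by simp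
    also have "integral {0..T} (\<lambda>t. ?r (t + \<tau>)) = integral {\<tau>..\<tau> + T} ?r"
      using integral_shift_real_ivl[of \<tau> \<tau> "\<tau> + T" ?r] by simp
    also have "integral {0..\<tau>} ?r + integral {\<tau>..\<tau> + T} ?r = integral {0..\<tau> + T} ?r"
      by (rule Henstock_Kurzweil_Integration.integral_combine) (use \<tau> T int in auto)
    then have "integral {\<tau>..\<tau> + T} ?r = integral {0..\<tau> + T} ?r - integral {0..\<tau>} ?r" by simp
    finally show ?thesis .
  qed
  have "((\<lambda>T. integral {0..\<tau> + T} ?r) \<longlongrightarrow> j) at_top"
  proof (rule filterlim_compose[where g="\<lambda>T. integral {0..T} ?r"])
    show "((\<lambda>T. integral {0..T} ?r) \<longlongrightarrow> j) at_top" using v by (simp add: has_value_def)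
    show "filterlim (\<lambda>T. \<tau> + T) at_top at_top" by (rule filterlim_tendsto_add_at_top[OF tendsto_const filterlim_ident])
  qed
  then have "((\<lambda>T. exp (\<tau> / lam) * (integral {0..\<tau> + T} ?r - integral {0..\<tau>} ?r)) \<longlongrightarrow> exp (\<tau> / lam) * (j - integral {0..\<tau>} ?r)) at_top"
    by (intro tendsto_intros)
  then have "((\<lambda>T. integral {0..T} ?s) \<longlongrightarrow> exp (\<tau> / lam) * (j - integral {0..\<tau>} ?r)) at_top"
    by (rule Lim_transform_eventually) (auto intro!: eventually_mono[OF eventually_ge_at_top[of 0]] simp: seq)
  then have "has_value lam h (\<lambda>t. \<gamma> (t + \<tau>)) (exp (\<tau> / lam) * (j - integral {0..\<tau>} ?r))"
    using sint by (auto simp: has_value_def)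
  moreover have "j = integral {0..\<tau>} ?r + exp (- \<tau> / lam) * (exp (\<tau> / lam) * (j - integral {0..\<tau>} ?r))"
    by (simp add: mult.assoc[symmetric] exp_add[symmetric])
  ultimately show thesis using that by blast
qed

lemma has_value_join:
  assumes \<gamma>: "running lam h \<gamma> integrable_on {0..\<tau>}" and \<zeta>: "has_value lam h \<zeta> j" and \<tau>: "\<tau> \<ge> 0"
  shows "has_value lam h (join_paths_at \<tau> \<gamma> \<zeta>) (integral {0..\<tau>} (running lam h \<gamma>) + exp (- \<tau> / lam) * j)"
proof -
  let ?\<eta> = "join_paths_at \<tau> \<gamma> \<zeta>"
  let ?e = "running lam h ?\<eta>" and ?r = "running lam h \<gamma>" and ?z = "running lam h \<zeta>"
  have e1: "?e s = ?r s" if "s < \<tau>" for s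
    using that by (simp add: running_def cost_def vector_derivative_join(1) join_paths_at_def)
  have e2: "?e (s + \<tau>) = exp (- \<tau> / lam) * ?z s" if "s > 0" for s
  proof -
    have "- (s + \<tau>) / lam = - \<tau> / lam + - s / lam" using lam by (simp add: field_simps)
    then have "exp (- (s + \<tau>) / lam) = exp (- \<tau> / lam) * exp (- s / lam)" by (simp only: exp_add)
    then show ?thesis
      using that unfolding running_def cost_def vector_derivative_join(2)[OF that] by (simp add: join_paths_at_def)
  qed
  have A: "(?e has_integral integral {0..\<tau>} ?r) {0..\<tau>}"
    by (rule has_integral_spike[OF negligible_sing[of \<tau>] _ integrable_integral[OF \<gamma>]]) (use e1 in auto)
  have zint: "?z integrable_on {0..T}" if "T \<ge> 0" for T using \<zeta> that by (auto simp: has_value_def)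
  have Bi: "(?e has_integral (exp (- \<tau> / lam) * integral {0..T} ?z)) {\<tau>..\<tau> + T}" if T: "T \<ge> 0" for T
  proof -
    have "((\<lambda>s. exp (- \<tau> / lam) * ?z s) has_integral (exp (- \<tau> / lam) * integral {0..T} ?z)) {0..T}"
      by (intro has_integral_mult_right integrable_integral zint T)
    then have "((\<lambda>s. ?e (s + \<tau>)) has_integral (exp (- \<tau> / lam) * integral {0..T} ?z)) {0..T}"
      by (rule has_integral_spike[OF negligible_sing[of 0], rotated]) (use e2 in auto)
    then have "((\<lambda>s. ?e (s + \<tau>)) has_integral (exp (- \<tau> / lam) * integral {0..T} ?z)) {\<tau> - \<tau>..\<tau> + T - \<tau>}" by simp
    then show ?thesis by (simp only: has_integral_shift_real_ivl_iff[symmetric])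
  qed
  have AB: "(?e has_integral (integral {0..\<tau>} ?r + exp (- \<tau> / lam) * integral {0..T} ?z)) {0..\<tau> + T}" if T: "T \<ge> 0" for T
    by (rule has_integral_combine[OF \<tau> _ A Bi[OF T]]) (use T in simp)
  have int: "?e integrable_on {0..T}" if "T \<ge> 0" for T
    by (rule integrable_on_subinterval[OF has_integral_integrable[OF AB[OF that]]]) (use \<tau> in auto)
  have z: "((\<lambda>T. integral {0..T - \<tau>} ?z) \<longlongrightarrow> j) at_top"
  proof (rule filterlim_compose[where g="\<lambda>T. integral {0..T} ?z"])
    show "((\<lambda>T. integral {0..T} ?z) \<longlongrightarrow> j) at_top" using \<zeta> by (simp add: has_value_def)
    show "filterlim (\<lambda>T. T - \<tau>) at_top at_top"
      using filterlim_tendsto_add_at_top[OF tendsto_const[of "- \<tau>"] filterlim_ident] by simp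
  qed
  have "((\<lambda>T. integral {0..\<tau>} ?r + exp (- \<tau> / lam) * integral {0..T - \<tau>} ?z) \<longlongrightarrow> integral {0..\<tau>} ?r + exp (- \<tau> / lam) * j) at_top"
    by (rule tendsto_add[OF tendsto_const tendsto_mult_left[OF z]])
  moreover have "\<forall>\<^sub>F T in at_top. integral {0..\<tau>} ?r + exp (- \<tau> / lam) * integral {0..T - \<tau>} ?z = integral {0..T} ?e"
    using eventually_ge_at_top[of \<tau>]
  proof eventually_elim
    case (elim T)
    then show ?case using AB[of "T - \<tau>"] by (simp add: integral_unique)
  qed
  ultimately have "((\<lambda>T. integral {0..T} ?e) \<longlongrightarrow> integral {0..\<tau>} ?r + exp (- \<tau> / lam) * j) at_top"
    by (rule Lim_transform_eventually)
  then show ?thesis using int by (auto simp: has_value_def)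
qed

lemma val_upper: "\<gamma> \<in> AC_paths \<Longrightarrow> has_value lam h \<gamma> j \<Longrightarrow> j \<le> val lam h (\<gamma> 0)"
  unfolding val_def
proof (rule cSup_upper)
  show "bdd_above {j. \<exists>\<zeta>\<in>AC_paths. \<zeta> 0 = \<gamma> 0 \<and> has_value lam h \<zeta> j}"
    by (rule bdd_aboveI[of _ B]) (use has_value_le in blast)
qed blast

text \<open>Subtracting \<open>running\<close> from its integrable upper bound leaves a nonnegative
  function, whose integrals increase and stay bounded.\<close>

lemma has_value_exists:
  assumes int: "\<And>T. T \<ge> 0 \<Longrightarrow> running lam h \<gamma> integrable_on {0..T}"
    and lower: "\<And>T. T \<ge> 0 \<Longrightarrow> c \<le> integral {0..T} (running lam h \<gamma>)"
  shows "\<exists>j. has_value lam h \<gamma> j"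
proof -
  let ?g = "\<lambda>s. exp (- s / lam) * (B / lam) - running lam h \<gamma> s"
  have g: "(?g has_integral (B * (1 - exp (- T / lam)) - integral {0..T} (running lam h \<gamma>))) {0..T}" if "T \<ge> 0" for T
    by (intro has_integral_diff discount_has_integral lam that integrable_integral int)
  obtain l where l: "((\<lambda>T. integral {0..T} ?g) \<longlongrightarrow> l) at_top"
  proof (rule increasing_bounded_tendsto_at_top)
    fix s t :: real assume "0 \<le> s" "s \<le> t"
    then show "integral {0..s} ?g \<le> integral {0..t} ?g"
      using g[of s] g[of t] running_le by (intro integral_subset_le) (auto simp: integrable_on_def)
  next
    fix t :: real assume t: "t \<ge> 0"
    have "B * (1 - exp (- t / lam)) \<le> B * 1" using B_nonneg by (intro mult_left_mono) auto
    then show "integral {0..t} ?g \<le> B - c" using g[OF t] lower[OF t] by (simp add: integral_unique)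
  qed
  have "((\<lambda>T. B * (1 - exp (- T / lam)) - integral {0..T} ?g) \<longlongrightarrow> B * (1 - 0) - l) at_top"
  proof (intro tendsto_intros l filterlim_compose[OF exp_at_bot])
    show "filterlim (\<lambda>T. - T / lam) at_bot at_top"
      using filterlim_tendsto_neg_mult_at_bot[OF tendsto_const[of "- inverse lam"] _ filterlim_ident] lam
      by (simp add: divide_inverse mult.commute)
  qed
  moreover have "\<forall>\<^sub>F T in at_top. B * (1 - exp (- T / lam)) - integral {0..T} ?g = integral {0..T} (running lam h \<gamma>)"
  proof (rule eventually_mono[OF eventually_ge_at_top[of 0]])
    fix T :: real assume "0 \<le> T"
    from integral_unique[OF g[OF this]]
    show "B * (1 - exp (- T / lam)) - integral {0..T} ?g = integral {0..T} (running lam h \<gamma>)" by linarith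
  qed
  ultimately have "((\<lambda>T. integral {0..T} (running lam h \<gamma>)) \<longlongrightarrow> B * (1 - 0) - l) at_top"
    by (rule Lim_transform_eventually)
  then show ?thesis using int by (auto simp: has_value_def)
qed

text \<open>The reversed Young inequality bounds the cost by the derivative in the chain rule plus
  continuous terms, all of them integrable, which yields integrability of the cost itself.\<close>

lemma running_integrable:
  assumes \<gamma>: "\<gamma> \<in> AC_paths" and f: "f \<in> Ccc_smooth" and N: "negligible N" and T: "T \<ge> 0"
    and ineq: "\<And>s. s \<ge> 0 \<Longrightarrow> s \<notin> N \<Longrightarrow> H (\<gamma> s) (grad f (\<gamma> s)) + cost \<gamma> s - e \<le> vector_derivative \<gamma> (at s) \<bullet> grad f (\<gamma> s)"
  shows "running lam h \<gamma> integrable_on {0..T}"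
proof (rule integrable_on_AE_bounded[OF _ _ N])
  have cont: "continuous_on {0..T} \<gamma>" by (rule continuous_on_subset[OF AC_path_FTC(1)[OF \<gamma>]]) auto
  have comp: "continuous_on {0..T} (\<lambda>s. F (\<gamma> s))" if "continuous_on UNIV F" for F :: "'a \<Rightarrow> real"
    by (rule continuous_on_compose2[OF that cont]) auto
  have "(\<lambda>s. exp (- s / lam)) \<in> borel_measurable (lebesgue_on {0..T})"
    "(\<lambda>s. h (\<gamma> s) / lam) \<in> borel_measurable (lebesgue_on {0..T})"
    by (intro continuous_imp_measurable_on_sets_lebesgue continuous_intros comp h_cont; use lam in simp)+
  then show "running lam h \<gamma> \<in> borel_measurable (lebesgue_on {0..T})"
    unfolding running_def[abs_def]
    by (intro borel_measurable_times borel_measurable_diff cost_measurable \<gamma> T)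
  let ?c = "\<lambda>s. exp (- s / lam) * (vector_derivative \<gamma> (at s) \<bullet> grad f (\<gamma> s) - f (\<gamma> s) / lam)"
  let ?g = "\<lambda>s. ?c s + exp (- s / lam) * (f (\<gamma> s) / lam + e + B / lam - H (\<gamma> s) (grad f (\<gamma> s)))"
  show "?g integrable_on {0..T}"
  proof (rule integrable_add)
    show "?c integrable_on {0..T}" using AC_path_discounted_chain_rule[OF \<gamma> f T lam] by (auto simp: integrable_on_def)
    show "(\<lambda>s. exp (- s / lam) * (f (\<gamma> s) / lam + e + B / lam - H (\<gamma> s) (grad f (\<gamma> s)))) integrable_on {0..T}"
      by (intro integrable_continuous_real continuous_intros comp Ccc_smooth_continuous[OF f] H_grad_continuous[OF f]) (use lam in auto)
  qed
  fix s assume s: "s \<in> {0..T} - N"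
  have "\<bar>h (\<gamma> s) / lam - cost \<gamma> s\<bar> \<le> vector_derivative \<gamma> (at s) \<bullet> grad f (\<gamma> s) + e + B / lam - H (\<gamma> s) (grad f (\<gamma> s))"
  proof -
    have "\<bar>h (\<gamma> s) / lam\<bar> \<le> B / lam" using h_bdd[of "\<gamma> s"] lam by (simp add: divide_right_mono)
    moreover have "H (\<gamma> s) (grad f (\<gamma> s)) + cost \<gamma> s - e \<le> vector_derivative \<gamma> (at s) \<bullet> grad f (\<gamma> s)"
      by (rule ineq) (use s in auto)
    ultimately show ?thesis using cost_nonneg[of \<gamma> s] by linarith
  qed
  then have "exp (- s / lam) * \<bar>h (\<gamma> s) / lam - cost \<gamma> s\<bar> \<le> exp (- s / lam) * (vector_derivative \<gamma> (at s) \<bullet> grad f (\<gamma> s) + e + B / lam - H (\<gamma> s) (grad f (\<gamma> s)))"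
    by (intro mult_left_mono) auto
  moreover have "\<bar>running lam h \<gamma> s\<bar> = exp (- s / lam) * \<bar>h (\<gamma> s) / lam - cost \<gamma> s\<bar>"
    by (simp add: running_def abs_mult)
  moreover have "exp (- s / lam) * (vector_derivative \<gamma> (at s) \<bullet> grad f (\<gamma> s) + e + B / lam - H (\<gamma> s) (grad f (\<gamma> s))) = ?g s"
    by (simp add: algebra_simps)
  ultimately show "\<bar>running lam h \<gamma> s\<bar> \<le> ?g s" by linarith
qed

lemma zero_Ccc_smooth: "(\<lambda>_::'a. 0) \<in> Ccc_smooth"
  unfolding Ccc_smooth_def smooth_def using Ck_const by (auto intro!: exI[of _ "{}"])

text \<open>For \<open>f = 0\<close> the polygon inequality with \<open>e = 1\<close> says that the
  cost is at most 1 almost everywhere. Discounting turns this into a loss of at most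
  \<open>lam\<close>, besides the loss \<open>B\<close> from \<open>h\<close>.\<close>

lemma exists_value:
  obtains \<gamma> j where "\<gamma> \<in> AC_paths" "\<gamma> 0 = x" "has_value lam h \<gamma> j" "- B - lam \<le> j"
proof -
  let ?z = "\<lambda>_::'a. 0::real"
  have gz: "grad ?z y = 0" for y :: 'a by (rule grad_eq) simp
  obtain \<gamma> N where \<gamma>: "\<gamma> \<in> AC_paths" "\<gamma> 0 = x" "negligible N"
    "\<And>s. s \<ge> 0 \<Longrightarrow> s \<notin> N \<Longrightarrow> H (\<gamma> s) (grad ?z (\<gamma> s)) + cost \<gamma> s - 1 \<le> vector_derivative \<gamma> (at s) \<bullet> grad ?z (\<gamma> s)"
    by (rule euler_path[OF zero_Ccc_smooth zero_less_one]) (rule that)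
  have int: "running lam h \<gamma> integrable_on {0..T}" if T: "T \<ge> 0" for T
    by (rule running_integrable[OF \<gamma>(1) zero_Ccc_smooth \<gamma>(3) T \<gamma>(4)])
  have c1: "cost \<gamma> s \<le> 1" if "s \<ge> 0" "s \<notin> N" for s using \<gamma>(4)[OF that] by (simp add: gz H_zero)
  have low: "exp (- s / lam) * ((- B - lam) / lam) \<le> running lam h \<gamma> s" if "s \<ge> 0" "s \<notin> N" for s
  proof -
    have "(- B - lam) / lam \<le> h (\<gamma> s) / lam - 1" using h_bdd[of "\<gamma> s"] lam by (simp add: field_simps abs_le_iff)
    also have "\<dots> \<le> h (\<gamma> s) / lam - cost \<gamma> s" using c1[OF that] by simp
    finally show ?thesis unfolding running_def by (intro mult_left_mono) auto
  qed
  have lower: "- B - lam \<le> integral {0..T} (running lam h \<gamma>)" if T: "T \<ge> 0" for T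
  proof -
    let ?w = "\<lambda>s. if s \<in> N then exp (- s / lam) * ((- B - lam) / lam) else running lam h \<gamma> s"
    have "(?w has_integral integral {0..T} (running lam h \<gamma>)) {0..T}"
      by (rule has_integral_spike[OF \<gamma>(3) _ integrable_integral[OF int[OF T]]]) auto
    then have "(- B - lam) * (1 - exp (- T / lam)) \<le> integral {0..T} (running lam h \<gamma>)"
      by (rule has_integral_le[OF discount_has_integral[OF lam T]]) (use low in auto)
    moreover have "(B + lam) * (1 - exp (- T / lam)) \<le> (B + lam) * 1"
      using B_nonneg lam by (intro mult_left_mono) auto
    ultimately show ?thesis by (simp add: algebra_simps)
  qed
  have "\<exists>j. has_value lam h \<gamma> j" by (rule has_value_exists[OF int lower])
  then obtain j where j: "has_value lam h \<gamma> j" by blast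
  have "- B - lam \<le> j"
    by (rule tendsto_lowerbound[where F=at_top and f="\<lambda>T. integral {0..T} (running lam h \<gamma>)"])
       (use j lower in \<open>auto simp: has_value_def intro!: eventually_mono[OF eventually_ge_at_top[of 0]]\<close>)
  then show thesis using that \<gamma>(1,2) j by blast
qed

lemma val_bounds: "- B - lam \<le> val lam h x" "val lam h x \<le> B"
proof -
  obtain \<gamma> j where \<gamma>: "\<gamma> \<in> AC_paths" "\<gamma> 0 = x" "has_value lam h \<gamma> j" "- B - lam \<le> j" by (rule exists_value)
  then show "- B - lam \<le> val lam h x" using val_upper by force
  show "val lam h x \<le> B" unfolding val_def
    by (rule cSup_least) (use \<gamma> has_value_le in blast)+
qed

lemma val_near_optimal:
  assumes "e > 0"
  obtains \<gamma> j where "\<gamma> \<in> AC_paths" "\<gamma> 0 = x" "has_value lam h \<gamma> j" "val lam h x - e < j"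
proof -
  obtain \<gamma>0 j0 where \<gamma>0: "\<gamma>0 \<in> AC_paths" "\<gamma>0 0 = x" "has_value lam h \<gamma>0 j0" by (rule exists_value) (rule that)
  have "val lam h x - e < val lam h x" using assms by simp
  then have "\<exists>j\<in>{j. \<exists>\<gamma>\<in>AC_paths. \<gamma> 0 = x \<and> has_value lam h \<gamma> j}. val lam h x - e < j"
    unfolding val_def by (rule less_cSupD[rotated]) (use \<gamma>0 in blast)
  then show thesis using that by blast
qed

lemma dynamic_programming_le:
  assumes \<gamma>: "\<gamma> \<in> AC_paths" "has_value lam h \<gamma> j" and \<tau>: "\<tau> \<ge> 0"
  shows "j \<le> integral {0..\<tau>} (running lam h \<gamma>) + exp (- \<tau> / lam) * val lam h (\<gamma> \<tau>)"
proof -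
  obtain j' where j': "has_value lam h (\<lambda>t. \<gamma> (t + \<tau>)) j'" "j = integral {0..\<tau>} (running lam h \<gamma>) + exp (- \<tau> / lam) * j'"
    by (rule has_value_shift[OF \<gamma>(2) \<tau>])
  have "j' \<le> val lam h (\<gamma> \<tau>)" using val_upper[OF AC_paths_shift[OF \<gamma>(1) \<tau>] j'(1)] by simp
  then show ?thesis unfolding j'(2) by simp
qed

text \<open>An almost optimal continuation from \<open>\<gamma> \<tau>\<close> is attached to the
  initial piece. Integrability is asked for only up to \<open>\<tau>\<close>, so polygons and
  segments qualify whatever their later payoff.\<close>

lemma dynamic_programming_ge:
  assumes \<gamma>: "\<gamma> \<in> AC_paths" "running lam h \<gamma> integrable_on {0..\<tau>}" and \<tau>: "\<tau> \<ge> 0"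
  shows "integral {0..\<tau>} (running lam h \<gamma>) + exp (- \<tau> / lam) * val lam h (\<gamma> \<tau>) \<le> val lam h (\<gamma> 0)"
proof (rule field_le_epsilon)
  fix e :: real assume e: "e > 0"
  obtain \<zeta> j where \<zeta>: "\<zeta> \<in> AC_paths" "\<zeta> 0 = \<gamma> \<tau>" "has_value lam h \<zeta> j" "val lam h (\<gamma> \<tau>) - e < j"
    by (rule val_near_optimal[OF e])
  have "integral {0..\<tau>} (running lam h \<gamma>) + exp (- \<tau> / lam) * j \<le> val lam h (join_paths_at \<tau> \<gamma> \<zeta> 0)"
    by (rule val_upper[OF AC_paths_join[OF \<gamma>(1) \<zeta>(1,2) \<tau>] has_value_join[OF \<gamma>(2) \<zeta>(3) \<tau>]])
  moreover have "join_paths_at \<tau> \<gamma> \<zeta> 0 = \<gamma> 0" using \<tau> by (simp add: join_paths_at_def)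
  moreover have "exp (- \<tau> / lam) * (val lam h (\<gamma> \<tau>) - e) \<le> exp (- \<tau> / lam) * j" using \<zeta>(4) by simp
  moreover have "exp (- \<tau> / lam) * e \<le> 1 * e" using e \<tau> lam by (intro mult_right_mono) auto
  ultimately show "integral {0..\<tau>} (running lam h \<gamma>) + exp (- \<tau> / lam) * val lam h (\<gamma> \<tau>) \<le> val lam h (\<gamma> 0) + e"
    by (simp add: right_diff_distrib)
qed

lemma val_continuous: "continuous_on UNIV (val lam h)"
  unfolding continuous_on_iff
proof (intro ballI allI impI)
  fix x0 :: 'a and e :: real assume e: "e > 0"
  define R where "R = norm x0 + 1"
  have "compact (cball (0::'a) R \<times> cball (0::'a) 1)" by (intro compact_Times compact_cball)
  then have "compact ((\<lambda>(x, v). Lag x v) ` (cball 0 R \<times> cball 0 1))"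
    by (intro compact_continuous_image continuous_on_subset[OF Lag_continuous]) auto
  then obtain C0 where "\<forall>y\<in>(\<lambda>(x, v). Lag x v) ` (cball 0 R \<times> cball 0 1). norm y \<le> C0"
    using compact_imp_bounded bounded_iff by blast
  then have C0: "Lag x v \<le> C0" if "x \<in> cball 0 R" "v \<in> cball 0 1" for x v using that by force
  \<comment> \<open>Rates of loss along a unit-speed segment: \<open>B / lam\<close> from
    \<open>h\<close>, \<open>C0\<close> from the Lagrangian, and the last term from discounting the
    value at its end.\<close>
  define C where "C = B / lam + C0 + (B + lam) / lam"
  have step: "val lam h y - C * norm (y - x) \<le> val lam h x" if xy: "norm x \<le> R" "norm y \<le> R" "x \<noteq> y" for x y
  proof -
    define \<tau> where "\<tau> = norm (y - x)"
    have \<tau>: "\<tau> > 0" using xy by (simp add: \<tau>_def)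
    define v where "v = (y - x) /\<^sub>R \<tau>"
    have v: "norm v = 1" using \<tau> by (simp add: v_def \<tau>_def)
    define \<gamma> where "\<gamma> t = x + t *\<^sub>R v" for t
    have ends: "\<gamma> 0 = x" "\<gamma> \<tau> = y" using \<tau> by (simp_all add: \<gamma>_def v_def)
    have AC: "\<gamma> \<in> AC_paths"
    proof (rule AC_paths_locally_Lipschitz)
      have "dist (\<gamma> s) (\<gamma> t) = \<bar>s - t\<bar>" for s t
      proof -
        have "\<gamma> s - \<gamma> t = (s - t) *\<^sub>R v" by (simp add: \<gamma>_def algebra_simps)
        then show ?thesis by (simp add: dist_norm v)
      qed
      then show "\<exists>C. \<forall>s t. 0 \<le> s \<longrightarrow> s \<le> t \<longrightarrow> t \<le> T \<longrightarrow> dist (\<gamma> s) (\<gamma> t) \<le> C * (t - s)" for T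
        by (intro exI[of _ 1]) auto
    qed
    have vd: "vector_derivative \<gamma> (at s) = v" for s
      unfolding \<gamma>_def by (rule vector_derivative_at) (auto intro!: derivative_eq_intros)
    have ball: "\<gamma> s \<in> cball 0 R" if "0 \<le> s" "s \<le> \<tau>" for s
    proof -
      have "\<gamma> s = (1 - s / \<tau>) *\<^sub>R x + (s / \<tau>) *\<^sub>R y" using \<tau> by (simp add: \<gamma>_def v_def algebra_simps divide_inverse)
      moreover have "(1 - s / \<tau>) *\<^sub>R x + (s / \<tau>) *\<^sub>R y \<in> cball 0 R"
        by (rule convexD_alt[OF convex_cball]) (use xy that \<tau> in auto)
      ultimately show ?thesis by simp
    qed
    define K where "K = B / lam + C0"
    have low: "- K \<le> running lam h \<gamma> s" if s: "s \<in> {0..\<tau>}" for s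
    proof -
      have "\<bar>h (\<gamma> s) / lam\<bar> \<le> B / lam" using h_bdd[of "\<gamma> s"] lam by (simp add: divide_right_mono)
      moreover have "cost \<gamma> s \<le> C0" unfolding cost_def vd using ball[of s] s v by (intro C0) auto
      ultimately have a: "- K \<le> h (\<gamma> s) / lam - cost \<gamma> s" unfolding K_def by linarith
      have nn: "0 \<le> K" using C0[OF ball[of s], of v] Lag_nonneg[of "\<gamma> s" v] s v B_nonneg lam by (auto simp: K_def)
      have "exp (- s / lam) * K \<le> 1 * K" using nn s lam by (intro mult_right_mono) auto
      moreover have "exp (- s / lam) * - K \<le> exp (- s / lam) * (h (\<gamma> s) / lam - cost \<gamma> s)"
        using a by (intro mult_left_mono) auto
      ultimately show ?thesis unfolding running_def by simp
    qed
    have int: "running lam h \<gamma> integrable_on {0..\<tau>}"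
    proof (rule integrable_continuous_real)
      have g: "continuous_on {0..\<tau>} \<gamma>" unfolding \<gamma>_def by (intro continuous_intros)
      have "continuous_on {0..\<tau>} (\<lambda>s. (\<lambda>(x, v). Lag x v) (\<gamma> s, v))"
        by (rule continuous_on_compose2[OF Lag_continuous]) (auto intro!: continuous_intros g)
      moreover have "continuous_on {0..\<tau>} (\<lambda>s. h (\<gamma> s))" by (rule continuous_on_compose2[OF h_cont g]) auto
      ultimately show "continuous_on {0..\<tau>} (running lam h \<gamma>)"
        unfolding running_def[abs_def] cost_def vd using lam by (auto intro!: continuous_intros)
    qed
    have "integral {0..\<tau>} (\<lambda>_. - K) \<le> integral {0..\<tau>} (running lam h \<gamma>)"
      by (rule integral_le[OF integrable_const_ivl int low])
    then have "- (K * \<tau>) \<le> integral {0..\<tau>} (running lam h \<gamma>)" using \<tau> by (simp add: mult.commute)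
    moreover have "val lam h y - (B + lam) / lam * \<tau> \<le> exp (- \<tau> / lam) * val lam h y"
    proof -
      have e1: "1 - exp (- \<tau> / lam) \<le> \<tau> / lam" "0 \<le> 1 - exp (- \<tau> / lam)"
        using exp_ge_add_one_self[of "- \<tau> / lam"] \<tau> lam by auto
      have "(1 - exp (- \<tau> / lam)) * val lam h y \<le> (1 - exp (- \<tau> / lam)) * (B + lam)"
        using val_bounds(2)[of y] e1 lam by (intro mult_left_mono) auto
      also have "\<dots> \<le> \<tau> / lam * (B + lam)" using e1 B_nonneg lam by (intro mult_right_mono) auto
      finally show ?thesis by (simp add: algebra_simps)
    qed
    ultimately show ?thesis using dynamic_programming_ge[OF AC int] \<tau> unfolding ends C_def K_def \<tau>_def[symmetric]
      by (simp add: algebra_simps)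
  qed
  define d where "d = min 1 (e / (\<bar>C\<bar> + 1))"
  have "d \<le> e / (\<bar>C\<bar> + 1)" by (simp add: d_def)
  then have d3: "(\<bar>C\<bar> + 1) * d \<le> e" by (simp add: pos_le_divide_eq mult.commute add_pos_nonneg)
  have d: "d > 0" "d \<le> 1" using e by (simp_all add: d_def)
  have "dist (val lam h y) (val lam h x0) < e" if y: "dist y x0 < d" for y
  proof (cases "y = x0")
    case False
    have "norm y \<le> R" using y d(2) norm_triangle_sub[of y x0] by (simp add: R_def dist_norm)
    moreover have "norm x0 \<le> R" by (simp add: R_def)
    ultimately have "val lam h y - C * norm (y - x0) \<le> val lam h x0" "val lam h x0 - C * norm (y - x0) \<le> val lam h y"
      using step[of x0 y] step[of y x0] False by (auto simp: norm_minus_commute)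
    moreover have "C * norm (y - x0) \<le> \<bar>C\<bar> * norm (y - x0)" by (intro mult_right_mono) auto
    moreover have "(\<bar>C\<bar> + 1) * norm (y - x0) < (\<bar>C\<bar> + 1) * d" using y by (intro mult_strict_left_mono) (auto simp: dist_norm)
    then have "\<bar>C\<bar> * norm (y - x0) < e" using d3 norm_ge_zero[of "y - x0"] unfolding distrib_right by linarith
    ultimately show ?thesis unfolding dist_real_def by linarith
  qed (use e in simp)
  then show "\<exists>d>0. \<forall>x'\<in>UNIV. dist x' x0 < d \<longrightarrow> dist (val lam h x') (val lam h x0) < e" using d(1) by blast
qed

text \<open>The drift of the discounted test function plus payoff under the optimal velocity. The
  subsolution inequality at a point says exactly that \<open>u - f \<le> lam * rate f\<close>
  there.\<close>

definition rate :: "('a \<Rightarrow> real) \<Rightarrow> 'a \<Rightarrow> real" where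
  "rate f x = (h x - f x) / lam + H x (grad f x)"

lemma rate_continuous: "f \<in> Ccc_smooth \<Longrightarrow> continuous_on UNIV (rate f)"
  unfolding rate_def[abs_def] using lam
  by (intro continuous_intros h_cont Ccc_smooth_continuous H_grad_continuous) auto

lemma rate_bounded:
  assumes f: "f \<in> Ccc_smooth" obtains C where "\<And>x. \<bar>rate f x\<bar> \<le> C"
proof -
  obtain Bf where Bf: "\<And>x. \<bar>f x\<bar> \<le> Bf" by (rule Ccc_smooth_bounded[OF f]) (rule that)
  obtain CH where CH: "\<And>x. \<bar>H x (grad f x)\<bar> \<le> CH" by (rule H_grad_bounded[OF f]) (rule that)
  have "\<bar>rate f x\<bar> \<le> (B + Bf) / lam + CH" for x
  proof -
    have "\<bar>h x - f x\<bar> \<le> B + Bf" using h_bdd[of x] Bf[of x] by linarith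
    then have "\<bar>h x - f x\<bar> / lam \<le> (B + Bf) / lam" using lam by (intro divide_right_mono) auto
    moreover have "\<bar>(h x - f x) / lam\<bar> = \<bar>h x - f x\<bar> / lam" using lam by simp
    ultimately show ?thesis unfolding rate_def using CH[of x] by linarith
  qed
  then show thesis by (rule that)
qed

lemma rate_path:
  assumes \<gamma>: "\<gamma> \<in> AC_paths" and f: "f \<in> Ccc_smooth"
  shows "continuous_on {0..\<tau>} (\<lambda>s. rate f (\<gamma> s))"
  by (rule continuous_on_compose2[OF rate_continuous[OF f] continuous_on_subset[OF AC_path_FTC(1)[OF \<gamma>]]]) auto

lemma rate_path_integrable:
  assumes \<gamma>: "\<gamma> \<in> AC_paths" and f: "f \<in> Ccc_smooth"
  shows "(\<lambda>s. exp (- s / lam) * rate f (\<gamma> s)) integrable_on {0..\<tau>}"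
  by (intro integrable_continuous_real continuous_intros rate_path[OF \<gamma> f]) (use lam in auto)

text \<open>The chain rule integrates the derivative of \<open>f\<close> along the path, and Young's
  inequality bounds derivative minus cost by the Hamiltonian, for every velocity.\<close>

lemma integral_running_le_rate:
  assumes \<gamma>: "\<gamma> \<in> AC_paths" and f: "f \<in> Ccc_smooth" and \<tau>: "\<tau> \<ge> 0"
    and int: "running lam h \<gamma> integrable_on {0..\<tau>}"
  shows "integral {0..\<tau>} (running lam h \<gamma>) + exp (- \<tau> / lam) * f (\<gamma> \<tau>) - f (\<gamma> 0)
    \<le> integral {0..\<tau>} (\<lambda>s. exp (- s / lam) * rate f (\<gamma> s))"
proof -
  note sum = has_integral_add[OF integrable_integral[OF int] AC_path_discounted_chain_rule[OF \<gamma> f \<tau> lam]]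
  have "integral {0..\<tau>} (running lam h \<gamma>) + (exp (- \<tau> / lam) * f (\<gamma> \<tau>) - f (\<gamma> 0))
    \<le> integral {0..\<tau>} (\<lambda>s. exp (- s / lam) * rate f (\<gamma> s))"
  proof (rule has_integral_le[OF sum integrable_integral[OF rate_path_integrable[OF \<gamma> f]]])
    fix s
    have "h (\<gamma> s) / lam - cost \<gamma> s + (vector_derivative \<gamma> (at s) \<bullet> grad f (\<gamma> s) - f (\<gamma> s) / lam) \<le> rate f (\<gamma> s)"
      using Young[of "grad f (\<gamma> s)" "vector_derivative \<gamma> (at s)" "\<gamma> s"]
      by (simp add: rate_def cost_def inner_commute diff_divide_distrib)
    then have "exp (- s / lam) * (h (\<gamma> s) / lam - cost \<gamma> s + (vector_derivative \<gamma> (at s) \<bullet> grad f (\<gamma> s) - f (\<gamma> s) / lam))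
      \<le> exp (- s / lam) * rate f (\<gamma> s)" by (intro mult_left_mono) auto
    then show "running lam h \<gamma> s + exp (- s / lam) * (vector_derivative \<gamma> (at s) \<bullet> grad f (\<gamma> s) - f (\<gamma> s) / lam) \<le> exp (- s / lam) * rate f (\<gamma> s)"
      by (simp only: running_def distrib_left)
  qed
  then show ?thesis by simp
qed

text \<open>The reverse estimate along polygons, where Young's inequality fails to be an equality by
  at most \<open>e\<close> per unit time.\<close>

lemma integral_running_ge_rate:
  assumes \<gamma>: "\<gamma> \<in> AC_paths" and f: "f \<in> Ccc_smooth" and \<tau>: "\<tau> \<ge> 0" and e: "e \<ge> 0"
    and int: "running lam h \<gamma> integrable_on {0..\<tau>}" and N: "negligible N"
    and ineq: "\<And>s. s \<ge> 0 \<Longrightarrow> s \<notin> N \<Longrightarrow> H (\<gamma> s) (grad f (\<gamma> s)) + cost \<gamma> s - e \<le> vector_derivative \<gamma> (at s) \<bullet> grad f (\<gamma> s)"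
  shows "integral {0..\<tau>} (\<lambda>s. exp (- s / lam) * rate f (\<gamma> s)) - e * \<tau>
    \<le> integral {0..\<tau>} (running lam h \<gamma>) + exp (- \<tau> / lam) * f (\<gamma> \<tau>) - f (\<gamma> 0)"
proof -
  let ?l = "\<lambda>s. exp (- s / lam) * rate f (\<gamma> s) - e"
  let ?r = "\<lambda>s. running lam h \<gamma> s + exp (- s / lam) * (vector_derivative \<gamma> (at s) \<bullet> grad f (\<gamma> s) - f (\<gamma> s) / lam)"
  let ?r' = "\<lambda>s. if s \<in> N then ?l s else ?r s"
  note sum = has_integral_add[OF integrable_integral[OF int] AC_path_discounted_chain_rule[OF \<gamma> f \<tau> lam]]
  have r': "(?r' has_integral (integral {0..\<tau>} (running lam h \<gamma>) + (exp (- \<tau> / lam) * f (\<gamma> \<tau>) - f (\<gamma> 0)))) {0..\<tau>}"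
    by (rule has_integral_spike[OF N _ sum]) auto
  have l: "(?l has_integral (integral {0..\<tau>} (\<lambda>s. exp (- s / lam) * rate f (\<gamma> s)) - e * \<tau>)) {0..\<tau>}"
    using has_integral_diff[OF integrable_integral[OF rate_path_integrable[OF \<gamma> f]] has_integral_const_real[of e 0 \<tau>]] \<tau>
    by (simp add: mult.commute)
  have "integral {0..\<tau>} (\<lambda>s. exp (- s / lam) * rate f (\<gamma> s)) - e * \<tau> \<le>
    integral {0..\<tau>} (running lam h \<gamma>) + (exp (- \<tau> / lam) * f (\<gamma> \<tau>) - f (\<gamma> 0))"
  proof (rule has_integral_le[OF l r'])
    fix s assume s: "s \<in> {0..\<tau>}"
    show "?l s \<le> ?r' s"
    proof (cases "s \<in> N")
      case False
      let ?E = "exp (- s / lam)"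
      have "H (\<gamma> s) (grad f (\<gamma> s)) + cost \<gamma> s - e \<le> vector_derivative \<gamma> (at s) \<bullet> grad f (\<gamma> s)"
        using ineq False s by simp
      then have "rate f (\<gamma> s) - e \<le> h (\<gamma> s) / lam - cost \<gamma> s + (vector_derivative \<gamma> (at s) \<bullet> grad f (\<gamma> s) - f (\<gamma> s) / lam)"
        by (simp add: rate_def diff_divide_distrib)
      then have "?E * (rate f (\<gamma> s) - e) \<le> ?E * (h (\<gamma> s) / lam - cost \<gamma> s + (vector_derivative \<gamma> (at s) \<bullet> grad f (\<gamma> s) - f (\<gamma> s) / lam))"
        by (intro mult_left_mono) auto
      moreover have "?E * e \<le> 1 * e" using s lam e by (intro mult_right_mono) auto
      moreover have "?E * (h (\<gamma> s) / lam - cost \<gamma> s + (vector_derivative \<gamma> (at s) \<bullet> grad f (\<gamma> s) - f (\<gamma> s) / lam)) = ?r s"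
        by (simp only: running_def distrib_left)
      ultimately have "?E * rate f (\<gamma> s) - e \<le> ?r s" unfolding right_diff_distrib[of ?E "rate f (\<gamma> s)" e] by linarith
      then show ?thesis using False by simp
    qed simp
  qed
  then show ?thesis by simp
qed

lemma val_abs_le: "\<bar>val lam h x\<bar> \<le> B + lam"
  using val_bounds[of x] lam by linarith

section \<open>The viscosity inequalities for the value function\<close>

theorem val_subsolution:
  "viscosity_subsolution Ccc_smooth (\<lambda>f x. H x (grad f x)) lam h (val lam h)"
proof (rule viscosity_subsolution_of_approximation[OF usc_continuous[OF val_continuous] val_abs_le h_bdd])
  fix f :: "'a \<Rightarrow> real" assume f: "f \<in> Ccc_smooth"
  show "\<exists>C. \<forall>x. \<bar>H x (grad f x)\<bar> \<le> C" by (rule H_grad_bounded[OF f]) blast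
  let ?U = "\<lambda>x. val lam h x - f x"
  let ?S = "SUP x. ?U x"
  obtain Bf where Bf: "\<And>x. \<bar>f x\<bar> \<le> Bf" by (rule Ccc_smooth_bounded[OF f]) (rule that)
  obtain CG where CG: "\<And>x. \<bar>rate f x\<bar> \<le> CG" by (rule rate_bounded[OF f]) (rule that)
  define BU where "BU = B + lam + Bf"
  have U: "\<bar>?U x\<bar> \<le> BU" for x using val_abs_le[of x] Bf[of x] by (simp add: BU_def)
  show bdd: "bdd_above (range ?U)" by (rule bdd_aboveI2[of _ _ BU]) (use U in \<open>simp add: abs_le_iff\<close>)
  have US: "?U x \<le> ?S" for x by (rule cSUP_upper[OF UNIV_I bdd])
  define C where "C = max (2 + CG + BU / lam) (3 * lam * exp (1 / lam))"
  have "\<exists>x. ?S - C / real (Suc n) \<le> ?U x \<and> val lam h x - lam * H x (grad f x) - h x \<le> C / real (Suc n)" for n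
  proof -
    \<comment> \<open>\<open>\<delta>^2\<close> is lost in choosing \<open>x\<close> and again in
      choosing the path; together they form the slack in
      \<open>discounted_averaging\<close>.\<close>
    define \<delta> where "\<delta> = 1 / real (Suc n)"
    have \<delta>: "0 < \<delta>" "\<delta> \<le> 1" by (simp_all add: \<delta>_def)
    have d2: "\<delta>\<^sup>2 > 0" using \<delta> by simp
    have "?S - \<delta>\<^sup>2 < ?S" using d2 by simp
    then obtain x where x: "?S - \<delta>\<^sup>2 < ?U x" unfolding less_cSUP_iff[OF UNIV_not_empty bdd] by blast
    obtain \<gamma> j where \<gamma>: "\<gamma> \<in> AC_paths" "\<gamma> 0 = x" "has_value lam h \<gamma> j" "val lam h x - \<delta>\<^sup>2 < j"
      by (rule val_near_optimal[OF d2])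
    obtain t where t: "?S - (2 + CG + BU / lam) * \<delta> \<le> ?U (\<gamma> t)" "?S - 3 * lam * exp (1 / lam) * \<delta> \<le> lam * rate f (\<gamma> t)"
    proof (rule discounted_averaging[of ?U ?S BU "rate f" CG \<delta> \<gamma> lam, OF US U CG rate_path[OF \<gamma>(1) f] lam \<delta>])
      fix \<tau> :: real assume \<tau>: "0 \<le> \<tau>" "\<tau> \<le> \<delta>"
      have int: "running lam h \<gamma> integrable_on {0..\<tau>}" using \<gamma>(3) \<tau> by (simp add: has_value_def)
      show "?S - 2 * \<delta>\<^sup>2 \<le> exp (- \<tau> / lam) * ?U (\<gamma> \<tau>) + integral {0..\<tau>} (\<lambda>t. exp (- t / lam) * rate f (\<gamma> t))"
        using dynamic_programming_le[OF \<gamma>(1,3) \<tau>(1)] integral_running_le_rate[OF \<gamma>(1) f \<tau>(1) int] x \<gamma>(2,4)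
        by (simp add: right_diff_distrib)
    qed (rule that)
    have "(2 + CG + BU / lam) * \<delta> \<le> C * \<delta>" "3 * lam * exp (1 / lam) * \<delta> \<le> C * \<delta>"
      using \<delta> by (auto simp: C_def intro!: mult_right_mono)
    moreover have "lam * rate f (\<gamma> t) = h (\<gamma> t) - f (\<gamma> t) + lam * H (\<gamma> t) (grad f (\<gamma> t))"
      using lam by (simp add: rate_def distrib_left)
    moreover have "C / real (Suc n) = C * \<delta>" by (simp add: \<delta>_def)
    ultimately show ?thesis using t US[of "\<gamma> t"] by (intro exI[of _ "\<gamma> t"]) linarith
  qed
  then show "\<exists>C. \<forall>n. \<exists>x. ?S - C / real (Suc n) \<le> ?U x \<and> val lam h x - lam * H x (grad f x) - h x \<le> C / real (Suc n)" by blast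
qed

theorem val_supersolution:
  "viscosity_supersolution Ccc_smooth (\<lambda>f x. H x (grad f x)) lam h (val lam h)"
proof (rule iffD2[OF supersolution_iff_subsolution_dual])
  show "viscosity_subsolution Ccc_smooth (\<lambda>f x. - H x (grad (\<lambda>y. - f y) x)) lam (\<lambda>x. - h x) (\<lambda>x. - val lam h x)"
  proof (rule viscosity_subsolution_of_approximation)
    show "usc (\<lambda>x. - val lam h x)" by (intro usc_continuous continuous_on_minus val_continuous)
    show "\<bar>- val lam h x\<bar> \<le> B + lam" for x using val_abs_le[of x] by simp
    show "\<bar>- h x\<bar> \<le> B" for x using h_bdd[of x] by simp
    fix f0 :: "'a \<Rightarrow> real" assume f0: "f0 \<in> Ccc_smooth"
    define f where "f = (\<lambda>y. - f0 y)"
    have f: "f \<in> Ccc_smooth" unfolding f_def by (rule Ccc_smooth_uminus[OF f0])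
    have ff: "- val lam h x - f0 x = f x - val lam h x" for x by (simp add: f_def)
    show "\<exists>C. \<forall>x. \<bar>- H x (grad (\<lambda>y. - f0 y) x)\<bar> \<le> C"
      unfolding f_def[symmetric] abs_minus_cancel by (rule H_grad_bounded[OF f]) blast
    let ?U = "\<lambda>x. f x - val lam h x"
    let ?S = "SUP x. ?U x"
    obtain Bf where Bf: "\<And>x. \<bar>f x\<bar> \<le> Bf" by (rule Ccc_smooth_bounded[OF f]) (rule that)
    obtain CG where CG: "\<And>x. \<bar>rate f x\<bar> \<le> CG" by (rule rate_bounded[OF f]) (rule that)
    define BU where "BU = B + lam + Bf"
    have U: "\<bar>?U x\<bar> \<le> BU" for x using val_abs_le[of x] Bf[of x] by (simp add: BU_def)
    have bdd: "bdd_above (range ?U)" by (rule bdd_aboveI2[of _ _ BU]) (use U in \<open>simp add: abs_le_iff\<close>)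
    then show "bdd_above (range (\<lambda>x. - val lam h x - f0 x))" unfolding ff .
    have US: "?U x \<le> ?S" for x by (rule cSUP_upper[OF UNIV_I bdd])
    define C where "C = max (2 + CG + BU / lam) (3 * lam * exp (1 / lam))"
    have "\<exists>x. ?S - C / real (Suc n) \<le> ?U x \<and> - val lam h x - lam * - H x (grad f x) - - h x \<le> C / real (Suc n)" for n
    proof -
      define \<delta> where "\<delta> = 1 / real (Suc n)"
      have \<delta>: "0 < \<delta>" "\<delta> \<le> 1" by (simp_all add: \<delta>_def)
      have d2: "\<delta>\<^sup>2 > 0" using \<delta> by simp
      have "?S - \<delta>\<^sup>2 < ?S" using d2 by simp
      then obtain x where x: "?S - \<delta>\<^sup>2 < ?U x" unfolding less_cSUP_iff[OF UNIV_not_empty bdd] by blast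
      \<comment> \<open>Here the second \<open>\<delta>^2\<close> is the rate at which the polygon
        misses equality, over a time of at most 1.\<close>
      obtain \<gamma> N where \<gamma>: "\<gamma> \<in> AC_paths" "\<gamma> 0 = x" "negligible N"
        "\<And>s. s \<ge> 0 \<Longrightarrow> s \<notin> N \<Longrightarrow> H (\<gamma> s) (grad f (\<gamma> s)) + cost \<gamma> s - \<delta>\<^sup>2 \<le> vector_derivative \<gamma> (at s) \<bullet> grad f (\<gamma> s)"
        by (rule euler_path[OF f d2]) (rule that)
      have cont: "continuous_on {0..\<delta>} (\<lambda>s. - rate f (\<gamma> s))" by (intro continuous_on_minus rate_path \<gamma>(1) f)
      have CG': "\<bar>- rate f x\<bar> \<le> CG" for x using CG[of x] by simp
      obtain t where t: "?S - (2 + CG + BU / lam) * \<delta> \<le> ?U (\<gamma> t)" "?S - 3 * lam * exp (1 / lam) * \<delta> \<le> lam * - rate f (\<gamma> t)"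
      proof (rule discounted_averaging[of ?U ?S BU "\<lambda>x. - rate f x" CG \<delta> \<gamma> lam, OF US U CG' cont lam \<delta>])
        fix \<tau> :: real assume \<tau>: "0 \<le> \<tau>" "\<tau> \<le> \<delta>"
        have int: "running lam h \<gamma> integrable_on {0..\<tau>}"
          by (rule running_integrable[OF \<gamma>(1) f \<gamma>(3) \<tau>(1) \<gamma>(4)])
        have "\<delta>\<^sup>2 * \<tau> \<le> \<delta>\<^sup>2 * 1" using \<tau> \<delta> by (intro mult_left_mono) auto
        moreover have "integral {0..\<tau>} (\<lambda>t. exp (- t / lam) * - rate f (\<gamma> t)) = - integral {0..\<tau>} (\<lambda>t. exp (- t / lam) * rate f (\<gamma> t))"
          by simp
        moreover have "exp (- \<tau> / lam) * ?U (\<gamma> \<tau>) = exp (- \<tau> / lam) * f (\<gamma> \<tau>) - exp (- \<tau> / lam) * val lam h (\<gamma> \<tau>)"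
          by (rule right_diff_distrib)
        moreover note dynamic_programming_ge[OF \<gamma>(1) int \<tau>(1), unfolded \<gamma>(2)]
          integral_running_ge_rate[OF \<gamma>(1) f \<tau>(1) less_imp_le[OF d2] int \<gamma>(3,4), unfolded \<gamma>(2)] x
        ultimately show "?S - 2 * \<delta>\<^sup>2 \<le> exp (- \<tau> / lam) * ?U (\<gamma> \<tau>) + integral {0..\<tau>} (\<lambda>t. exp (- t / lam) * - rate f (\<gamma> t))"
          by linarith
      qed (rule that)
      have "(2 + CG + BU / lam) * \<delta> \<le> C * \<delta>" "3 * lam * exp (1 / lam) * \<delta> \<le> C * \<delta>"
        using \<delta> by (auto simp: C_def intro!: mult_right_mono)
      moreover have "lam * - rate f (\<gamma> t) = - (lam * rate f (\<gamma> t))" by simp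
      moreover have "lam * rate f (\<gamma> t) = h (\<gamma> t) - f (\<gamma> t) + lam * H (\<gamma> t) (grad f (\<gamma> t))"
        using lam by (simp add: rate_def distrib_left)
      moreover have "lam * - H (\<gamma> t) (grad f (\<gamma> t)) = - (lam * H (\<gamma> t) (grad f (\<gamma> t)))" by simp
      moreover have "C / real (Suc n) = C * \<delta>" by (simp add: \<delta>_def)
      ultimately show ?thesis using t US[of "\<gamma> t"] by (intro exI[of _ "\<gamma> t"]) linarith
    qed
    then show "\<exists>C. \<forall>n. \<exists>x. (SUP y. - val lam h y - f0 y) - C / real (Suc n) \<le> - val lam h x - f0 x \<and>
        - val lam h x - lam * - H x (grad (\<lambda>y. - f0 y) x) - - h x \<le> C / real (Suc n)"
      unfolding ff f_def[symmetric] by blast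
  qed
qed (rule Ccc_smooth_uminus)

text \<open>Paths with functional minus infinity do not affect the supremum; on all others the
  functional is the value in the sense of \<open>has_value\<close>.\<close>

theorem discounted_SUP_eq_val:
  "(SUP \<gamma>\<in>{\<gamma>\<in>AC_paths. \<gamma> 0 = x}.
     ereal_integral {0..} (\<lambda>t. ereal (inverse lam * exp (- inverse lam * t)) *
       (ereal (h (\<gamma> t)) - ereal_integral {0..t} (\<lambda>s. ereal (cost \<gamma> s))))) = ereal (val lam h x)"
    (is "(SUP \<gamma>\<in>?P. ?E \<gamma>) = _")
proof (rule SUP_eqI)
  fix \<gamma> assume "\<gamma> \<in> ?P"
  then have \<gamma>: "\<gamma> \<in> AC_paths" "\<gamma> 0 = x" by auto
  from discounted_functional_cases[OF \<gamma>(1) h_cont h_bdd lam] show "?E \<gamma> \<le> ereal (val lam h x)"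
  proof (elim disjE exE conjE)
    fix j assume j: "has_value lam h \<gamma> j" "?E \<gamma> = ereal j"
    show ?thesis unfolding j(2) using val_upper[OF \<gamma>(1) j(1)] \<gamma>(2) by simp
  next
    assume "?E \<gamma> = - \<infinity>"
    then show ?thesis by (simp only: ereal_less_eq)
  qed
next
  fix y assume y: "\<And>\<gamma>. \<gamma> \<in> ?P \<Longrightarrow> ?E \<gamma> \<le> y"
  have yj: "ereal j \<le> y" if \<gamma>: "\<gamma> \<in> AC_paths" "\<gamma> 0 = x" and j: "has_value lam h \<gamma> j" for \<gamma> j
  proof -
    from discounted_functional_cases[OF \<gamma>(1) h_cont h_bdd lam] obtain j' where "has_value lam h \<gamma> j'" "?E \<gamma> = ereal j'"
      using j by blast
    then show ?thesis using y[of \<gamma>] \<gamma> has_value_unique[OF j] by auto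
  qed
  obtain \<gamma>0 j0 where \<gamma>0: "\<gamma>0 \<in> AC_paths" "\<gamma>0 0 = x" "has_value lam h \<gamma>0 j0" by (rule exists_value) (rule that)
  show "ereal (val lam h x) \<le> y"
  proof (cases y)
    case (real z)
    have "val lam h x \<le> z" unfolding val_def
      by (rule cSup_least) (use \<gamma>0 yj real in auto)
    then show ?thesis using real by simp
  qed (use yj[OF \<gamma>0] in auto)
qed

end

end

theorem proposition5p1:
  fixes a :: "real ^ 'd \<Rightarrow> 'j::finite \<Rightarrow> real ^ 'd ^ 'd"
    and b :: "real ^ 'd \<Rightarrow> 'j \<Rightarrow> real ^ 'd"
    and r :: "'j \<Rightarrow> 'j \<Rightarrow> real ^ 'd \<Rightarrow> real"
  assumes r_nonneg: "\<And>i j x. r i j x \<ge> 0"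
    and r_cont: "\<And>i j. continuous_on UNIV (r i j)"
    and r_irred: "\<And>x. irreducible_matrix (rate_matrix r x)"
    and r_pos: "\<And>i j. (\<forall>x. r i j x = 0) \<or>
                  (\<forall>K. compact K \<longrightarrow> (INF x\<in>K. ereal (r i j x)) > 0)"
    and a_cont: "\<And>i. continuous_on UNIV (\<lambda>x. a x i)"
    and b_cont: "\<And>i. continuous_on UNIV (\<lambda>x. b x i)"
    and a_lower: "\<And>K. compact K \<Longrightarrow>
          (INF (x, i, p)\<in>K \<times> UNIV \<times> sphere 0 1. ereal ((a x i *v p) \<bullet> p)) > 0"
    and a_upper: "\<And>K. compact K \<Longrightarrow>
          (SUP (x, i, p)\<in>K \<times> UNIV \<times> sphere 0 1. ereal ((a x i *v p) \<bullet> p)) < \<infinity>"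
    and b_upper: "\<And>K. compact K \<Longrightarrow>
          (SUP (x, i, p)\<in>K \<times> UNIV \<times> sphere 0 1. ereal \<bar>b x i \<bullet> p\<bar>) < \<infinity>"
    and a_Lipschitz: "\<exists>L>0. \<forall>x y i. norm (a x i - a y i) \<le> L * norm (x - y)"
    and b_one_sided: "one_sided_Lipschitz b"
  shows "(\<forall>f\<in>Ccc_smooth. continuous_on UNIV (H_op a b r f)) \<and>
    (\<forall>h\<in>bcontfun. \<forall>lam>0. comparison_principle Ccc_smooth (H_op a b r) lam h) \<and>
    (\<forall>h\<in>bcontfun. \<forall>lam>0. \<exists>u. (\<forall>x. ereal (u x) = resolvent a b r lam h x) \<and>
       viscosity_solution Ccc_smooth (H_op a b r) lam h u \<and>
       (\<forall>v. viscosity_solution Ccc_smooth (H_op a b r) lam h v \<longrightarrow> v = u))"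
proof -
  interpret m: switching_model a b r
    by unfold_locales (fact r_nonneg r_cont r_pos a_cont b_cont a_lower a_Lipschitz b_one_sided)+
  let ?H = "Hamiltonian a b r"
  have op: "H_op a b r = (\<lambda>f x. ?H x (grad f x))" by (simp add: H_op_def fun_eq_iff)
  have bc: "continuous_on UNIV h" "\<exists>B. \<forall>x. \<bar>h x\<bar> \<le> B" if "h \<in> bcontfun" for h :: "real ^ 'd \<Rightarrow> real"
    using that by (auto simp: bcontfun_def bounded_iff)
  have comparison: "u x \<le> v x"
    if h: "h \<in> bcontfun" and "lam > 0" "viscosity_subsolution Ccc_smooth (H_op a b r) lam h u"
      "viscosity_supersolution Ccc_smooth (H_op a b r) lam h v" for h lam u v x
  proof -
    obtain B where B: "\<And>x. \<bar>h x\<bar> \<le> B" using bc(2)[OF h] by blast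
    show ?thesis by (rule m.comparison[OF bc(1)[OF h] B that(2-4)[unfolded op]])
  qed
  have "\<exists>u. (\<forall>x. ereal (u x) = resolvent a b r lam h x) \<and>
       viscosity_solution Ccc_smooth (H_op a b r) lam h u \<and>
       (\<forall>v. viscosity_solution Ccc_smooth (H_op a b r) lam h v \<longrightarrow> v = u)"
    if h: "h \<in> bcontfun" and lam: "lam > 0" for h lam
  proof -
    obtain B where B: "\<And>x. \<bar>h x\<bar> \<le> B" using bc(2)[OF h] by blast
    note hyps = lam bc(1)[OF h] B
    have "ereal (m.val lam h x) = resolvent a b r lam h x" for x
      using m.discounted_SUP_eq_val[OF hyps, of x]
      unfolding resolvent_def Lagrangian_def m.Lagrangian_SUP m.cost_def by (rule sym)
    moreover have sol: "viscosity_solution Ccc_smooth (H_op a b r) lam h (m.val lam h)"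
      unfolding op viscosity_solution_def using m.val_subsolution[OF hyps] m.val_supersolution[OF hyps] by blast
    moreover have "v = m.val lam h" if v: "viscosity_solution Ccc_smooth (H_op a b r) lam h v" for v
    proof
      fix x
      show "v x = m.val lam h x"
        using v sol comparison[OF h lam] unfolding viscosity_solution_def by (meson antisym)
    qed
    ultimately show ?thesis by (intro exI[of _ "m.val lam h"] conjI allI impI)
  qed
  moreover have "\<forall>f\<in>Ccc_smooth. continuous_on UNIV (H_op a b r f)"
    unfolding op using m.H_grad_continuous by blast
  moreover have "\<forall>h\<in>bcontfun. \<forall>lam>0. comparison_principle Ccc_smooth (H_op a b r) lam h"
    unfolding comparison_principle_def using comparison by blast
  ultimately show ?thesis by blast
qed

end
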